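(* Let $\Sigma$ be a finite set and $L_I\subset\Sigma^{\ast}$ a regular language such that the state space $A(-)$ of $L_I$ is a projective $\mathbb{B}$-semimodule (equivalently, the finite lattice obtained from the semilattice $A(-)$ is distributive). Let $L_{\circ}$ be the circular language associated to $L_I$ via a decomposition of the identity, and let $\alpha=(L_I,L_{\circ})$ be the corresponding evaluation. Then $\mathcal{C}_{\alpha}$ is a $\mathbb{B}$-valued one-dimensional TQFT with defects; that is, the state spaces $A(\varepsilon)=\mathrm{Hom}_{\mathcal{C}_\alpha}(\emptyset,\varepsilon)$ define a symmetric monoidal functor from $\mathcal{C}_\Sigma$ to $\mathbb{B}$-semimodules, and there are natural isomorphisms (induced by disjoint union of cobordisms and by duality) $$A(\varepsilon)\cong A(\varepsilon_1)\otimes\cdots\otimes A(\varepsilon_n)$$ for every sign sequence $\varepsilon=(\varepsilon_1,\dots,\varepsilon_n)$, $\varepsilon_i\in\{+,-\}$, and $$\mathrm{Hom}_{\mathcal{C}_{\alpha}}(\varepsilon,\varepsilon')\cong A(\varepsilon^{\ast}\varepsilon')\cong A(\varepsilon^{\ast})\otimes A(\varepsilon')$$ for all sign sequences $\varepsilon,\varepsilon'$.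
   Context: **Semimodules.** $\mathbb{B}=\{0,1\mid 1+1=1\}$ is the Boolean semiring. A $\mathbb{B}$-semimodule is a commutative monoid $(M,+,0)$ with $a+a=a$ for all $a$; maps preserve $+$ and $0$. Equivalently it is a join-semilattice with least element $0$ ($a\le b\Leftrightarrow a+b=b$); a finite one is automatically a lattice. $P$ is projective if for every surjective semimodule map $M\to N$ the map $\mathrm{Hom}(P,M)\to\mathrm{Hom}(P,N)$ is surjective. The tensor product $M\otimes N$ is the $\mathbb{B}$-semimodule universal for maps $M\times N\to K$ that are semimodule homomorphisms in each variable. **Languages.** $\Sigma^{\ast}$ is the set of words in $\Sigma$; $\Sigma^{\ast}_{\circ}$ is the quotient of $\Sigma^{\ast}$ by $\omega_1\omega_2\sim\omega_2\omega_1$ (circular words). A language is a subset $L_I\subset\Sigma^{\ast}$ with characteristic function $\alpha_I:\Sigma^{\ast}\to\mathbb{B}$; a circular language is a subset $L_\circ\subset\Sigma^{\ast}_\circ$ with characteristic function $\alpha_\circ$. **Cobordism category $\mathcal{C}_\Sigma$.** Objects are finite sequences $\varepsilon$ of signs $\pm$ (the empty sequence is $\emptyset$). A morphism $\varepsilon\to\varepsilon'$ is an oriented compact one-dimensional cobordism from $\varepsilon$ (bottom) to $\varepsilon'$ (top), with finitely many interior points labelled by elements of $\Sigma$; in addition to outer endpoints (matching the signs of $\varepsilon,\varepsilon'$) components may have inner ("floating") endpoints strictly inside the cobordism. Cobordisms are taken up to diffeomorphism rel outer boundary. Composition is concatenation, tensor product is placing side by side (concatenation of sequences on objects). This is a rigid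 symmetric monoidal category; the dual $\varepsilon^{\ast}$ is obtained by reversing the order and all signs. An endomorphism of $\emptyset$ is a disjoint union of intervals $I(\omega)$, $\omega\in\Sigma^{\ast}$, and circles $S(\omega)$, $\omega\in\Sigma^{\ast}_\circ$, where $\omega$ is read along the orientation. **Evaluation and $\mathcal{C}_\alpha$.** A pair $\alpha=(L_I,L_\circ)$ gives a multiplicative evaluation of closed cobordisms: $\alpha(I(\omega))=\alpha_I(\omega)$, $\alpha(S(\omega))=\alpha_\circ(\omega)$, $\alpha(U\sqcup V)=\alpha(U)\alpha(V)$, $\alpha(\text{empty})=1$. $\mathcal{C}_\alpha$ has the same objects as $\mathcal{C}_\Sigma$; $\mathrm{Hom}_{\mathcal{C}_\alpha}(\varepsilon,\varepsilon')$ is the quotient of the free $\mathbb{B}$-semimodule on $\mathrm{Hom}_{\mathcal{C}_\Sigma}(\varepsilon,\varepsilon')$ by the relation $\sum_i f_i\sim\sum_j g_j$ iff $\sum_i\alpha(\mathrm{cl}(f_i,h))=\sum_j\alpha(\mathrm{cl}(g_j,h))$ for every cobordism $h:\varepsilon'\to\varepsilon$, where $\mathrm{cl}(f,h)$ is the closed cobordism obtained by gluing $f$ and $h$ along all outer endpoints. The state space of $\varepsilon$ is $A(\varepsilon)=\mathrm{Hom}_{\mathcal{C}_\alpha}(\emptyset,\varepsilon)$. The spaces $A(-)$ and $A(+)$ depend only on $L_I$: $A(-)$ is the quotient of the free $\mathbb{B}$-semimodule $\mathbb{B}[\Sigma^{\ast}]$ by $\sum_i\omega_i\sim\sum_j\omega_j'$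 iff $\sum_i\alpha_I(\omega_i u)=\sum_j\alpha_I(\omega'_j u)$ for all $u\in\Sigma^{\ast}$, and $A(+)$ is defined in the same way using $\alpha_I(u\omega_i)$, $\alpha_I(u\omega_j')$. **Decomposition of the identity and the associated circular language.** A decomposition of the identity for $L_I$ is a finite collection of pairs of words $(u_i,v_i)$, $i=1,\dots,m$, with $\alpha_I(xy)=\sum_{i=1}^m\alpha_I(xu_i)\alpha_I(v_iy)$ for all $x,y\in\Sigma^{\ast}$. It exists when $A(-)$ is projective. The associated circular language is $L_\circ=\{\omega : \sum_{i=1}^m\alpha_I(v_i\omega u_i)=1\}$, i.e. the evaluation of a circle carrying $\omega$ is obtained by cutting the circle at any place and inserting the decomposition $\sum_i u_i\otimes v_i$. **TQFT.** A $\mathbb{B}$-valued one-dimensional TQFT with defects is a symmetric monoidal functor from $\mathcal{C}_\Sigma$ to the category of $\mathbb{B}$-semimodules with $\otimes$. Here the functor sends $\varepsilon$ to $A(\varepsilon)$ and a cobordism to the map induced by composition. *)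

theory Defs
  imports "HOL-Algebra.FiniteProduct" "HOL-Library.Multiset"
begin

section \<open>Semimodules over the Boolean semiring\<close>

text \<open>
  A semimodule over the Boolean semiring is an idempotent commutative monoid. It is modelled by
  the library's carrier-based commutative monoids, so that the semimodule operations $+$ and $0$
  are the record fields \<open>mult\<close> and \<open>one\<close>. The Boolean semiring itself is the type
  \<^typ>\<open>bool\<close>: sums are disjunctions (existential quantifiers), products are conjunctions.
\<close>

definition B_semimodule :: "('m, 'z) monoid_scheme \<Rightarrow> bool" where
  "B_semimodule M \<longleftrightarrow> comm_monoid M \<and> (\<forall>x\<in>carrier M. x \<otimes>\<^bsub>M\<^esub> x = x)"

definition bhom :: "('m, 'y) monoid_scheme \<Rightarrow> ('n, 'z) monoid_scheme \<Rightarrow> ('m \<Rightarrow> 'n) set" where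
  "bhom M N = {h \<in> hom M N. h \<one>\<^bsub>M\<^esub> = \<one>\<^bsub>N\<^esub>}"

definition biso :: "('m, 'y) monoid_scheme \<Rightarrow> ('n, 'z) monoid_scheme \<Rightarrow> ('m \<Rightarrow> 'n) set" where
  "biso M N = {h \<in> bhom M N. bij_betw h (carrier M) (carrier N)}"

definition Bool :: "bool monoid" where
  "Bool = \<lparr>carrier = UNIV, monoid.mult = (\<or>), one = False\<rparr>"

text \<open>
  HOL cannot quantify over all semimodules of all types inside a definition. The test semimodules
  are carried by \<^typ>\<open>'p set\<close>, which is large enough to contain the free semimodule on the carrier
  of \<open>P\<close>; lemma \<open>projective_lift\<close> below recovers the lifting property against surjections between
  semimodules of arbitrary types.
\<close>

definition projective :: "('p, 'z) monoid_scheme \<Rightarrow> bool" where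
  "projective P \<longleftrightarrow> B_semimodule P \<and>
     (\<forall>(M :: 'p set monoid) (N :: 'p set monoid). \<forall>p\<in>bhom M N. \<forall>f\<in>bhom P N.
        B_semimodule M \<longrightarrow> B_semimodule N \<longrightarrow> p ` carrier M = carrier N \<longrightarrow>
          (\<exists>g\<in>bhom P M. \<forall>x\<in>carrier P. p (g x) = f x))"


subsection \<open>Quotients of free semimodules\<close>

text \<open>
  The free semimodule on \<open>X\<close> is \<^term>\<open>Fpow X\<close>, the finite subsets of \<open>X\<close>, with union: a finite sum
  of generators is the set of its summands. \<open>bquot X E\<close> is its quotient by a congruence \<open>E\<close>.
\<close>

definition bquot :: "'x set \<Rightarrow> ('x set \<times> 'x set) set \<Rightarrow> 'x set set monoid" where
  "bquot X E = \<lparr>carrier = Fpow X // E,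
                monoid.mult = (\<lambda>A B. \<Union>S\<in>A. \<Union>T\<in>B. E `` {S \<union> T}),
                one = E `` {{}}\<rparr>"

inductive_set bcong :: "'x set \<Rightarrow> ('x set \<times> 'x set) set \<Rightarrow> ('x set \<times> 'x set) set"
  for X R where
  base: "(S, T) \<in> R \<Longrightarrow> S \<in> Fpow X \<Longrightarrow> T \<in> Fpow X \<Longrightarrow> (S, T) \<in> bcong X R"
| refl: "S \<in> Fpow X \<Longrightarrow> (S, S) \<in> bcong X R"
| sym: "(S, T) \<in> bcong X R \<Longrightarrow> (T, S) \<in> bcong X R"
| trans: "(S, T) \<in> bcong X R \<Longrightarrow> (T, U) \<in> bcong X R \<Longrightarrow> (S, U) \<in> bcong X R"
| union: "(S, T) \<in> bcong X R \<Longrightarrow> U \<in> Fpow X \<Longrightarrow> (S \<union> U, T \<union> U) \<in> bcong X R"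

text \<open>The semimodule with generators \<open>X\<close> and relations \<open>R\<close>.\<close>

definition bpres :: "'x set \<Rightarrow> ('x set \<times> 'x set) set \<Rightarrow> 'x set set monoid" where
  "bpres X R = bquot X (bcong X R)"

definition bgen :: "'x set \<Rightarrow> ('x set \<times> 'x set) set \<Rightarrow> 'x \<Rightarrow> 'x set set" where
  "bgen X R x = bcong X R `` {{x}}"

text \<open>
  The homomorphism from a quotient of a free semimodule to \<open>K\<close> that is given by \<open>\<phi>\<close> on generators
  (meaningful if the sums of \<open>\<phi>\<close> over all representatives of a class agree).
\<close>

definition bext :: "('k, 'z) monoid_scheme \<Rightarrow> ('x \<Rightarrow> 'k) \<Rightarrow> 'x set set \<Rightarrow> 'k" where
  "bext K \<phi> A = the_elem (finprod K \<phi> ` A)"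


subsection \<open>Tensor products\<close>

definition tensor_rel ::
  "('m, 'y) monoid_scheme \<Rightarrow> ('n, 'z) monoid_scheme \<Rightarrow> (('m \<times> 'n) set \<times> ('m \<times> 'n) set) set" where
  "tensor_rel M N =
     {({(a \<otimes>\<^bsub>M\<^esub> b, c)}, {(a, c), (b, c)}) | a b c. a \<in> carrier M \<and> b \<in> carrier M \<and> c \<in> carrier N} \<union>
     {({(\<one>\<^bsub>M\<^esub>, c)}, {}) | c. c \<in> carrier N} \<union>
     {({(a, c \<otimes>\<^bsub>N\<^esub> d)}, {(a, c), (a, d)}) | a c d. a \<in> carrier M \<and> c \<in> carrier N \<and> d \<in> carrier N} \<union>
     {({(a, \<one>\<^bsub>N\<^esub>)}, {}) | a. a \<in> carrier M}"

definition tensor ::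
  "('m, 'y) monoid_scheme \<Rightarrow> ('n, 'z) monoid_scheme \<Rightarrow> ('m \<times> 'n) set set monoid" where
  "tensor M N = bpres (carrier M \<times> carrier N) (tensor_rel M N)"

definition pure ::
  "('m, 'y) monoid_scheme \<Rightarrow> ('n, 'z) monoid_scheme \<Rightarrow> 'm \<Rightarrow> 'n \<Rightarrow> ('m \<times> 'n) set set" where
  "pure M N x y = bgen (carrier M \<times> carrier N) (tensor_rel M N) (x, y)"

text \<open>The homomorphism out of a tensor product induced by a map \<open>b\<close> that is bilinear.\<close>

definition tensor_lift ::
  "('k, 'z) monoid_scheme \<Rightarrow> ('m \<Rightarrow> 'n \<Rightarrow> 'k) \<Rightarrow> ('m \<times> 'n) set set \<Rightarrow> 'k" where
  "tensor_lift K b = bext K (\<lambda>(x, y). b x y)"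

text \<open>\<open>tensor_map M' N' f g\<close> is $f \otimes g$, where \<open>M'\<close>, \<open>N'\<close> are the codomains of \<open>f\<close>, \<open>g\<close>.\<close>

definition tensor_map ::
  "('m1, 'y) monoid_scheme \<Rightarrow> ('n1, 'z) monoid_scheme \<Rightarrow> ('m \<Rightarrow> 'm1) \<Rightarrow> ('n \<Rightarrow> 'n1) \<Rightarrow>
   ('m \<times> 'n) set set \<Rightarrow> ('m1 \<times> 'n1) set set" where
  "tensor_map M' N' f g = tensor_lift (tensor M' N') (\<lambda>x y. pure M' N' (f x) (g y))"

definition tensor_assoc ::
  "('m, 'x) monoid_scheme \<Rightarrow> ('n, 'y) monoid_scheme \<Rightarrow> ('k, 'z) monoid_scheme \<Rightarrow>
   (('m \<times> 'n) set set \<times> 'k) set set \<Rightarrow> ('m \<times> ('n \<times> 'k) set set) set set" where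
  "tensor_assoc M N K =
     tensor_lift (tensor M (tensor N K))
       (\<lambda>t z. tensor_lift (tensor M (tensor N K)) (\<lambda>x y. pure M (tensor N K) x (pure N K y z)) t)"

definition tensor_swap ::
  "('m, 'y) monoid_scheme \<Rightarrow> ('n, 'z) monoid_scheme \<Rightarrow> ('m \<times> 'n) set set \<Rightarrow> ('n \<times> 'm) set set" where
  "tensor_swap M N = tensor_lift (tensor N M) (\<lambda>x y. pure N M y x)"

definition tensor_lunit :: "('m, 'y) monoid_scheme \<Rightarrow> (bool \<times> 'm) set set \<Rightarrow> 'm" where
  "tensor_lunit M = tensor_lift M (\<lambda>c x. if c then x else \<one>\<^bsub>M\<^esub>)"

definition tensor_runit :: "('m, 'y) monoid_scheme \<Rightarrow> ('m \<times> bool) set set \<Rightarrow> 'm" where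
  "tensor_runit M = tensor_lift M (\<lambda>x c. if c then x else \<one>\<^bsub>M\<^esub>)"

text \<open>
  The tensor product of a list of semimodules, universal for multilinear maps. It is not obtained
  by iterating \<^const>\<open>tensor\<close>, since the type of the iterated product would depend on the length of
  the list. The empty product is the Boolean semiring (the free semimodule on one generator).
\<close>

definition tuples :: "'m monoid list \<Rightarrow> 'm list set" where
  "tuples Ms = {xs. length xs = length Ms \<and> (\<forall>i<length Ms. xs ! i \<in> carrier (Ms ! i))}"

definition ntensor_rel :: "'m monoid list \<Rightarrow> ('m list set \<times> 'm list set) set" where
  "ntensor_rel Ms =
     {({xs[i := a \<otimes>\<^bsub>Ms ! i\<^esub> b]}, {xs[i := a], xs[i := b]}) | xs i a b.
        xs \<in> tuples Ms \<and> i < length Ms \<and> a \<in> carrier (Ms ! i) \<and> b \<in> carrier (Ms ! i)} \<union>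
     {({xs[i := \<one>\<^bsub>Ms ! i\<^esub>]}, {}) | xs i. xs \<in> tuples Ms \<and> i < length Ms}"

definition ntensor :: "'m monoid list \<Rightarrow> 'm list set set monoid" where
  "ntensor Ms = bpres (tuples Ms) (ntensor_rel Ms)"

definition npure :: "'m monoid list \<Rightarrow> 'm list \<Rightarrow> 'm list set set" where
  "npure Ms = bgen (tuples Ms) (ntensor_rel Ms)"

definition ntensor_map ::
  "'n monoid list \<Rightarrow> ('m \<Rightarrow> 'n) list \<Rightarrow> 'm list set set \<Rightarrow> 'n list set set" where
  "ntensor_map Ns fs = bext (ntensor Ns) (\<lambda>xs. npure Ns (map2 (\<lambda>f x. f x) fs xs))"


subsection \<open>Universal properties\<close>

lemma B_semimoduleD:
  assumes "B_semimodule K"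
  shows "comm_monoid K" "x \<in> carrier K \<Longrightarrow> x \<otimes>\<^bsub>K\<^esub> x = x"
  using assms by (auto simp: B_semimodule_def)

lemma finprod_Un_idem:
  assumes K: "B_semimodule K" and "finite S" "finite T" "\<phi> \<in> S \<union> T \<rightarrow> carrier K"
  shows "finprod K \<phi> (S \<union> T) = finprod K \<phi> S \<otimes>\<^bsub>K\<^esub> finprod K \<phi> T"
proof -
  interpret comm_monoid K using K by (rule B_semimoduleD)
  have abs: "\<phi> a \<otimes>\<^bsub>K\<^esub> finprod K \<phi> U = finprod K \<phi> (insert a U)"
    if "finite U" "\<phi> \<in> insert a U \<rightarrow> carrier K" for a U
  proof (cases "a \<in> U")
    case True
    define V where "V = U - {a}"
    have U: "U = insert a V" "finite V" "a \<notin> V" using True that by (auto simp: V_def)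
    have c: "\<phi> a \<in> carrier K" "\<phi> \<in> V \<rightarrow> carrier K" using that U by auto
    then have "finprod K \<phi> U = \<phi> a \<otimes>\<^bsub>K\<^esub> finprod K \<phi> V" using U by simp
    then show ?thesis using c U B_semimoduleD(2)[OF K c(1)]
      by (simp add: m_assoc[symmetric])
  qed (use that in auto)
  show ?thesis using assms(2,4)
  proof (induction S)
    case empty
    then show ?case by simp
  next
    case (insert a S)
    have c: "\<phi> \<in> S \<rightarrow> carrier K" "\<phi> \<in> T \<rightarrow> carrier K" "\<phi> a \<in> carrier K" using insert by auto
    have "finprod K \<phi> (insert a S \<union> T) = \<phi> a \<otimes>\<^bsub>K\<^esub> finprod K \<phi> (S \<union> T)"
      using abs[of "S \<union> T" a] insert assms(3) by auto
    also have "\<dots> = \<phi> a \<otimes>\<^bsub>K\<^esub> (finprod K \<phi> S \<otimes>\<^bsub>K\<^esub> finprod K \<phi> T)"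
      using insert by auto
    also have "\<dots> = finprod K \<phi> (insert a S) \<otimes>\<^bsub>K\<^esub> finprod K \<phi> T"
      using insert c by (simp add: m_assoc)
    finally show ?case .
  qed
qed

lemma bhom_finprod:
  assumes "h \<in> bhom M N" "comm_monoid M" "comm_monoid N" "finite S" "\<phi> \<in> S \<rightarrow> carrier M"
  shows "h (finprod M \<phi> S) = finprod N (\<lambda>x. h (\<phi> x)) S"
  using assms(4,5)
proof (induction S)
  case empty
  then show ?case using assms by (simp add: bhom_def comm_monoid.finprod_empty)
next
  case (insert a S)
  interpret M: comm_monoid M by fact
  interpret N: comm_monoid N by fact
  have h: "h \<in> carrier M \<rightarrow> carrier N" using assms(1) by (auto simp: bhom_def hom_def)
  have c: "\<phi> a \<in> carrier M" "\<phi> \<in> S \<rightarrow> carrier M" using insert by auto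
  have d: "h (\<phi> a) \<in> carrier N" "(\<lambda>x. h (\<phi> x)) \<in> S \<rightarrow> carrier N" using c h by auto
  have "finprod M \<phi> S \<in> carrier M" using c(2) by (rule M.finprod_closed)
  then show ?case using insert c d assms(1)
    by (auto simp: bhom_def hom_def)
qed

text \<open>A projective semimodule lifts against surjections between semimodules of any type.\<close>

lemma projective_lift:
  fixes P :: "('p, 'z) monoid_scheme" and M :: "('m, 'y) monoid_scheme"
    and N :: "('n, 'x) monoid_scheme"
  assumes P: "projective P" and M: "B_semimodule M" and N: "B_semimodule N"
    and p: "p \<in> bhom M N" "p ` carrier M = carrier N" and f: "f \<in> bhom P N"
  shows "\<exists>g\<in>bhom P M. \<forall>x\<in>carrier P. p (g x) = f x"
proof -
  have BP: "B_semimodule P" using P by (simp add: projective_def)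
  interpret P: comm_monoid P using BP by (rule B_semimoduleD)
  interpret M: comm_monoid M using M by (rule B_semimoduleD)
  interpret N: comm_monoid N using N by (rule B_semimoduleD)
  let ?sum = "finprod P (\<lambda>y. y)"
  define F :: "'p set monoid" where
    "F = \<lparr>carrier = Fpow (carrier P), monoid.mult = (\<union>), one = {}\<rparr>"
  define Q :: "'p set monoid" where "Q = \<lparr>carrier = (\<lambda>x. {x}) ` carrier P,
    monoid.mult = (\<lambda>A B. {the_elem A \<otimes>\<^bsub>P\<^esub> the_elem B}), one = {\<one>\<^bsub>P\<^esub>}\<rparr>"
  have F: "B_semimodule F"
    unfolding B_semimodule_def F_def
    by (auto intro!: comm_monoidI simp: Fpow_def)
  have Q: "B_semimodule Q"
    unfolding B_semimodule_def Q_def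
    by (auto intro!: comm_monoidI simp: P.m_ac B_semimoduleD(2)[OF BP])
  have sum: "?sum S \<in> carrier P" if "S \<in> Fpow (carrier P)" for S
    using that by (auto simp: Fpow_def intro!: P.finprod_closed)
  have p0: "(\<lambda>S. {?sum S}) \<in> bhom F Q"
    using sum by (auto simp: bhom_def hom_def F_def Q_def Fpow_def intro!: finprod_Un_idem[OF BP])
  have s0: "(\<lambda>S. {?sum S}) ` carrier F = carrier Q"
  proof
    show "(\<lambda>S. {?sum S}) ` carrier F \<subseteq> carrier Q" using sum by (auto simp: F_def Q_def)
    show "carrier Q \<subseteq> (\<lambda>S. {?sum S}) ` carrier F"
    proof
      fix A assume "A \<in> carrier Q"
      then obtain x where x: "x \<in> carrier P" "A = {x}" by (auto simp: Q_def)
      then have "A = {?sum {x}}" "{x} \<in> carrier F" by (auto simp: F_def Fpow_def)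
      then show "A \<in> (\<lambda>S. {?sum S}) ` carrier F" by blast
    qed
  qed
  have f0: "(\<lambda>x. {x}) \<in> bhom P Q" by (auto simp: bhom_def hom_def Q_def)
  obtain g0 where g0: "g0 \<in> bhom P F" "\<forall>x\<in>carrier P. {?sum (g0 x)} = {x}"
    using P[unfolded projective_def, THEN conjunct2, rule_format, OF p0 f0 F Q s0] by blast
  have g0F: "g0 x \<in> Fpow (carrier P)" if "x \<in> carrier P" for x
    using g0(1) that by (auto simp: bhom_def hom_def F_def)
  have fc: "f x \<in> carrier N" if "x \<in> carrier P" for x
    using f that by (auto simp: bhom_def hom_def)
  obtain m where m: "\<And>y. y \<in> carrier P \<Longrightarrow> m y \<in> carrier M \<and> p (m y) = f y"
  proof -
    have "\<forall>y\<in>carrier P. \<exists>z. z \<in> carrier M \<and> p z = f y" using p(2) fc by (metis imageE)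
    then show ?thesis using that by metis
  qed
  define g where "g x = finprod M m (g0 x)" for x
  have mc: "m \<in> S \<rightarrow> carrier M" if "S \<in> Fpow (carrier P)" for S
    using that m by (auto simp: Fpow_def)
  have "g \<in> bhom P M"
  proof -
    have "g (x \<otimes>\<^bsub>P\<^esub> y) = g x \<otimes>\<^bsub>M\<^esub> g y" if "x \<in> carrier P" "y \<in> carrier P" for x y
    proof -
      have "g0 (x \<otimes>\<^bsub>P\<^esub> y) = g0 x \<union> g0 y" using g0(1) that by (auto simp: bhom_def hom_def F_def)
      then show ?thesis
        using g0F[OF that(1)] g0F[OF that(2)] mc
        by (auto simp: g_def Fpow_def intro!: finprod_Un_idem[OF M])
    qed
    moreover have "g \<one>\<^bsub>P\<^esub> = \<one>\<^bsub>M\<^esub>" using g0(1) by (simp add: bhom_def F_def g_def)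
    moreover have "g x \<in> carrier M" if "x \<in> carrier P" for x
      unfolding g_def using mc[OF g0F[OF that]] by (rule M.finprod_closed)
    ultimately show ?thesis by (auto simp: bhom_def hom_def)
  qed
  moreover have "p (g x) = f x" if x: "x \<in> carrier P" for x
  proof -
    have S: "finite (g0 x)" "g0 x \<subseteq> carrier P" using g0F[OF x] by (auto simp: Fpow_def)
    have "p (g x) = finprod N (\<lambda>y. p (m y)) (g0 x)"
      unfolding g_def using p(1) M.comm_monoid_axioms N.comm_monoid_axioms S(1) mc[OF g0F[OF x]]
      by (rule bhom_finprod)
    also have "\<dots> = finprod N (\<lambda>y. f y) (g0 x)"
      using S m fc by (intro N.finprod_cong') auto
    also have "\<dots> = f (?sum (g0 x))"
      using S by (intro bhom_finprod[symmetric] f P.comm_monoid_axioms N.comm_monoid_axioms) auto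
    also have "\<dots> = f x" using g0(2) x by auto
    finally show ?thesis .
  qed
  ultimately show ?thesis by blast
qed

lemma bcong_in_Fpow: "(S, T) \<in> bcong X R \<Longrightarrow> S \<in> Fpow X \<and> T \<in> Fpow X"
  by (induction rule: bcong.induct) (auto simp: Fpow_def)

lemma equiv_bcong: "equiv (Fpow X) (bcong X R)"
  by (rule equivI)
    (auto simp: refl_on_def sym_def trans_def dest: bcong_in_Fpow intro: bcong.intros)

lemma bcong_Un:
  assumes "(S, S') \<in> bcong X R" "(T, T') \<in> bcong X R"
  shows "(S \<union> T, S' \<union> T') \<in> bcong X R"
proof -
  have "(S \<union> T, S' \<union> T) \<in> bcong X R" "(T \<union> S', T' \<union> S') \<in> bcong X R"
    using assms bcong_in_Fpow by (blast intro: bcong.union)+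
  then show ?thesis by (metis Un_commute bcong.trans)
qed

lemma bpres_mult:
  assumes "S \<in> Fpow X" "T \<in> Fpow X"
  shows "bcong X R `` {S} \<otimes>\<^bsub>bpres X R\<^esub> bcong X R `` {T} = bcong X R `` {S \<union> T}"
proof -
  let ?E = "bcong X R"
  have eq: "?E `` {S' \<union> T'} = ?E `` {S \<union> T}" if "S' \<in> ?E `` {S}" "T' \<in> ?E `` {T}" for S' T'
  proof -
    have "(S \<union> T, S' \<union> T') \<in> ?E" using that by (intro bcong_Un) auto
    then show ?thesis by (rule equiv_class_eq[OF equiv_bcong, symmetric])
  qed
  have ne: "?E `` {S} \<noteq> {}" "?E `` {T} \<noteq> {}"
    using bcong.refl[OF assms(1)] bcong.refl[OF assms(2)] by blast+
  have "(\<Union>S'\<in>?E `` {S}. \<Union>T'\<in>?E `` {T}. ?E `` {S' \<union> T'}) =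
      (\<Union>S'\<in>?E `` {S}. \<Union>T'\<in>?E `` {T}. ?E `` {S \<union> T})"
    by (intro SUP_cong HOL.refl eq)
  also have "\<dots> = ?E `` {S \<union> T}" using ne by simp
  finally show ?thesis by (simp add: bpres_def bquot_def)
qed

lemma bpres_carrierE:
  assumes "A \<in> carrier (bpres X R)"
  obtains S where "S \<in> Fpow X" "A = bcong X R `` {S}"
  using assms by (auto simp: bpres_def bquot_def elim!: quotientE)

lemma bpres_one: "\<one>\<^bsub>bpres X R\<^esub> = bcong X R `` {{}}"
  by (simp add: bpres_def bquot_def)

lemma bpres_class: "S \<in> Fpow X \<Longrightarrow> bcong X R `` {S} \<in> carrier (bpres X R)"
  by (auto simp: bpres_def bquot_def intro: quotientI)

lemma Fpow_Un: "S \<in> Fpow X \<Longrightarrow> T \<in> Fpow X \<Longrightarrow> S \<union> T \<in> Fpow X"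
  by (auto simp: Fpow_def)

lemma B_semimodule_bpres: "B_semimodule (bpres X R)"
  unfolding B_semimodule_def
proof (intro conjI ballI comm_monoidI)
  have e: "{} \<in> Fpow X" by (auto simp: Fpow_def)
  show "\<one>\<^bsub>bpres X R\<^esub> \<in> carrier (bpres X R)" using e by (simp add: bpres_one bpres_class)
  fix A assume A: "A \<in> carrier (bpres X R)"
  then show "\<one>\<^bsub>bpres X R\<^esub> \<otimes>\<^bsub>bpres X R\<^esub> A = A" "A \<otimes>\<^bsub>bpres X R\<^esub> A = A"
    by (auto elim!: bpres_carrierE simp: bpres_one bpres_mult e)
  fix B assume B: "B \<in> carrier (bpres X R)"
  show "A \<otimes>\<^bsub>bpres X R\<^esub> B \<in> carrier (bpres X R)" "A \<otimes>\<^bsub>bpres X R\<^esub> B = B \<otimes>\<^bsub>bpres X R\<^esub> A"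
    using A B by (auto elim!: bpres_carrierE simp: bpres_mult bpres_class Fpow_Un Un_commute)
  fix C assume C: "C \<in> carrier (bpres X R)"
  show "A \<otimes>\<^bsub>bpres X R\<^esub> B \<otimes>\<^bsub>bpres X R\<^esub> C = A \<otimes>\<^bsub>bpres X R\<^esub> (B \<otimes>\<^bsub>bpres X R\<^esub> C)"
    using A B C by (auto elim!: bpres_carrierE simp: bpres_mult Fpow_Un Un_assoc)
qed

lemma bgen_closed: "x \<in> X \<Longrightarrow> bgen X R x \<in> carrier (bpres X R)"
  by (auto simp: bgen_def Fpow_def intro!: bpres_class)

lemma bext_class:
  assumes K: "B_semimodule K" and \<phi>: "\<phi> \<in> X \<rightarrow> carrier K"
    and R: "\<And>S T. (S, T) \<in> R \<Longrightarrow> S \<in> Fpow X \<Longrightarrow> T \<in> Fpow X \<Longrightarrow> finprod K \<phi> S = finprod K \<phi> T"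
    and S: "S \<in> Fpow X"
  shows "bext K \<phi> (bcong X R `` {S}) = finprod K \<phi> S"
proof -
  have "finprod K \<phi> S = finprod K \<phi> T" if "(S, T) \<in> bcong X R" for S T
    using that
  proof (induction rule: bcong.induct)
    case (union S T U)
    have "S \<in> Fpow X" "T \<in> Fpow X" using union bcong_in_Fpow by blast+
    then show ?case using union \<phi>
      by (subst (1 2) finprod_Un_idem[OF K]) (auto simp: Fpow_def)
  qed (auto intro: R)
  then have "finprod K \<phi> ` (bcong X R `` {S}) = {finprod K \<phi> S}"
    using bcong.refl[OF S] by (auto intro!: image_eqI)
  then show ?thesis by (simp add: bext_def)
qed

theorem bpres_universal:
  assumes K: "B_semimodule K" and \<phi>: "\<phi> \<in> X \<rightarrow> carrier K"
    and R: "\<And>S T. (S, T) \<in> R \<Longrightarrow> S \<in> Fpow X \<Longrightarrow> T \<in> Fpow X \<Longrightarrow> finprod K \<phi> S = finprod K \<phi> T"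
  shows "bext K \<phi> \<in> bhom (bpres X R) K"
    and "x \<in> X \<Longrightarrow> bext K \<phi> (bgen X R x) = \<phi> x"
    and "h \<in> bhom (bpres X R) K \<Longrightarrow> (\<And>x. x \<in> X \<Longrightarrow> h (bgen X R x) = \<phi> x) \<Longrightarrow>
      A \<in> carrier (bpres X R) \<Longrightarrow> h A = bext K \<phi> A"
proof -
  interpret K: comm_monoid K using K by (rule B_semimoduleD)
  note [simp] = bext_class[OF K \<phi> R]
  have e: "{} \<in> Fpow X" by (auto simp: Fpow_def)
  show "bext K \<phi> \<in> bhom (bpres X R) K"
    unfolding bhom_def hom_def
  proof (safe)
    fix A assume A: "A \<in> carrier (bpres X R)"
    then show "bext K \<phi> A \<in> carrier K"
      using \<phi> by (auto elim!: bpres_carrierE intro!: K.finprod_closed simp: Pi_iff)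
        (auto simp: Fpow_def)
    fix B assume B: "B \<in> carrier (bpres X R)"
    show "bext K \<phi> (A \<otimes>\<^bsub>bpres X R\<^esub> B) = bext K \<phi> A \<otimes>\<^bsub>K\<^esub> bext K \<phi> B"
      using A B \<phi>
      by (auto elim!: bpres_carrierE simp: bpres_mult Fpow_Un)
        (subst finprod_Un_idem[OF K], auto simp: Fpow_def)
  qed (simp add: bpres_one e)
  show "bext K \<phi> (bgen X R x) = \<phi> x" if "x \<in> X"
    using that \<phi> unfolding bgen_def by (subst bext_class[OF K \<phi> R]) (auto simp: Fpow_def Pi_iff)
  assume h: "h \<in> bhom (bpres X R) K" and hx: "\<And>x. x \<in> X \<Longrightarrow> h (bgen X R x) = \<phi> x"
  have hS: "h (bcong X R `` {S}) = finprod K \<phi> S" if "finite S" "S \<subseteq> X" for S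
    using that
  proof (induction S)
    case empty
    then show ?case using h by (simp add: bhom_def bpres_one)
  next
    case (insert a S)
    have F: "{a} \<in> Fpow X" "S \<in> Fpow X" using insert by (auto simp: Fpow_def)
    have "h (bcong X R `` {insert a S}) = h (bgen X R a \<otimes>\<^bsub>bpres X R\<^esub> bcong X R `` {S})"
      using bpres_mult[OF F] by (simp add: bgen_def)
    also have "\<dots> = \<phi> a \<otimes>\<^bsub>K\<^esub> finprod K \<phi> S"
      using h insert hx bgen_closed[of a X R] bpres_class[OF F(2), of R] by (simp add: bhom_def hom_def)
    finally show ?case using insert \<phi> by (auto simp: subset_iff Pi_iff)
  qed
  show "h A = bext K \<phi> A" if A: "A \<in> carrier (bpres X R)"
  proof -
    obtain S where S: "S \<in> Fpow X" "A = bcong X R `` {S}" using A by (rule bpres_carrierE)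
    have "h A = finprod K \<phi> S" using S hS[of S] unfolding Fpow_def by blast
    also have "\<dots> = bext K \<phi> A" unfolding S(2) by (rule bext_class[OF K \<phi> R S(1), symmetric])
    finally show ?thesis .
  qed
qed

text \<open>\<^const>\<open>tensor\<close> is universal for bilinear maps, to semimodules of any type.\<close>

theorem tensor_universal:
  fixes M :: "('m, 'y) monoid_scheme" and N :: "('n, 'z) monoid_scheme"
    and K :: "('k, 'x) monoid_scheme"
  assumes K: "B_semimodule K"
    and l: "\<And>y. y \<in> carrier N \<Longrightarrow> (\<lambda>x. b x y) \<in> bhom M K"
    and r: "\<And>x. x \<in> carrier M \<Longrightarrow> b x \<in> bhom N K"
  shows "tensor_lift K b \<in> bhom (tensor M N) K"
    and "x \<in> carrier M \<Longrightarrow> y \<in> carrier N \<Longrightarrow> tensor_lift K b (pure M N x y) = b x y"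
    and "h \<in> bhom (tensor M N) K \<Longrightarrow>
      (\<And>x y. x \<in> carrier M \<Longrightarrow> y \<in> carrier N \<Longrightarrow> h (pure M N x y) = b x y) \<Longrightarrow>
      t \<in> carrier (tensor M N) \<Longrightarrow> h t = tensor_lift K b t"
proof -
  interpret K: comm_monoid K using K by (rule B_semimoduleD)
  have bc: "b x y \<in> carrier K" if "x \<in> carrier M" "y \<in> carrier N" for x y
    using r[OF that(1)] that(2) by (auto simp: bhom_def hom_def)
  have two: "finprod K \<phi> {x, y} = \<phi> x \<otimes>\<^bsub>K\<^esub> \<phi> y"
    if "\<phi> x \<in> carrier K" "\<phi> y \<in> carrier K" for \<phi> and x y :: "'m \<times> 'n"
  proof -
    have "{x, y} = {x} \<union> {y}" by auto
    then have "finprod K \<phi> {x, y} = finprod K \<phi> {x} \<otimes>\<^bsub>K\<^esub> finprod K \<phi> {y}"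
      using that by (simp only:, intro finprod_Un_idem[OF K]) auto
    then show ?thesis using that by simp
  qed
  have la: "b (x \<otimes>\<^bsub>M\<^esub> x') y = b x y \<otimes>\<^bsub>K\<^esub> b x' y"
    if "x \<in> carrier M" "x' \<in> carrier M" "y \<in> carrier N" for x x' y
    using l[OF that(3)] that by (auto simp: bhom_def hom_def)
  have bl1: "b \<one>\<^bsub>M\<^esub> y = \<one>\<^bsub>K\<^esub>" if "y \<in> carrier N" for y
    using l[OF that] by (auto simp: bhom_def)
  have ra: "b x (y \<otimes>\<^bsub>N\<^esub> y') = b x y \<otimes>\<^bsub>K\<^esub> b x y'"
    if "x \<in> carrier M" "y \<in> carrier N" "y' \<in> carrier N" for x y y'
    using r[OF that(1)] that by (auto simp: bhom_def hom_def)
  have br1: "b x \<one>\<^bsub>N\<^esub> = \<one>\<^bsub>K\<^esub>" if "x \<in> carrier M" for x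
    using r[OF that] by (auto simp: bhom_def)
  have \<phi>: "(\<lambda>(x, y). b x y) \<in> carrier M \<times> carrier N \<rightarrow> carrier K" using bc by auto
  have R: "finprod K (\<lambda>(x, y). b x y) S = finprod K (\<lambda>(x, y). b x y) T"
    if ST: "(S, T) \<in> tensor_rel M N"
      "S \<in> Fpow (carrier M \<times> carrier N)" "T \<in> Fpow (carrier M \<times> carrier N)" for S T
  proof -
    have one: "finprod K (\<lambda>(x, y). b x y) {(x, y)} = b x y"
      if "x \<in> carrier M" "y \<in> carrier N" for x y
      using bc[OF that] by simp
    consider
        (l) a a' c where "S = {(a \<otimes>\<^bsub>M\<^esub> a', c)}" "T = {(a, c), (a', c)}"
          "a \<in> carrier M" "a' \<in> carrier M" "c \<in> carrier N"
      | (l1) c where "S = {(\<one>\<^bsub>M\<^esub>, c)}" "T = {}" "c \<in> carrier N"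
      | (r) a c c' where "S = {(a, c \<otimes>\<^bsub>N\<^esub> c')}" "T = {(a, c), (a, c')}"
          "a \<in> carrier M" "c \<in> carrier N" "c' \<in> carrier N"
      | (r1) a where "S = {(a, \<one>\<^bsub>N\<^esub>)}" "T = {}" "a \<in> carrier M"
      using ST(1) unfolding tensor_rel_def by blast
    then show ?thesis
    proof cases
      case l
      moreover have "a \<otimes>\<^bsub>M\<^esub> a' \<in> carrier M" using ST(2) l by (auto simp: Fpow_def)
      ultimately show ?thesis by (simp add: one two bc la)
    next
      case l1
      moreover have "\<one>\<^bsub>M\<^esub> \<in> carrier M" using ST(2) l1 by (auto simp: Fpow_def)
      ultimately show ?thesis by (simp add: one bl1)
    next
      case r
      moreover have "c \<otimes>\<^bsub>N\<^esub> c' \<in> carrier N" using ST(2) r by (auto simp: Fpow_def)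
      ultimately show ?thesis by (simp add: one two bc ra)
    next
      case r1
      moreover have "\<one>\<^bsub>N\<^esub> \<in> carrier N" using ST(2) r1 by (auto simp: Fpow_def)
      ultimately show ?thesis by (simp add: one br1)
    qed
  qed
  show "tensor_lift K b \<in> bhom (tensor M N) K"
    using bpres_universal(1)[OF K \<phi> R] by (simp add: tensor_def tensor_lift_def)
  show "tensor_lift K b (pure M N x y) = b x y" if "x \<in> carrier M" "y \<in> carrier N"
    using bpres_universal(2)[OF K \<phi> R, where x = "(x, y)"] that
    by (simp add: pure_def tensor_lift_def)
  assume h: "h \<in> bhom (tensor M N) K"
    and hp: "\<And>x y. x \<in> carrier M \<Longrightarrow> y \<in> carrier N \<Longrightarrow> h (pure M N x y) = b x y"
  show "h t = tensor_lift K b t" if t: "t \<in> carrier (tensor M N)"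
    unfolding tensor_lift_def
    by (rule bpres_universal(3)[OF K \<phi> R h[unfolded tensor_def] _ t[unfolded tensor_def]])
      (use hp in \<open>auto simp: pure_def\<close>)
qed


subsection \<open>Symmetric monoidal functors to semimodules\<close>

text \<open>
  The data of a symmetric monoidal category that is strict, i.e. whose associators and unitors are
  identities. \<open>Comp a b c g f\<close> is the composite of \<open>f \<in> Hom a b\<close> and \<open>g \<in> Hom b c\<close>;
  \<open>TensM a b c d f g\<close> is the tensor product of \<open>f \<in> Hom a b\<close> and \<open>g \<in> Hom c d\<close>.
\<close>

record ('o, 'f) smcat =
  Hom :: "'o \<Rightarrow> 'o \<Rightarrow> 'f set"
  Idt :: "'o \<Rightarrow> 'f"
  Comp :: "'o \<Rightarrow> 'o \<Rightarrow> 'o \<Rightarrow> 'f \<Rightarrow> 'f \<Rightarrow> 'f"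
  Unit :: "'o"
  TensO :: "'o \<Rightarrow> 'o \<Rightarrow> 'o"
  TensM :: "'o \<Rightarrow> 'o \<Rightarrow> 'o \<Rightarrow> 'o \<Rightarrow> 'f \<Rightarrow> 'f \<Rightarrow> 'f"
  Braid :: "'o \<Rightarrow> 'o \<Rightarrow> 'f"

text \<open>
  \<open>F\<close> on objects, \<open>Fm a b\<close> on morphisms from \<open>a\<close> to \<open>b\<close>, the unit constraint \<open>\<eta>\<close> and the
  tensor constraint \<open>\<mu>\<close> form a (strong) symmetric monoidal functor to semimodules with
  \<^const>\<open>tensor\<close>.
\<close>

definition symmetric_monoidal_functor ::
  "('o, 'f) smcat \<Rightarrow> ('o \<Rightarrow> 'm monoid) \<Rightarrow> ('o \<Rightarrow> 'o \<Rightarrow> 'f \<Rightarrow> 'm \<Rightarrow> 'm) \<Rightarrow>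
   (bool \<Rightarrow> 'm) \<Rightarrow> ('o \<Rightarrow> 'o \<Rightarrow> ('m \<times> 'm) set set \<Rightarrow> 'm) \<Rightarrow> bool" where
  "symmetric_monoidal_functor C F Fm \<eta> \<mu> \<longleftrightarrow>
     (\<forall>a. B_semimodule (F a)) \<and>
     (\<forall>a b. \<forall>f\<in>Hom C a b. Fm a b f \<in> bhom (F a) (F b)) \<and>
     (\<forall>a. \<forall>x\<in>carrier (F a). Fm a a (Idt C a) x = x) \<and>
     (\<forall>a b c. \<forall>f\<in>Hom C a b. \<forall>g\<in>Hom C b c. \<forall>x\<in>carrier (F a).
        Fm a c (Comp C a b c g f) x = Fm b c g (Fm a b f x)) \<and>
     \<eta> \<in> biso Bool (F (Unit C)) \<and>
     (\<forall>a b. \<mu> a b \<in> biso (tensor (F a) (F b)) (F (TensO C a b))) \<and>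
     (\<forall>a b c d. \<forall>f\<in>Hom C a b. \<forall>g\<in>Hom C c d. \<forall>t\<in>carrier (tensor (F a) (F c)).
        Fm (TensO C a c) (TensO C b d) (TensM C a b c d f g) (\<mu> a c t) =
        \<mu> b d (tensor_map (F b) (F d) (Fm a b f) (Fm c d g) t)) \<and>
     (\<forall>a b c. \<forall>t\<in>carrier (tensor (tensor (F a) (F b)) (F c)).
        \<mu> (TensO C a b) c (tensor_map (F (TensO C a b)) (F c) (\<mu> a b) (\<lambda>z. z) t) =
        \<mu> a (TensO C b c)
          (tensor_map (F a) (F (TensO C b c)) (\<lambda>z. z) (\<mu> b c) (tensor_assoc (F a) (F b) (F c) t))) \<and>
     (\<forall>a. \<forall>t\<in>carrier (tensor Bool (F a)).
        \<mu> (Unit C) a (tensor_map (F (Unit C)) (F a) \<eta> (\<lambda>z. z) t) = tensor_lunit (F a) t) \<and>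
     (\<forall>a. \<forall>t\<in>carrier (tensor (F a) Bool).
        \<mu> a (Unit C) (tensor_map (F a) (F (Unit C)) (\<lambda>z. z) \<eta> t) = tensor_runit (F a) t) \<and>
     (\<forall>a b. \<forall>t\<in>carrier (tensor (F a) (F b)).
        Fm (TensO C a b) (TensO C b a) (Braid C a b) (\<mu> a b t) = \<mu> b a (tensor_swap (F a) (F b) t))"


section \<open>Languages\<close>

text \<open>\<open>circ w\<close> is the circular word of \<open>w\<close>: its class modulo $\omega_1\omega_2 \sim \omega_2\omega_1$.\<close>

definition circ :: "'a list \<Rightarrow> 'a list set" where
  "circ w = {v @ u | u v. w = u @ v}"

definition circ_words :: "'a set \<Rightarrow> 'a list set set" where
  "circ_words \<Sigma> = circ ` lists \<Sigma>"

text \<open>\<open>L\<close> is the language accepted by a deterministic finite automaton with states \<open>{..<n}\<close>.\<close>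

definition regular_language :: "'a set \<Rightarrow> 'a list set \<Rightarrow> bool" where
  "regular_language \<Sigma> L \<longleftrightarrow>
     (\<exists>(n::nat) \<delta> q\<^sub>0 F. q\<^sub>0 < n \<and> F \<subseteq> {..<n} \<and> (\<forall>q<n. \<forall>a\<in>\<Sigma>. \<delta> q a < n) \<and>
        L = {w \<in> lists \<Sigma>. foldl \<delta> q\<^sub>0 w \<in> F})"

text \<open>The space $A(-)$ of a language, as a quotient of the free semimodule on words.\<close>

definition state_space_minus :: "'a set \<Rightarrow> 'a list set \<Rightarrow> 'a list set set monoid" where
  "state_space_minus \<Sigma> L =
     bquot (lists \<Sigma>)
       {(S, T). S \<in> Fpow (lists \<Sigma>) \<and> T \<in> Fpow (lists \<Sigma>) \<and>
          (\<forall>u\<in>lists \<Sigma>. (\<exists>w\<in>S. w @ u \<in> L) \<longleftrightarrow> (\<exists>w\<in>T. w @ u \<in> L))}"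

definition decomposition_of_identity ::
  "'a set \<Rightarrow> 'a list set \<Rightarrow> ('a list \<times> 'a list) set \<Rightarrow> bool" where
  "decomposition_of_identity \<Sigma> L D \<longleftrightarrow>
     finite D \<and> D \<subseteq> lists \<Sigma> \<times> lists \<Sigma> \<and>
     (\<forall>x\<in>lists \<Sigma>. \<forall>y\<in>lists \<Sigma>. x @ y \<in> L \<longleftrightarrow> (\<exists>(u, v)\<in>D. x @ u \<in> L \<and> v @ y \<in> L))"

text \<open>The condition does not depend on the representative of a circular word, see
  \<open>circ_in_associated_circular\<close> below.\<close>

definition associated_circular ::
  "'a set \<Rightarrow> 'a list set \<Rightarrow> ('a list \<times> 'a list) set \<Rightarrow> 'a list set set" where
  "associated_circular \<Sigma> L D = {circ w | w. w \<in> lists \<Sigma> \<and> (\<exists>(u, v)\<in>D. v @ w @ u \<in> L)}"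

lemma circ_in_associated_circular:
  assumes D: "decomposition_of_identity \<Sigma> L D" and w: "w \<in> lists \<Sigma>"
  shows "circ w \<in> associated_circular \<Sigma> L D \<longleftrightarrow> (\<exists>(u, v)\<in>D. v @ w @ u \<in> L)"
proof
  assume "circ w \<in> associated_circular \<Sigma> L D"
  then obtain w' u v where w': "circ w = circ w'" "w' \<in> lists \<Sigma>" "(u, v) \<in> D" "v @ w' @ u \<in> L"
    by (auto simp: associated_circular_def)
  have "w' = w' @ [] \<and> w' = [] @ w'" by simp
  then have "w' \<in> circ w'" unfolding circ_def by blast
  then have "w' \<in> circ w" using w' by simp
  then obtain a b where ab: "w = a @ b" "w' = b @ a" by (auto simp: circ_def)
  have D': "\<And>x y. x \<in> lists \<Sigma> \<Longrightarrow> y \<in> lists \<Sigma> \<Longrightarrow>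
      x @ y \<in> L \<longleftrightarrow> (\<exists>(u, v)\<in>D. x @ u \<in> L \<and> v @ y \<in> L)"
    and DS: "\<And>u v. (u, v) \<in> D \<Longrightarrow> u \<in> lists \<Sigma> \<and> v \<in> lists \<Sigma>"
    using D unfolding decomposition_of_identity_def by blast+
  have l: "a \<in> lists \<Sigma>" "b \<in> lists \<Sigma>" using w ab by auto
  have "(v @ b) @ (a @ u) \<in> L" using w' ab by simp
  then obtain u' v' where uv': "(u', v') \<in> D" "(v @ b) @ u' \<in> L" "v' @ a @ u \<in> L"
    using D'[of "v @ b" "a @ u"] DS[OF w'(3)] l by auto
  then have "(v' @ a) @ (b @ u') \<in> L"
    using D'[of "v' @ a" "b @ u'"] DS[OF uv'(1)] l w'(3) by auto
  then show "\<exists>(u, v)\<in>D. v @ w @ u \<in> L" using uv'(1) ab by force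
qed (use w in \<open>auto simp: associated_circular_def\<close>)


section \<open>The cobordism category\<close>

datatype sign = Plus | Minus

primrec neg :: "sign \<Rightarrow> sign" where
  "neg Plus = Minus"
| "neg Minus = Plus"

definition dual :: "sign list \<Rightarrow> sign list" where
  "dual \<epsilon> = map neg (rev \<epsilon>)"

text \<open>
  By the classification of compact one-manifolds, a cobordism up to diffeomorphism rel outer boundary
  is the multiset of its connected components. An oriented interval \<open>Arc p w q\<close> starts at \<open>p\<close>, ends
  at \<open>q\<close> and carries the word \<open>w\<close>, read along the orientation; \<open>p\<close> and \<open>q\<close> are names of outer
  endpoints, or \<^const>\<open>None\<close> for an inner (floating) endpoint. \<open>Loop c\<close> is an oriented circle carrying
  the circular word \<open>c\<close>.
\<close>

datatype ('p, 'a) component = Arc "'p option" "'a list" "'p option" | Loop "'a list set"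

fun start :: "('p, 'a) component \<Rightarrow> 'p option" where
  "start (Arc p w q) = p"
| "start (Loop c) = None"

fun finish :: "('p, 'a) component \<Rightarrow> 'p option" where
  "finish (Arc p w q) = q"
| "finish (Loop c) = None"

fun label :: "('p, 'a) component \<Rightarrow> 'a list" where
  "label (Arc p w q) = w"
| "label (Loop c) = []"

fun labelled_in :: "'a set \<Rightarrow> ('p, 'a) component \<Rightarrow> bool" where
  "labelled_in \<Sigma> (Arc p w q) \<longleftrightarrow> w \<in> lists \<Sigma>"
| "labelled_in \<Sigma> (Loop c) \<longleftrightarrow> c \<in> circ_words \<Sigma>"

text \<open>Outer endpoints, by their position in the bottom or top sign sequence, counted from 0.\<close>

datatype pt = Bot nat | Top nat

type_synonym 'a cob = "(pt, 'a) component multiset"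

abbreviation rename :: "('p \<Rightarrow> 'q) \<Rightarrow> ('p, 'a) component multiset \<Rightarrow> ('q, 'a) component multiset" where
  "rename r \<equiv> image_mset (map_component r)"

text \<open>
  Orientation convention: the strand of a \<^const>\<open>Minus\<close> runs from bottom to top, that of a
  \<^const>\<open>Plus\<close> from top to bottom. It is the convention for which closing up a word $\omega$ in $A(-)$
  by a word $u$ gives the interval labelled $\omega u$, as in \<^const>\<open>state_space_minus\<close>, while words
  are read along the orientation. Exchanging \<^const>\<open>Plus\<close> and \<^const>\<open>Minus\<close> gives the opposite
  convention.
\<close>

fun starts_at :: "sign list \<Rightarrow> sign list \<Rightarrow> pt \<Rightarrow> bool" where
  "starts_at \<epsilon> \<epsilon>' (Bot i) \<longleftrightarrow> i < length \<epsilon> \<and> \<epsilon> ! i = Minus"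
| "starts_at \<epsilon> \<epsilon>' (Top j) \<longleftrightarrow> j < length \<epsilon>' \<and> \<epsilon>' ! j = Plus"

fun ends_at :: "sign list \<Rightarrow> sign list \<Rightarrow> pt \<Rightarrow> bool" where
  "ends_at \<epsilon> \<epsilon>' (Bot i) \<longleftrightarrow> i < length \<epsilon> \<and> \<epsilon> ! i = Plus"
| "ends_at \<epsilon> \<epsilon>' (Top j) \<longleftrightarrow> j < length \<epsilon>' \<and> \<epsilon>' ! j = Minus"

definition Cob :: "'a set \<Rightarrow> sign list \<Rightarrow> sign list \<Rightarrow> 'a cob set" where
  "Cob \<Sigma> \<epsilon> \<epsilon>' = {M.
     (\<forall>x\<in>#M. labelled_in \<Sigma> x) \<and>
     (\<forall>p. size {#x \<in># M. start x = Some p#} = (if starts_at \<epsilon> \<epsilon>' p then 1 else 0)) \<and>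
     (\<forall>p. size {#x \<in># M. finish x = Some p#} = (if ends_at \<epsilon> \<epsilon>' p then 1 else 0))}"

text \<open>
  Gluing at a point \<open>p\<close> at which exactly one component \<open>x\<close> ends and exactly one component \<open>y\<close>
  starts. If \<open>x\<close> and \<open>y\<close> are the same component, it is closed up to a circle.
\<close>

definition glue ::
  "'p \<Rightarrow> ('p, 'a) component multiset \<Rightarrow> ('p, 'a) component multiset" where
  "glue p M =
     (let x = (THE x. x \<in># M \<and> finish x = Some p);
          y = (THE y. y \<in># M \<and> start y = Some p)
      in if x = y then add_mset (Loop (circ (label x))) (M - {#x#})
         else add_mset (Arc (start x) (label x @ label y) (finish y)) (M - {#x, y#}))"

text \<open>
  \<open>cob_comp \<epsilon>' g f\<close> is \<open>g\<close> on top of \<open>f\<close>, glued along \<open>\<epsilon>'\<close>. The \<open>i\<close>-th point of \<open>\<epsilon>'\<close>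
  is called \<^term>\<open>Inr i\<close> during the gluing.
\<close>

definition cob_comp :: "sign list \<Rightarrow> 'a cob \<Rightarrow> 'a cob \<Rightarrow> 'a cob" where
  "cob_comp \<epsilon>' g f =
     rename projl
       (fold glue (map Inr [0..<length \<epsilon>'])
         (rename (case_pt (\<lambda>i. Inl (Bot i)) (\<lambda>j. Inr j)) f +
          rename (case_pt (\<lambda>i. Inr i) (\<lambda>j. Inl (Top j))) g))"

text \<open>The closed cobordism obtained from \<open>f : \<epsilon> \<rightarrow> \<epsilon>'\<close> and \<open>h : \<epsilon>' \<rightarrow> \<epsilon>\<close>.\<close>

definition cob_closure :: "sign list \<Rightarrow> sign list \<Rightarrow> 'a cob \<Rightarrow> 'a cob \<Rightarrow> 'a cob" where
  "cob_closure \<epsilon> \<epsilon>' f h =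
     fold glue (map Bot [0..<length \<epsilon>] @ map Top [0..<length \<epsilon>'])
       (f + rename (case_pt Top Bot) h)"

text \<open>\<open>f : \<epsilon> \<rightarrow> \<epsilon>'\<close> placed to the left of another cobordism \<open>g\<close>.\<close>

definition cob_tensor :: "sign list \<Rightarrow> sign list \<Rightarrow> 'a cob \<Rightarrow> 'a cob \<Rightarrow> 'a cob" where
  "cob_tensor \<epsilon> \<epsilon>' f g =
     f + rename (case_pt (\<lambda>i. Bot (length \<epsilon> + i)) (\<lambda>j. Top (length \<epsilon>' + j))) g"

fun cob_tensors :: "sign list \<Rightarrow> sign list \<Rightarrow> 'a cob list \<Rightarrow> 'a cob" where
  "cob_tensors (s # \<epsilon>) (s' # \<epsilon>') (f # fs) = cob_tensor [s] [s'] f (cob_tensors \<epsilon> \<epsilon>' fs)"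
| "cob_tensors _ _ _ = {#}"

text \<open>Vertical strands joining the \<open>i\<close>-th bottom point to the \<open>\<pi> i\<close>-th top point.\<close>

definition strands :: "sign list \<Rightarrow> (nat \<Rightarrow> nat) \<Rightarrow> 'a cob" where
  "strands \<epsilon> \<pi> = mset (map (\<lambda>i. case \<epsilon> ! i of
       Minus \<Rightarrow> Arc (Some (Bot i)) [] (Some (Top (\<pi> i)))
     | Plus \<Rightarrow> Arc (Some (Top (\<pi> i))) [] (Some (Bot i))) [0..<length \<epsilon>])"

definition cob_braid :: "sign list \<Rightarrow> sign list \<Rightarrow> 'a cob" where
  "cob_braid \<epsilon> \<delta> =
     strands (\<epsilon> @ \<delta>) (\<lambda>i. if i < length \<epsilon> then length \<delta> + i else i - length \<epsilon>)"

definition Cob_cat :: "'a set \<Rightarrow> (sign list, 'a cob) smcat" where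
  "Cob_cat \<Sigma> = \<lparr>
     Hom = Cob \<Sigma>,
     Idt = (\<lambda>\<epsilon>. strands \<epsilon> (\<lambda>i. i)),
     Comp = (\<lambda>_ \<epsilon>' _ g f. cob_comp \<epsilon>' g f),
     Unit = [],
     TensO = (@),
     TensM = (\<lambda>\<epsilon> \<epsilon>' _ _ f g. cob_tensor \<epsilon> \<epsilon>' f g),
     Braid = cob_braid\<rparr>"

text \<open>
  Duality. \<open>cob_bend\<close> turns \<open>f : \<epsilon> \<rightarrow> \<epsilon>'\<close> into a cobordism from the empty sequence to
  \<open>dual \<epsilon> @ \<epsilon>'\<close> by bending the bottom endpoints up to the left of the top ones; \<open>cob_dual\<close> turns
  \<open>f\<close> into its dual, from \<open>dual \<epsilon>'\<close> to \<open>dual \<epsilon>\<close>, by rotating it through a half turn.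
\<close>

definition cob_bend :: "sign list \<Rightarrow> 'a cob \<Rightarrow> 'a cob" where
  "cob_bend \<epsilon> = rename (case_pt (\<lambda>i. Top (length \<epsilon> - 1 - i)) (\<lambda>j. Top (length \<epsilon> + j)))"

definition cob_dual :: "sign list \<Rightarrow> sign list \<Rightarrow> 'a cob \<Rightarrow> 'a cob" where
  "cob_dual \<epsilon> \<epsilon>' =
     rename (case_pt (\<lambda>i. Top (length \<epsilon> - 1 - i)) (\<lambda>j. Bot (length \<epsilon>' - 1 - j)))"


section \<open>Evaluation and state spaces\<close>

text \<open>In this section an evaluation is a pair \<open>\<alpha> = (L\<^sub>I, L\<^sub>\<circ>)\<close>.\<close>

type_synonym 'a evaluation = "'a list set \<times> 'a list set set"

fun eval_component :: "'a evaluation \<Rightarrow> ('p, 'a) component \<Rightarrow> bool" where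
  "eval_component \<alpha> (Arc p w q) \<longleftrightarrow> w \<in> fst \<alpha>"
| "eval_component \<alpha> (Loop c) \<longleftrightarrow> c \<in> snd \<alpha>"

definition eval_closed :: "'a evaluation \<Rightarrow> 'a cob \<Rightarrow> bool" where
  "eval_closed \<alpha> M \<longleftrightarrow> (\<forall>x\<in>#M. eval_component \<alpha> x)"

definition cob_equiv ::
  "'a set \<Rightarrow> 'a evaluation \<Rightarrow> sign list \<Rightarrow> sign list \<Rightarrow> ('a cob set \<times> 'a cob set) set" where
  "cob_equiv \<Sigma> \<alpha> \<epsilon> \<epsilon>' =
     {(S, T). S \<in> Fpow (Cob \<Sigma> \<epsilon> \<epsilon>') \<and> T \<in> Fpow (Cob \<Sigma> \<epsilon> \<epsilon>') \<and>
        (\<forall>h\<in>Cob \<Sigma> \<epsilon>' \<epsilon>. (\<exists>f\<in>S. eval_closed \<alpha> (cob_closure \<epsilon> \<epsilon>' f h)) \<longleftrightarrow>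
                        (\<exists>g\<in>T. eval_closed \<alpha> (cob_closure \<epsilon> \<epsilon>' g h)))}"

definition Hom_eval ::
  "'a set \<Rightarrow> 'a evaluation \<Rightarrow> sign list \<Rightarrow> sign list \<Rightarrow> 'a cob set set monoid" where
  "Hom_eval \<Sigma> \<alpha> \<epsilon> \<epsilon>' = bquot (Cob \<Sigma> \<epsilon> \<epsilon>') (cob_equiv \<Sigma> \<alpha> \<epsilon> \<epsilon>')"

definition state_space :: "'a set \<Rightarrow> 'a evaluation \<Rightarrow> sign list \<Rightarrow> 'a cob set set monoid" where
  "state_space \<Sigma> \<alpha> = Hom_eval \<Sigma> \<alpha> []"

text \<open>The map of classes of formal sums that is induced by a map \<open>\<phi>\<close> of cobordisms.\<close>

definition induced ::
  "('a cob set \<times> 'a cob set) set \<Rightarrow> ('a cob \<Rightarrow> 'a cob) \<Rightarrow> 'a cob set set \<Rightarrow> 'a cob set set" where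
  "induced E \<phi> A = (\<Union>S\<in>A. E `` {\<phi> ` S})"

definition state_map ::
  "'a set \<Rightarrow> 'a evaluation \<Rightarrow> sign list \<Rightarrow> sign list \<Rightarrow> 'a cob \<Rightarrow> 'a cob set set \<Rightarrow> 'a cob set set" where
  "state_map \<Sigma> \<alpha> \<epsilon> \<epsilon>' f = induced (cob_equiv \<Sigma> \<alpha> [] \<epsilon>') (cob_comp \<epsilon> f)"

text \<open>\<open>Hom_map \<Sigma> \<alpha> \<delta> \<epsilon> \<epsilon>' \<delta>' h g\<close> is $f \mapsto g f h$ for \<open>h : \<delta> \<rightarrow> \<epsilon>\<close> and \<open>g : \<epsilon>' \<rightarrow> \<delta>'\<close>.\<close>

definition Hom_map ::
  "'a set \<Rightarrow> 'a evaluation \<Rightarrow> sign list \<Rightarrow> sign list \<Rightarrow> sign list \<Rightarrow> sign list \<Rightarrow> 'a cob \<Rightarrow> 'a cob \<Rightarrow>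
   'a cob set set \<Rightarrow> 'a cob set set" where
  "Hom_map \<Sigma> \<alpha> \<delta> \<epsilon> \<epsilon>' \<delta>' h g =
     induced (cob_equiv \<Sigma> \<alpha> \<delta> \<delta>') (\<lambda>f. cob_comp \<epsilon>' g (cob_comp \<epsilon> f h))"

definition bend_map ::
  "'a set \<Rightarrow> 'a evaluation \<Rightarrow> sign list \<Rightarrow> sign list \<Rightarrow> 'a cob set set \<Rightarrow> 'a cob set set" where
  "bend_map \<Sigma> \<alpha> \<epsilon> \<epsilon>' = induced (cob_equiv \<Sigma> \<alpha> [] (dual \<epsilon> @ \<epsilon>')) (cob_bend \<epsilon>)"

definition state_unit :: "'a set \<Rightarrow> 'a evaluation \<Rightarrow> bool \<Rightarrow> 'a cob set set" where
  "state_unit \<Sigma> \<alpha> c = cob_equiv \<Sigma> \<alpha> [] [] `` {if c then {{#}} else {}}"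

text \<open>Disjoint union of elements of state spaces, extended bilinearly from cobordisms.\<close>

definition state_union ::
  "'a set \<Rightarrow> 'a evaluation \<Rightarrow> sign list \<Rightarrow> sign list \<Rightarrow>
   'a cob set set \<Rightarrow> 'a cob set set \<Rightarrow> 'a cob set set" where
  "state_union \<Sigma> \<alpha> \<epsilon> \<delta> A B =
     (\<Union>S\<in>A. \<Union>T\<in>B. cob_equiv \<Sigma> \<alpha> [] (\<epsilon> @ \<delta>) `` {(\<lambda>(f, g). cob_tensor [] \<epsilon> f g) ` (S \<times> T)})"

definition state_tensor ::
  "'a set \<Rightarrow> 'a evaluation \<Rightarrow> sign list \<Rightarrow> sign list \<Rightarrow>
   ('a cob set set \<times> 'a cob set set) set set \<Rightarrow> 'a cob set set" where
  "state_tensor \<Sigma> \<alpha> \<epsilon> \<delta> = tensor_lift (state_space \<Sigma> \<alpha> (\<epsilon> @ \<delta>)) (state_union \<Sigma> \<alpha> \<epsilon> \<delta>)"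

fun state_unions ::
  "'a set \<Rightarrow> 'a evaluation \<Rightarrow> sign list \<Rightarrow> 'a cob set set list \<Rightarrow> 'a cob set set" where
  "state_unions \<Sigma> \<alpha> (s # \<epsilon>) (x # xs) = state_union \<Sigma> \<alpha> [s] \<epsilon> x (state_unions \<Sigma> \<alpha> \<epsilon> xs)"
| "state_unions \<Sigma> \<alpha> _ _ = state_unit \<Sigma> \<alpha> True"

definition sign_spaces :: "'a set \<Rightarrow> 'a evaluation \<Rightarrow> sign list \<Rightarrow> 'a cob set set monoid list" where
  "sign_spaces \<Sigma> \<alpha> \<epsilon> = map (\<lambda>s. state_space \<Sigma> \<alpha> [s]) \<epsilon>"

definition state_ntensor ::
  "'a set \<Rightarrow> 'a evaluation \<Rightarrow> sign list \<Rightarrow> 'a cob set set list set set \<Rightarrow> 'a cob set set" where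
  "state_ntensor \<Sigma> \<alpha> \<epsilon> = bext (state_space \<Sigma> \<alpha> \<epsilon>) (state_unions \<Sigma> \<alpha> \<epsilon>)"

end

theory Submission
  imports Defs
begin

text \<open>
  Cut a cobordism at all its outer endpoints and plug in words: it becomes a union of intervals and
  circles, and its evaluation is a Boolean function of the words. By the choice of the circular
  language, gluing at a point is the same as summing over the decomposition $\sum_i u_i \otimes v_i$
  inserted there, whether the gluing joins two components or closes one up to a circle. Thus
  composition of cobordisms becomes the product of Boolean matrices indexed by plugs, and two formal
  sums of cobordisms are equivalent iff they define the same function of the words. The half-intervals
  labelled by words of the decomposition span $A(\varepsilon)$, and the values of $x$ at the plugs
  $(u_i, v_i)$ are coefficients of $x$ that depend additively on $x$. Such dual bases make the
  multiplication maps $A(\varepsilon) \otimes A(\delta) \to A(\varepsilon\delta)$ invertible; everything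
  else is read off from the functions.
\<close>

section \<open>Endpoints of cobordisms\<close>

text \<open>A state space need not be free, so the summands of the decomposition carry no identity
  matrix: the vertical strand of sign s has the matrix \<open>pairing\<close>, which is merely
  idempotent. Strands act as identities because every function coming from a cobordism is fixed by
  this idempotent (\<open>cob_eval_split\<close>): the decomposition is inserted just inside the
  outer endpoints. Being fixed replaces freeness: values at finitely many plugs determine a state
  and expand it in half-intervals.

  Gluing is a fold along a list of points that rests on definite descriptions. Reasoning on
  cobordisms themselves would require that gluings at different points commute. On functions an
  iterated gluing is one sum over simultaneous choices at all points, and associativity is an
  exchange of sums.

  The decomposition itself is obtained by linear algebra: a splitting of the free semimodule over
  A(-) expresses each word through finitely many words v, and the coefficient functionals are sums
  of tests x \<mapsto> \<alpha>(xu); the pairs (u, v) form the decomposition.\<close>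

definition starts :: "('p, 'a) component multiset \<Rightarrow> 'p multiset" where
  "starts M = {#the (start x). x \<in># {#x \<in># M. start x \<noteq> None#}#}"

definition finishes :: "('p, 'a) component multiset \<Rightarrow> 'p multiset" where
  "finishes M = {#the (finish x). x \<in># {#x \<in># M. finish x \<noteq> None#}#}"

lemma starts_simps [simp]:
  "starts {#} = {#}"
  "starts (add_mset (Loop c) M) = starts M"
  "starts (add_mset (Arc None w q) M) = starts M"
  "starts (add_mset (Arc (Some p) w q) M) = add_mset p (starts M)"
  "starts (M + N) = starts M + starts N"
  by (simp_all add: starts_def)

lemma finishes_simps [simp]:
  "finishes {#} = {#}"
  "finishes (add_mset (Loop c) M) = finishes M"
  "finishes (add_mset (Arc p w None) M) = finishes M"
  "finishes (add_mset (Arc p w (Some q)) M) = add_mset q (finishes M)"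
  "finishes (M + N) = finishes M + finishes N"
  by (simp_all add: finishes_def)

lemma start_map [simp]: "start (map_component r x) = map_option r (start x)"
  by (cases x) auto

lemma finish_map [simp]: "finish (map_component r x) = map_option r (finish x)"
  by (cases x) auto

lemma starts_rename [simp]: "starts (rename r M) = image_mset r (starts M)"
  by (induction M) (auto simp: starts_def)

lemma finishes_rename [simp]: "finishes (rename r M) = image_mset r (finishes M)"
  by (induction M) (auto simp: finishes_def)

lemma count_starts: "count (starts M) p = size {#x \<in># M. start x = Some p#}"
  by (induction M) (auto simp: starts_def)

lemma count_finishes: "count (finishes M) p = size {#x \<in># M. finish x = Some p#}"
  by (induction M) (auto simp: finishes_def)

lemma labelled_map [simp]: "labelled_in \<Sigma> (map_component r x) = labelled_in \<Sigma> x"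
  by (cases x) auto

text \<open>The two counts make both definite descriptions in \<open>glue\<close> denote a component
  of multiplicity one; the cases are whether these components coincide. That p has left the rest
  \<open>M'\<close> allows the plug at p to be varied later without changing the value of
  \<open>M'\<close>.\<close>

lemma glue_cases:
  assumes "count (starts M) p = 1" "count (finishes M) p = 1"
  obtains
    (loop) w M' where "M = add_mset (Arc (Some p) w (Some p)) M'"
      "glue p M = add_mset (Loop (circ w)) M'" "p \<notin># starts M'" "p \<notin># finishes M'"
  | (arc) s w w' t M' where "M = add_mset (Arc s w (Some p)) (add_mset (Arc (Some p) w' t) M')"
      "glue p M = add_mset (Arc s (w @ w') t) M'" "s \<noteq> Some p" "t \<noteq> Some p"
      "p \<notin># starts M'" "p \<notin># finishes M'"
proof -
  obtain y where y: "{#x \<in># M. start x = Some p#} = {#y#}"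
    using assms(1) unfolding count_starts by (metis size_1_singleton_mset)
  obtain x where x: "{#x \<in># M. finish x = Some p#} = {#x#}"
    using assms(2) unfolding count_finishes by (metis size_1_singleton_mset)
  have xm: "z \<in># M \<and> finish z = Some p \<longleftrightarrow> z = x" for z
    using arg_cong[OF x, of "\<lambda>N. z \<in># N"] by auto
  have ym: "z \<in># M \<and> start z = Some p \<longleftrightarrow> z = y" for z
    using arg_cong[OF y, of "\<lambda>N. z \<in># N"] by auto
  have the: "(THE x. x \<in># M \<and> finish x = Some p) = x" "(THE y. y \<in># M \<and> start y = Some p) = y"
    by (simp_all add: xm ym)
  have cx: "x \<in># M" "finish x = Some p" and cy: "y \<in># M" "start y = Some p"
    using xm[of x] ym[of y] by auto
  show thesis
  proof (cases "x = y")
    case True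
    obtain w where w: "x = Arc (Some p) w (Some p)" using True cx cy by (cases x) auto
    obtain M' where M: "M = add_mset x M'" using cx(1) by (metis mset_add)
    have "glue p M = add_mset (Loop (circ w)) M'"
      unfolding glue_def the using True[symmetric] w M by simp
    moreover have "p \<notin># starts M'" "p \<notin># finishes M'" using assms w M
      by (auto simp: not_in_iff)
    ultimately show thesis using loop w M by blast
  next
    case False
    obtain s w where w: "x = Arc s w (Some p)" using cx by (cases x) auto
    obtain t w' where w': "y = Arc (Some p) w' t" using cy by (cases y) auto
    obtain M1 where M1: "M = add_mset x M1" using cx(1) by (metis mset_add)
    then have "y \<in># M1" using cy(1) False by auto
    then obtain M' where M: "M = add_mset x (add_mset y M')" using M1 by (metis mset_add)
    have st: "s \<noteq> Some p" "t \<noteq> Some p" using False xm[of y] ym[of x] cx cy w w' by auto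
    have "glue p M = add_mset (Arc s (w @ w') t) M'"
      unfolding glue_def the Let_def if_not_P[OF False] using w w' M by simp
    moreover have "p \<notin># starts M'" "p \<notin># finishes M'" using assms w w' M st
      by (cases s; cases t; auto simp: not_in_iff)+
    ultimately show thesis using arc w w' M st by blast
  qed
qed

lemma starts_glue:
  assumes "count (starts M) p = 1" "count (finishes M) p = 1"
  shows "starts M = add_mset p (starts (glue p M))"
  using assms
proof (cases rule: glue_cases)
  case (arc s w w' t M')
  then show ?thesis by (cases s) auto
qed auto

lemma finishes_glue:
  assumes "count (starts M) p = 1" "count (finishes M) p = 1"
  shows "finishes M = add_mset p (finishes (glue p M))"
  using assms
proof (cases rule: glue_cases)
  case (arc s w w' t M')
  then show ?thesis by (cases t) auto
qed auto

lemma labelled_glue: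
  assumes "count (starts M) p = 1" "count (finishes M) p = 1" "\<forall>x\<in>#M. labelled_in \<Sigma> x"
  shows "\<forall>x\<in>#glue p M. labelled_in \<Sigma> x"
  using assms(1,2)
  by (cases rule: glue_cases) (use assms(3) in \<open>auto simp: circ_words_def\<close>)

text \<open>Gluing at one point leaves the counts at the other points of \<open>ps\<close> at 1
  because \<open>ps\<close> is distinct, so the one-step lemmas iterate.\<close>

lemma
  assumes "distinct ps" "\<forall>p\<in>set ps. count (starts M) p = 1 \<and> count (finishes M) p = 1"
    "\<forall>x\<in>#M. labelled_in \<Sigma> x"
  shows starts_fold_glue: "starts M = mset ps + starts (fold glue ps M)"
    and finishes_fold_glue: "finishes M = mset ps + finishes (fold glue ps M)"
    and labelled_fold_glue: "\<forall>x\<in>#fold glue ps M. labelled_in \<Sigma> x"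
proof -
  have "starts M = mset ps + starts (fold glue ps M) \<and>
    finishes M = mset ps + finishes (fold glue ps M) \<and> (\<forall>x\<in>#fold glue ps M. labelled_in \<Sigma> x)"
    using assms
  proof (induction ps arbitrary: M)
    case (Cons p ps)
    have 1: "count (starts M) p = 1" "count (finishes M) p = 1" using Cons.prems by auto
    note s = starts_glue[OF 1] and f = finishes_glue[OF 1]
    have "count (starts (glue p M)) q = 1 \<and> count (finishes (glue p M)) q = 1" if "q \<in> set ps" for q
    proof -
      have "q \<noteq> p" "count (starts M) q = 1" "count (finishes M) q = 1"
        using Cons.prems that by auto
      then show ?thesis by (simp add: s f)
    qed
    then have "starts (glue p M) = mset ps + starts (fold glue ps (glue p M)) \<and>
      finishes (glue p M) = mset ps + finishes (fold glue ps (glue p M)) \<and>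
      (\<forall>x\<in>#fold glue ps (glue p M). labelled_in \<Sigma> x)"
      using Cons.prems labelled_glue[OF 1] by (intro Cons.IH) auto
    then show ?case using s f by auto
  qed simp
  then show "starts M = mset ps + starts (fold glue ps M)"
    "finishes M = mset ps + finishes (fold glue ps M)" "\<forall>x\<in>#fold glue ps M. labelled_in \<Sigma> x"
    by auto
qed

section \<open>Positions of signs and the endpoint multisets of morphisms\<close>

definition positions :: "sign list \<Rightarrow> sign \<Rightarrow> nat multiset" where
  "positions X s = mset_set {i. i < length X \<and> X ! i = s}"

lemma positions_Nil [simp]: "positions [] s = {#}"
  by (simp add: positions_def)

lemma in_positions [simp]: "i \<in># positions X s \<longleftrightarrow> i < length X \<and> X ! i = s"
  by (simp add: positions_def)

lemma count_positions: "count (positions X s) i = (if i < length X \<and> X ! i = s then 1 else 0)"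
  by (simp add: positions_def count_mset_set')

text \<open>At an interface one cobordism starts at the points of one sign and the other at the
  points of the opposite sign; this adds both kinds up to the list of glued points.\<close>

lemma positions_Plus_Minus: "positions X Plus + positions X Minus = mset [0..<length X]"
  by (rule multiset_eqI) (auto simp: count_positions count_mset_0_iff distinct_count_atmost_1 intro: sign.exhaust)

lemma image_mset_inj_count: "inj f \<Longrightarrow> count (image_mset f A) (f x) = count A x"
  by (induction A) (auto dest: injD)

lemma count_image_Bot_Top [simp]:
  "count (image_mset Bot A) (Bot i) = count A i"
  "count (image_mset Top A) (Top i) = count A i"
  "count (image_mset Bot A) (Top i) = 0"
  "count (image_mset Top A) (Bot i) = 0"
  by (auto intro!: image_mset_inj_count injI simp: count_eq_zero_iff)

lemma positions_append: "positions (X @ Y) s = positions X s + image_mset ((+) (length X)) (positions Y s)"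
proof (rule multiset_eqI)
  fix i
  have *: "count (image_mset ((+) (length X)) (positions Y s)) i =
      (if length X \<le> i then count (positions Y s) (i - length X) else 0)"
  proof (cases "length X \<le> i")
    case True
    then obtain k where "i = length X + k" by (metis le_add_diff_inverse)
    then show ?thesis using image_mset_inj_count[of "(+) (length X)" "positions Y s" k] by simp
  qed (auto simp: count_eq_zero_iff)
  show "count (positions (X @ Y) s) i = count (positions X s + image_mset ((+) (length X)) (positions Y s)) i"
    unfolding count_union * by (auto simp: count_positions nth_append)
qed

lemma length_dual [simp]: "length (dual X) = length X"
  by (simp add: dual_def)

lemma neg_neg [simp]: "neg (neg s) = s"
  by (cases s) auto

lemma dual_nth: "i < length X \<Longrightarrow> dual X ! i = neg (X ! (length X - 1 - i))"
  by (simp add: dual_def rev_nth)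

lemma neg_eq_iff: "neg s = t \<longleftrightarrow> s = neg t"
  by auto

lemma positions_dual: "positions (dual X) s = image_mset (\<lambda>i. length X - 1 - i) (positions X (neg s))"
proof -
  have "image_mset (\<lambda>i. length X - 1 - i) (positions X (neg s)) =
      mset_set ((\<lambda>i. length X - 1 - i) ` {i. i < length X \<and> X ! i = neg s})"
    unfolding positions_def by (rule image_mset_mset_set) (auto simp: inj_on_def)
  also have "(\<lambda>i. length X - 1 - i) ` {i. i < length X \<and> X ! i = neg s} =
      {i. i < length (dual X) \<and> dual X ! i = s}"
  proof (intro equalityI subsetI)
    fix i assume "i \<in> {i. i < length (dual X) \<and> dual X ! i = s}"
    then show "i \<in> (\<lambda>i. length X - 1 - i) ` {i. i < length X \<and> X ! i = neg s}"
      by (intro image_eqI[of _ _ "length X - 1 - i"]) (auto simp: dual_nth)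
  qed (auto simp: dual_nth)
  finally show ?thesis by (simp add: positions_def)
qed

text \<open>Renaming acts on endpoint multisets by \<open>image_mset\<close> and gluing by removing
  a point, so in this form membership of each constructed cobordism is a computation.\<close>

lemma Cob_iff:
  "M \<in> Cob \<Sigma> X X' \<longleftrightarrow> (\<forall>x\<in>#M. labelled_in \<Sigma> x) \<and>
     starts M = image_mset Bot (positions X Minus) + image_mset Top (positions X' Plus) \<and>
     finishes M = image_mset Bot (positions X Plus) + image_mset Top (positions X' Minus)"
proof -
  have "count (image_mset Bot (positions X Minus) + image_mset Top (positions X' Plus)) p =
      (if starts_at X X' p then 1 else 0)"
    "count (image_mset Bot (positions X Plus) + image_mset Top (positions X' Minus)) p =
      (if ends_at X X' p then 1 else 0)" for p
    by (cases p; simp add: count_positions)+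
  then show ?thesis
    unfolding Cob_def multiset_eq_iff count_starts count_finishes by auto
qed

lemma CobD:
  assumes "M \<in> Cob \<Sigma> X X'"
  shows "\<forall>x\<in>#M. labelled_in \<Sigma> x"
    "starts M = image_mset Bot (positions X Minus) + image_mset Top (positions X' Plus)"
    "finishes M = image_mset Bot (positions X Plus) + image_mset Top (positions X' Minus)"
  using assms by (auto simp: Cob_iff)

text \<open>At a \<open>Plus\<close> point of the interface \<open>f\<close> starts and
  \<open>g\<close> ends, at a \<open>Minus\<close> point it is the reverse. Hence each
  \<open>Inr i\<close> is a start once and an end once, as gluing requires.\<close>

lemma cob_glue_conditions:
  assumes f: "f \<in> Cob \<Sigma> X X'" and g: "g \<in> Cob \<Sigma> X' X''"
  defines "N \<equiv> rename (case_pt (\<lambda>i. Inl (Bot i)) (\<lambda>j. Inr j)) f +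
          rename (case_pt (\<lambda>i. Inr i) (\<lambda>j. Inl (Top j))) g"
  shows "starts N = mset (map Inr [0..<length X']) + image_mset (Inl \<circ> Bot) (positions X Minus) +
      image_mset (Inl \<circ> Top) (positions X'' Plus)"
    "finishes N = mset (map Inr [0..<length X']) + image_mset (Inl \<circ> Bot) (positions X Plus) +
      image_mset (Inl \<circ> Top) (positions X'' Minus)"
    "\<forall>p\<in>set (map Inr [0..<length X']). count (starts N) p = 1 \<and> count (finishes N) p = 1"
    "\<forall>x\<in>#N. labelled_in \<Sigma> x"
proof -
  have m: "mset (map Inr [0..<length X']) = image_mset Inr (positions X' Plus) + image_mset Inr (positions X' Minus)"
    unfolding mset_map positions_Plus_Minus[symmetric] by simp
  show s: "starts N = mset (map Inr [0..<length X']) + image_mset (Inl \<circ> Bot) (positions X Minus) +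
      image_mset (Inl \<circ> Top) (positions X'' Plus)"
    unfolding m by (simp add: N_def CobD[OF f] CobD[OF g] multiset.map_comp comp_def ac_simps)
  show e: "finishes N = mset (map Inr [0..<length X']) + image_mset (Inl \<circ> Bot) (positions X Plus) +
      image_mset (Inl \<circ> Top) (positions X'' Minus)"
    unfolding m by (simp add: N_def CobD[OF f] CobD[OF g] multiset.map_comp comp_def ac_simps)
  have 0: "count (image_mset (Inl \<circ> h) A) (Inr i) = 0" for h :: "nat \<Rightarrow> pt" and A and i :: nat
    by (auto simp: count_eq_zero_iff)
  have 1: "count (mset (map Inr [0..<n])) (Inr i :: pt + nat) = 1" if "i < n" for i n
    using that distinct_count_atmost_1[of "map Inr [0..<n] :: (pt + nat) list"]
    by (auto simp: distinct_map)
  show "\<forall>p\<in>set (map Inr [0..<length X']). count (starts N) p = 1 \<and> count (finishes N) p = 1"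
    unfolding s e count_union by (auto simp: 0 1 simp del: mset_map)
  show "\<forall>x\<in>#N. labelled_in \<Sigma> x" using CobD(1)[OF f] CobD(1)[OF g] by (auto simp: N_def)
qed

lemma cob_comp_in_Cob:
  assumes f: "f \<in> Cob \<Sigma> X X'" and g: "g \<in> Cob \<Sigma> X' X''"
  shows "cob_comp X' g f \<in> Cob \<Sigma> X X''"
proof -
  note c = cob_glue_conditions[OF f g]
  have d: "distinct (map Inr [0..<length X'] :: (pt + nat) list)" by (simp add: distinct_map)
  let ?N = "rename (case_pt (\<lambda>i. Inl (Bot i)) (\<lambda>j. Inr j)) f +
      rename (case_pt (\<lambda>i. Inr i) (\<lambda>j. Inl (Top j))) g"
  \<comment> \<open>Cancelling the glued points in the multiset equation leaves the outer endpoints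
    of \<open>f\<close> and \<open>g\<close>.\<close>
  have "starts (fold glue (map Inr [0..<length X']) ?N) =
      image_mset (Inl \<circ> Bot) (positions X Minus) + image_mset (Inl \<circ> Top) (positions X'' Plus)"
    using starts_fold_glue[OF d c(3,4)] unfolding c(1) add.assoc by (rule add_left_imp_eq[symmetric])
  moreover have "finishes (fold glue (map Inr [0..<length X']) ?N) =
      image_mset (Inl \<circ> Bot) (positions X Plus) + image_mset (Inl \<circ> Top) (positions X'' Minus)"
    using finishes_fold_glue[OF d c(3,4)] unfolding c(2) add.assoc by (rule add_left_imp_eq[symmetric])
  ultimately show ?thesis
    unfolding Cob_iff cob_comp_def
    using labelled_fold_glue[OF d c(3,4)] by (simp add: multiset.map_comp comp_def)
qed

section \<open>Tensor products, bending and duals of morphisms\<close>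

lemma cob_tensor_in_Cob:
  assumes "f \<in> Cob \<Sigma> X X'" "g \<in> Cob \<Sigma> Y Y'"
  shows "cob_tensor X X' f g \<in> Cob \<Sigma> (X @ Y) (X' @ Y')"
  using CobD[OF assms(1)] CobD[OF assms(2)]
  unfolding Cob_iff cob_tensor_def
  by (auto simp: positions_append multiset.map_comp comp_def ac_simps)

lemma cob_bend_in_Cob:
  assumes "f \<in> Cob \<Sigma> X X'"
  shows "cob_bend X f \<in> Cob \<Sigma> [] (dual X @ X')"
  using CobD[OF assms] unfolding Cob_iff cob_bend_def
  by (auto simp: positions_append positions_dual multiset.map_comp comp_def)

lemma cob_dual_in_Cob:
  assumes "f \<in> Cob \<Sigma> X X'"
  shows "cob_dual X X' f \<in> Cob \<Sigma> (dual X') (dual X)"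
  using CobD[OF assms] unfolding Cob_iff cob_dual_def
  by (auto simp: positions_dual multiset.map_comp comp_def ac_simps)

text \<open>Supplies preimages of states under bending, see \<open>bend_map_biso\<close>.\<close>

definition cob_unbend :: "sign list \<Rightarrow> 'a cob \<Rightarrow> 'a cob" where
  "cob_unbend X = rename (case_pt Bot (\<lambda>j. if j < length X then Bot (length X - 1 - j) else Top (j - length X)))"

lemma cob_unbend_in_Cob:
  assumes "f \<in> Cob \<Sigma> [] (dual X @ X')"
  shows "cob_unbend X f \<in> Cob \<Sigma> X X'"
  using CobD[OF assms] unfolding Cob_iff cob_unbend_def
  by (auto simp: positions_append positions_dual multiset.map_comp comp_def intro!: image_mset_cong)

section \<open>Evaluation of cobordisms with plugged endpoints\<close>

text \<open>
  The endpoint \<open>p\<close> is plugged by the pair of words \<open>\<rho> p\<close>: a component ending at \<open>p\<close> is continued by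
  the first word, a component starting at \<open>p\<close> is preceded by the second one. During a gluing both
  occur at the same point, and a summand $u_i \otimes v_i$ of the decomposition of the identity is
  such a pair.
\<close>

fun plugged_component :: "'a evaluation \<Rightarrow> ('p \<Rightarrow> 'a list \<times> 'a list) \<Rightarrow> ('p, 'a) component \<Rightarrow> bool" where
  "plugged_component \<alpha> \<rho> (Arc p w q) \<longleftrightarrow>
     (case p of None \<Rightarrow> [] | Some p \<Rightarrow> snd (\<rho> p)) @ w @ (case q of None \<Rightarrow> [] | Some q \<Rightarrow> fst (\<rho> q)) \<in> fst \<alpha>"
| "plugged_component \<alpha> \<rho> (Loop c) \<longleftrightarrow> c \<in> snd \<alpha>"

definition plugged :: "'a evaluation \<Rightarrow> ('p \<Rightarrow> 'a list \<times> 'a list) \<Rightarrow> ('p, 'a) component multiset \<Rightarrow> bool" where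
  "plugged \<alpha> \<rho> M \<longleftrightarrow> (\<forall>x\<in>#M. plugged_component \<alpha> \<rho> x)"

lemma plugged_simps [simp]:
  "plugged \<alpha> \<rho> {#}"
  "plugged \<alpha> \<rho> (add_mset x M) \<longleftrightarrow> plugged_component \<alpha> \<rho> x \<and> plugged \<alpha> \<rho> M"
  "plugged \<alpha> \<rho> (M + N) \<longleftrightarrow> plugged \<alpha> \<rho> M \<and> plugged \<alpha> \<rho> N"
  by (auto simp: plugged_def)

lemma plugged_rename: "plugged \<alpha> \<rho> (rename r M) \<longleftrightarrow> plugged \<alpha> (\<rho> \<circ> r) M"
proof -
  have "plugged_component \<alpha> \<rho> (map_component r x) \<longleftrightarrow> plugged_component \<alpha> (\<rho> \<circ> r) x" for x
    by (cases x) (auto split: option.splits)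
  then show ?thesis by (simp add: plugged_def)
qed

text \<open>Empty words leave every label unchanged and \<open>eval_component\<close> reads labels
  only, so closed evaluation is a case of \<open>plugged\<close>.\<close>

lemma eval_closed_iff_plugged: "eval_closed \<alpha> M \<longleftrightarrow> plugged \<alpha> (\<lambda>_. ([], [])) M"
proof -
  have "eval_component \<alpha> x \<longleftrightarrow> plugged_component \<alpha> (\<lambda>_. ([], [])) x" for x :: "(pt, 'a) component"
    by (cases x) (auto split: option.splits)
  then show ?thesis by (simp add: eval_closed_def plugged_def)
qed

lemma plugged_cong:
  assumes "\<And>p. p \<in># starts M \<Longrightarrow> \<rho> p = \<rho>' p" "\<And>p. p \<in># finishes M \<Longrightarrow> \<rho> p = \<rho>' p"
  shows "plugged \<alpha> \<rho> M \<longleftrightarrow> plugged \<alpha> \<rho>' M"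
  using assms
proof (induction M)
  case (add x M)
  then have "plugged \<alpha> \<rho> M \<longleftrightarrow> plugged \<alpha> \<rho>' M"
    by (auto simp: starts_def finishes_def)
  moreover have "plugged_component \<alpha> \<rho> x \<longleftrightarrow> plugged_component \<alpha> \<rho>' x"
  proof (cases x)
    case (Arc p w q)
    then show ?thesis using add.prems by (cases p; cases q) auto
  qed auto
  ultimately show ?case by simp
qed simp

text \<open>Plugs of the bottom points serve as row index and plugs of the top points as column
  index: this is the Boolean matrix of the cobordism.\<close>

definition cob_eval :: "'a evaluation \<Rightarrow> 'a cob \<Rightarrow> (nat \<Rightarrow> 'a list \<times> 'a list) \<Rightarrow> (nat \<Rightarrow> 'a list \<times> 'a list) \<Rightarrow> bool" where
  "cob_eval \<alpha> f a b \<longleftrightarrow> plugged \<alpha> (case_pt a b) f"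

lemma plugged_rename_case_pt:
  "plugged \<alpha> (case_pt a b) (rename (case_pt h k) M) \<longleftrightarrow>
    plugged \<alpha> (case_pt (\<lambda>i. case_pt a b (h i)) (\<lambda>j. case_pt a b (k j))) M"
proof -
  have "case_pt a b \<circ> case_pt h k = case_pt (\<lambda>i. case_pt a b (h i)) (\<lambda>j. case_pt a b (k j))"
    by (auto simp: fun_eq_iff split: pt.splits)
  then show ?thesis by (simp add: plugged_rename)
qed

lemma cob_eval_cong:
  assumes "f \<in> Cob \<Sigma> X X'" "\<And>i. i < length X \<Longrightarrow> a i = a' i" "\<And>j. j < length X' \<Longrightarrow> b j = b' j"
  shows "cob_eval \<alpha> f a b \<longleftrightarrow> cob_eval \<alpha> f a' b'"
  unfolding cob_eval_def by (rule plugged_cong) (use assms in \<open>auto simp: CobD[OF assms(1)]\<close>)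

text \<open>The matrix of a disjoint union is a Kronecker product; the shifts by the lengths select
  the second block of an index.\<close>

lemma cob_eval_tensor:
  "cob_eval \<alpha> (cob_tensor X X' f g) a b \<longleftrightarrow>
    cob_eval \<alpha> f a b \<and> cob_eval \<alpha> g (\<lambda>i. a (length X + i)) (\<lambda>j. b (length X' + j))"
  by (simp add: cob_eval_def cob_tensor_def plugged_rename_case_pt)

lemma cob_eval_bend:
  "cob_eval \<alpha> (cob_bend X f) a b \<longleftrightarrow> cob_eval \<alpha> f (\<lambda>i. b (length X - 1 - i)) (\<lambda>j. b (length X + j))"
  by (simp add: cob_eval_def cob_bend_def plugged_rename_case_pt)

lemma cob_eval_unbend:
  "cob_eval \<alpha> (cob_unbend X f) a b \<longleftrightarrow>
    cob_eval \<alpha> f a (\<lambda>j. if j < length X then a (length X - 1 - j) else b (j - length X))"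
  by (simp add: cob_eval_def cob_unbend_def plugged_rename_case_pt if_distrib[of "case_pt a b"] cong: if_cong)

lemma cob_eval_dual:
  "cob_eval \<alpha> (cob_dual X X' f) a b \<longleftrightarrow> cob_eval \<alpha> f (\<lambda>i. b (length X - 1 - i)) (\<lambda>j. a (length X' - 1 - j))"
  by (simp add: cob_eval_def cob_dual_def plugged_rename_case_pt)

text \<open>A plug is a total function whatever the number of points, so a block of a concatenated
  sequence is selected by shifting the argument. By \<open>cob_eval_cong\<close> values beyond the
  actual points are harmless.\<close>

definition plugs :: "'a set \<Rightarrow> ('p \<Rightarrow> 'a list \<times> 'a list) set" where
  "plugs \<Sigma> = {\<rho>. \<forall>p. \<rho> p \<in> lists \<Sigma> \<times> lists \<Sigma>}"

lemma plugsD: "\<rho> \<in> plugs \<Sigma> \<Longrightarrow> fst (\<rho> p) \<in> lists \<Sigma>" "\<rho> \<in> plugs \<Sigma> \<Longrightarrow> snd (\<rho> p) \<in> lists \<Sigma>"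
  by (auto simp: plugs_def mem_Times_iff)

lemma plugs_comp: "\<rho> \<in> plugs \<Sigma> \<Longrightarrow> \<rho> \<circ> r \<in> plugs \<Sigma>" "\<rho> \<in> plugs \<Sigma> \<Longrightarrow> (\<lambda>i. \<rho> (r i)) \<in> plugs \<Sigma>"
  by (auto simp: plugs_def)

lemma plugs_case_pt: "a \<in> plugs \<Sigma> \<Longrightarrow> b \<in> plugs \<Sigma> \<Longrightarrow> case_pt a b \<in> plugs \<Sigma>"
  by (auto simp: plugs_def split: pt.splits)

lemma plugs_Nil [simp]: "(\<lambda>_. ([], [])) \<in> plugs \<Sigma>"
  by (auto simp: plugs_def)

text \<open>The evaluation of a vertical strand of sign \<open>s\<close> that is plugged by \<open>x\<close> below and by \<open>y\<close> above.\<close>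

definition pairing :: "'a list set \<Rightarrow> sign \<Rightarrow> 'a list \<times> 'a list \<Rightarrow> 'a list \<times> 'a list \<Rightarrow> bool" where
  "pairing L s x y \<longleftrightarrow> (case s of Minus \<Rightarrow> snd x @ fst y \<in> L | Plus \<Rightarrow> snd y @ fst x \<in> L)"

lemma pairing_neg: "pairing L (neg s) x y = pairing L s y x"
  by (cases s) (auto simp: pairing_def)

text \<open>
  Half-intervals with a floating endpoint: what remains of the vertical strands after plugging them
  by \<open>x\<close> from below (\<open>half\<close>) or from above (\<open>half_down\<close>).
\<close>

definition half :: "sign list \<Rightarrow> (nat \<Rightarrow> 'a list \<times> 'a list) \<Rightarrow> 'a cob" where
  "half X x = mset (map (\<lambda>i. case X ! i of
       Minus \<Rightarrow> Arc None (snd (x i)) (Some (Top i))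
     | Plus \<Rightarrow> Arc (Some (Top i)) (fst (x i)) None) [0..<length X])"

definition half_down :: "sign list \<Rightarrow> (nat \<Rightarrow> 'a list \<times> 'a list) \<Rightarrow> 'a cob" where
  "half_down X x = rename (case_pt Bot Bot) (half (map neg X) x)"

section \<open>Half-intervals and strands as morphisms, and their matrices\<close>

lemma positions_upt: "positions X s = filter_mset (\<lambda>i. X ! i = s) (mset [0..<length X])"
  by (rule multiset_eqI) (auto simp: count_positions not_in_iff[symmetric] count_mset_0_iff distinct_count_atmost_1)

lemma starts_mset_map:
  "starts (mset (map F xs)) = image_mset (\<lambda>i. the (start (F i))) (filter_mset (\<lambda>i. start (F i) \<noteq> None) (mset xs))"
  by (induction xs) (auto simp: starts_def)

lemma finishes_mset_map:
  "finishes (mset (map F xs)) = image_mset (\<lambda>i. the (finish (F i))) (filter_mset (\<lambda>i. finish (F i) \<noteq> None) (mset xs))"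
  by (induction xs) (auto simp: finishes_def)

lemma starts_mset_case_sign:
  "starts (mset (map (\<lambda>i. case s i of Plus \<Rightarrow> F i | Minus \<Rightarrow> G i) xs)) =
    starts (mset (map F (filter (\<lambda>i. s i = Plus) xs))) + starts (mset (map G (filter (\<lambda>i. s i = Minus) xs)))"
  by (induction xs) (auto simp: starts_def split: sign.splits)

lemma finishes_mset_case_sign:
  "finishes (mset (map (\<lambda>i. case s i of Plus \<Rightarrow> F i | Minus \<Rightarrow> G i) xs)) =
    finishes (mset (map F (filter (\<lambda>i. s i = Plus) xs))) + finishes (mset (map G (filter (\<lambda>i. s i = Minus) xs)))"
  by (induction xs) (auto simp: finishes_def split: sign.splits)

lemma half_in_Cob:
  assumes "x \<in> plugs \<Sigma>"
  shows "half X x \<in> Cob \<Sigma> [] X"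
proof -
  have "starts (half X x) = image_mset Top (positions X Plus)"
    unfolding half_def starts_mset_case_sign starts_mset_map positions_upt by (simp del: mset_upt)
  moreover have "finishes (half X x) = image_mset Top (positions X Minus)"
    unfolding half_def finishes_mset_case_sign finishes_mset_map positions_upt by (simp del: mset_upt)
  moreover have "\<forall>y\<in>#half X x. labelled_in \<Sigma> y"
    using plugsD[OF assms] by (auto simp: half_def split: sign.splits)
  ultimately show ?thesis by (simp add: Cob_iff)
qed

text \<open>Turning half-intervals upside down exchanges starting and ending at a point of given
  sign; the negated signs in \<open>half_down\<close> compensate for this.\<close>

lemma half_down_in_Cob:
  assumes "x \<in> plugs \<Sigma>"
  shows "half_down X x \<in> Cob \<Sigma> X []"
proof -
  have "positions (map neg X) s = positions X (neg s)" for s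
    unfolding positions_def by (intro arg_cong[where f = mset_set]) auto
  then show ?thesis
    using CobD[OF half_in_Cob[OF assms, of "map neg X"]]
    by (auto simp: Cob_iff half_down_def multiset.map_comp comp_def)
qed

text \<open>Formulated for a sign-preserving bijection \<pi> so that it covers identities and
  braidings alike.\<close>

lemma strands_in_Cob:
  assumes "bij_betw \<pi> {..<length X} {..<length Y}" "\<And>i. i < length X \<Longrightarrow> Y ! \<pi> i = X ! i"
  shows "strands X \<pi> \<in> Cob \<Sigma> X Y"
proof -
  have i: "positions Y s = image_mset \<pi> (positions X s)" for s
  proof -
    have "image_mset \<pi> (positions X s) = mset_set (\<pi> ` {i. i < length X \<and> X ! i = s})"
      unfolding positions_def
      by (rule image_mset_mset_set, rule inj_on_subset[of _ "{..<length X}"])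
        (use assms(1) in \<open>auto simp: bij_betw_def\<close>)
    also have "\<pi> ` {i. i < length X \<and> X ! i = s} = {i. i < length Y \<and> Y ! i = s}"
    proof (intro equalityI subsetI)
      fix j assume j: "j \<in> {i. i < length Y \<and> Y ! i = s}"
      then have "j \<in> \<pi> ` {..<length X}" using assms(1) by (auto simp: bij_betw_def)
      then show "j \<in> \<pi> ` {i. i < length X \<and> X ! i = s}" using j assms(2) by auto
    qed (use assms in \<open>auto simp: bij_betw_def\<close>)
    finally show ?thesis by (simp add: positions_def)
  qed
  have "starts (strands X \<pi>) = image_mset Bot (positions X Minus) + image_mset Top (positions Y Plus)"
    unfolding i unfolding strands_def starts_mset_case_sign starts_mset_map positions_upt
    by (simp add: multiset.map_comp comp_def union_commute del: mset_upt)
  moreover have "finishes (strands X \<pi>) = image_mset Bot (positions X Plus) + image_mset Top (positions Y Minus)"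
    unfolding i unfolding strands_def finishes_mset_case_sign finishes_mset_map positions_upt
    by (simp add: multiset.map_comp comp_def union_commute del: mset_upt)
  moreover have "\<forall>y\<in>#strands X \<pi>. labelled_in \<Sigma> y"
    by (auto simp: strands_def split: sign.splits)
  ultimately show ?thesis by (simp add: Cob_iff)
qed

text \<open>The label of a strand is empty, so the words plugged at its two ends become adjacent,
  which is \<open>pairing\<close>. That this matrix acts as an identity when \<pi> is the identity
  is due to \<open>cob_eval_split\<close>.\<close>

lemma cob_eval_strands: "cob_eval \<alpha> (strands X \<pi>) a b \<longleftrightarrow> (\<forall>i<length X. pairing (fst \<alpha>) (X ! i) (a i) (b (\<pi> i)))"
proof -
  have "plugged_component \<alpha> (case_pt a b) (case s of
       Minus \<Rightarrow> Arc (Some (Bot i)) [] (Some (Top (\<pi> i)))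
     | Plus \<Rightarrow> Arc (Some (Top (\<pi> i))) [] (Some (Bot i))) \<longleftrightarrow> pairing (fst \<alpha>) s (a i) (b (\<pi> i))" for i s
    by (cases s) (auto simp: pairing_def)
  then show ?thesis by (auto simp: cob_eval_def strands_def plugged_def)
qed

lemma cob_eval_half: "cob_eval \<alpha> (half X x) a b \<longleftrightarrow> (\<forall>i<length X. pairing (fst \<alpha>) (X ! i) (x i) (b i))"
proof -
  have "plugged_component \<alpha> (case_pt a b) (case s of
       Minus \<Rightarrow> Arc None (snd (x i)) (Some (Top i))
     | Plus \<Rightarrow> Arc (Some (Top i)) (fst (x i)) None) \<longleftrightarrow> pairing (fst \<alpha>) s (x i) (b i)" for i s
    by (cases s) (auto simp: pairing_def)
  then show ?thesis by (auto simp: cob_eval_def half_def plugged_def)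
qed

lemma cob_eval_half_down: "cob_eval \<alpha> (half_down X x) a b \<longleftrightarrow> (\<forall>i<length X. pairing (fst \<alpha>) (X ! i) (a i) (x i))"
proof -
  have "cob_eval \<alpha> (half_down X x) a b \<longleftrightarrow> cob_eval \<alpha> (half (map neg X) x) a a"
    by (simp add: cob_eval_def half_down_def plugged_rename_case_pt)
  then show ?thesis by (simp add: cob_eval_half pairing_neg)
qed

text \<open>Everything inside this locale rests on the one identity \<open>split_L\<close>.
  Regularity and projectivity produce such a \<open>D\<close> in the last section.\<close>

locale decomposed_language =
  fixes \<Sigma> :: "'a set" and L :: "'a list set" and D :: "('a list \<times> 'a list) set"
  assumes dec: "decomposition_of_identity \<Sigma> L D"
begin

definition \<alpha> :: "'a evaluation" where
  "\<alpha> = (L, associated_circular \<Sigma> L D)"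

abbreviation "V \<equiv> state_space \<Sigma> \<alpha>"
abbreviation "Homs \<equiv> Hom_eval \<Sigma> \<alpha>"
abbreviation "Vs \<equiv> sign_spaces \<Sigma> \<alpha>"
abbreviation "V_map \<equiv> state_map \<Sigma> \<alpha>"
abbreviation "V_union \<equiv> state_union \<Sigma> \<alpha>"
abbreviation "V_unions \<equiv> state_unions \<Sigma> \<alpha>"
abbreviation "V_bend \<equiv> bend_map \<Sigma> \<alpha>"
abbreviation "V_unit \<equiv> state_unit \<Sigma> \<alpha>"
abbreviation "V_tensor \<equiv> state_tensor \<Sigma> \<alpha>"
abbreviation "ev \<equiv> cob_eval \<alpha>"
abbreviation "W \<equiv> plugs \<Sigma>"

lemma finite_D: "finite D"
  using dec by (simp add: decomposition_of_identity_def)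

lemma D_lists: "d \<in> D \<Longrightarrow> fst d \<in> lists \<Sigma>" "d \<in> D \<Longrightarrow> snd d \<in> lists \<Sigma>"
  using dec by (auto simp: decomposition_of_identity_def)

lemma split_L:
  "x \<in> lists \<Sigma> \<Longrightarrow> y \<in> lists \<Sigma> \<Longrightarrow> x @ y \<in> L \<longleftrightarrow> (\<exists>d\<in>D. x @ fst d \<in> L \<and> snd d @ y \<in> L)"
  using dec by (auto simp: decomposition_of_identity_def case_prod_unfold)

lemma fst_\<alpha> [simp]: "fst \<alpha> = L"
  by (simp add: \<alpha>_def)

lemma circ_in_snd_\<alpha>: "w \<in> lists \<Sigma> \<Longrightarrow> circ w \<in> snd \<alpha> \<longleftrightarrow> (\<exists>d\<in>D. snd d @ w @ fst d \<in> L)"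
  using circ_in_associated_circular[OF dec] by (auto simp: \<alpha>_def case_prod_unfold)

text \<open>In the loop case the sum over \<open>D\<close> is the definition of the circular
  language, which \<open>circ_in_associated_circular\<close> makes independent of the cutting point.
  In the arc case \<open>split_L\<close> is applied at the seam of the two words. The other
  components do not touch p and come out of the sum.\<close>

lemma plugged_glue:
  assumes M: "count (starts M) p = 1" "count (finishes M) p = 1" "\<forall>x\<in>#M. labelled_in \<Sigma> x"
    and \<rho>: "\<rho> \<in> W"
  shows "plugged \<alpha> \<rho> (glue p M) \<longleftrightarrow> (\<exists>d\<in>D. plugged \<alpha> (\<rho>(p := d)) M)"
  using M(1,2)
proof (cases rule: glue_cases)
  case (loop w M')
  have "plugged \<alpha> (\<rho>(p := d)) M' \<longleftrightarrow> plugged \<alpha> \<rho> M'" for d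
    using loop by (intro plugged_cong) auto
  then show ?thesis using M(3) loop by (auto simp: circ_in_snd_\<alpha>)
next
  case (arc s w w' t M')
  have *: "plugged \<alpha> (\<rho>(p := d)) M' \<longleftrightarrow> plugged \<alpha> \<rho> M'" for d
    using arc by (intro plugged_cong) auto
  define x where "x = (case s of None \<Rightarrow> [] | Some p \<Rightarrow> snd (\<rho> p))"
  define y where "y = (case t of None \<Rightarrow> [] | Some p \<Rightarrow> fst (\<rho> p))"
  have xy: "x \<in> lists \<Sigma>" "y \<in> lists \<Sigma>"
    using plugsD[OF \<rho>] by (auto simp: x_def y_def split: option.splits)
  \<comment> \<open>The far ends of the two joined components differ from p, so the words plugged
    there survive a change at p.\<close>
  have xd: "(case s of None \<Rightarrow> [] | Some q \<Rightarrow> snd ((\<rho>(p := d)) q)) = x"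
    "(case t of None \<Rightarrow> [] | Some q \<Rightarrow> fst ((\<rho>(p := d)) q)) = y" for d
    using arc(3,4) by (auto simp: x_def y_def split: option.splits)
  have "(x @ w) @ (w' @ y) \<in> L \<longleftrightarrow> (\<exists>d\<in>D. (x @ w) @ fst d \<in> L \<and> snd d @ (w' @ y) \<in> L)"
    by (rule split_L) (use xy M(3) arc(1) in auto)
  then show ?thesis
    unfolding arc(2) unfolding arc(1) by (simp only: plugged_simps plugged_component.simps fst_\<alpha> * xd)
      (auto simp: x_def[symmetric] y_def[symmetric])
qed

text \<open>Summing at one glued point after another amounts to one sum over assignments \<theta> of
  summands to all of them. The right-hand side depends on \<open>ps\<close> only as a set: no trace
  of the order of gluing is left.\<close>

lemma plugged_fold_glue:
  assumes "distinct ps" "\<forall>p\<in>set ps. count (starts M) p = 1 \<and> count (finishes M) p = 1"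
    "\<forall>x\<in>#M. labelled_in \<Sigma> x" "\<rho> \<in> W"
  shows "plugged \<alpha> \<rho> (fold glue ps M) \<longleftrightarrow>
    (\<exists>\<theta>. (\<forall>p\<in>set ps. \<theta> p \<in> D) \<and> plugged \<alpha> (override_on \<rho> \<theta> (set ps)) M)"
  using assms
proof (induction ps arbitrary: M)
  case (Cons p ps)
  have 1: "count (starts M) p = 1" "count (finishes M) p = 1" using Cons.prems by auto
  note s = starts_glue[OF 1] and f = finishes_glue[OF 1]
  have "count (starts (glue p M)) q = 1 \<and> count (finishes (glue p M)) q = 1" if "q \<in> set ps" for q
  proof -
    have "q \<noteq> p" "count (starts M) q = 1" "count (finishes M) q = 1"
      using Cons.prems that by auto
    then show ?thesis by (simp add: s f)
  qed
  then have "plugged \<alpha> \<rho> (fold glue ps (glue p M)) \<longleftrightarrow>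
      (\<exists>\<theta>. (\<forall>p\<in>set ps. \<theta> p \<in> D) \<and> plugged \<alpha> (override_on \<rho> \<theta> (set ps)) (glue p M))"
    using Cons.prems labelled_glue[OF 1] by (intro Cons.IH) auto
  also have "\<dots> \<longleftrightarrow> (\<exists>\<theta>. (\<forall>p\<in>set ps. \<theta> p \<in> D) \<and>
      (\<exists>d\<in>D. plugged \<alpha> ((override_on \<rho> \<theta> (set ps))(p := d)) M))"
  proof (intro ex_cong1 conj_cong refl plugged_glue 1)
    fix \<theta> assume "\<forall>p\<in>set ps. \<theta> p \<in> D"
    then show "override_on \<rho> \<theta> (set ps) \<in> W"
      using Cons.prems(4) D_lists by (auto simp: plugs_def override_on_def mem_Times_iff)
  qed (use Cons.prems in auto)
  also have "\<dots> \<longleftrightarrow> (\<exists>\<theta>. (\<forall>q\<in>set (p # ps). \<theta> q \<in> D) \<and> plugged \<alpha> (override_on \<rho> \<theta> (set (p # ps))) M)"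
  proof safe
    fix \<theta> u v assume *: "\<forall>p\<in>set ps. \<theta> p \<in> D" "(u, v) \<in> D" "plugged \<alpha> ((override_on \<rho> \<theta> (set ps))(p := (u, v))) M"
    \<comment> \<open>The point p is not in \<open>ps\<close>, so its summand can be stored in
      \<theta> without a clash.\<close>
    have "(override_on \<rho> \<theta> (set ps))(p := (u, v)) = override_on \<rho> (\<theta>(p := (u, v))) (set (p # ps))"
      using Cons.prems(1) by (auto simp: override_on_def fun_eq_iff)
    then show "\<exists>\<theta>. (\<forall>q\<in>set (p # ps). \<theta> q \<in> D) \<and> plugged \<alpha> (override_on \<rho> \<theta> (set (p # ps))) M"
      using * by (intro exI[of _ "\<theta>(p := (u, v))"]) auto
  next
    fix \<theta> assume *: "\<forall>q\<in>set (p # ps). \<theta> q \<in> D" "plugged \<alpha> (override_on \<rho> \<theta> (set (p # ps))) M"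
    have "override_on \<rho> \<theta> (set (p # ps)) = (override_on \<rho> \<theta> (set ps))(p := \<theta> p)"
      by (auto simp: override_on_def fun_eq_iff)
    then show "\<exists>\<theta>. (\<forall>p\<in>set ps. \<theta> p \<in> D) \<and>
      (\<exists>d\<in>D. plugged \<alpha> ((override_on \<rho> \<theta> (set ps))(p := d)) M)"
      using * by (intro exI[of _ \<theta>]) auto
  qed
  finally show ?case by simp
qed simp

text \<open>A strand of sign s is attached at the outer endpoint p without changing the value:
  \<open>split_L\<close> cuts the word of the component at p where its label meets the plug. The
  count conditions say that p is an endpoint once, on the side prescribed by s.\<close>

lemma plugged_split_point:
  assumes M: "\<forall>x\<in>#M. labelled_in \<Sigma> x" and \<rho>: "\<rho> \<in> W"
    and s: "count (finishes M) p = (if s = Minus then 1 else 0)"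
      "count (starts M) p = (if s = Plus then 1 else 0)"
  shows "plugged \<alpha> \<rho> M \<longleftrightarrow> (\<exists>d\<in>D. plugged \<alpha> (\<rho>(p := d)) M \<and> pairing L s d (\<rho> p))"
proof (cases s)
  case Minus
  have "p \<in># finishes M" using s Minus by (intro count_inI) simp
  then obtain x where x: "x \<in># M" "finish x = Some p" by (auto simp: finishes_def)
  then obtain q w where xq: "x = Arc q w (Some p)" by (cases x) auto
  obtain M' where M': "M = add_mset x M'" using x(1) by (metis mset_add)
  have q: "q \<noteq> Some p" using s M' xq Minus by auto
  have "count (starts M') p = 0" using s(2) q M' xq Minus by (cases q) auto
  moreover have "count (finishes M') p = 0" using s(1) q M' xq Minus by (cases q) auto
  ultimately have "p \<notin># starts M'" "p \<notin># finishes M'" by (simp_all only: not_in_iff)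
  then have *: "plugged \<alpha> (\<rho>(p := d)) M' \<longleftrightarrow> plugged \<alpha> \<rho> M'" for d
    by (intro plugged_cong) auto
  define y where "y = (case q of None \<Rightarrow> [] | Some p \<Rightarrow> snd (\<rho> p))"
  have y: "y \<in> lists \<Sigma>" using plugsD[OF \<rho>] by (auto simp: y_def split: option.splits)
  have yd: "(case q of None \<Rightarrow> [] | Some q \<Rightarrow> snd ((\<rho>(p := d)) q)) = y" for d
    using q by (auto simp: y_def split: option.splits)
  have "(y @ w) @ fst (\<rho> p) \<in> L \<longleftrightarrow> (\<exists>d\<in>D. (y @ w) @ fst d \<in> L \<and> snd d @ fst (\<rho> p) \<in> L)"
    by (rule split_L) (use y M M' xq plugsD[OF \<rho>] in auto)
  then show ?thesis
    unfolding M' xq by (simp only: plugged_simps plugged_component.simps fst_\<alpha> * yd)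
      (auto simp: y_def[symmetric] pairing_def Minus)
next
  case Plus
  have "p \<in># starts M" using s Plus by (intro count_inI) simp
  then obtain x where x: "x \<in># M" "start x = Some p" by (auto simp: starts_def)
  then obtain q w where xq: "x = Arc (Some p) w q" by (cases x) auto
  obtain M' where M': "M = add_mset x M'" using x(1) by (metis mset_add)
  have q: "q \<noteq> Some p" using s M' xq Plus by auto
  have "count (starts M') p = 0" using s(2) q M' xq Plus by (cases q) auto
  moreover have "count (finishes M') p = 0" using s(1) q M' xq Plus by (cases q) auto
  ultimately have "p \<notin># starts M'" "p \<notin># finishes M'" by (simp_all only: not_in_iff)
  then have *: "plugged \<alpha> (\<rho>(p := d)) M' \<longleftrightarrow> plugged \<alpha> \<rho> M'" for d
    by (intro plugged_cong) auto
  define y where "y = (case q of None \<Rightarrow> [] | Some p \<Rightarrow> fst (\<rho> p))"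
  have y: "y \<in> lists \<Sigma>" using plugsD[OF \<rho>] by (auto simp: y_def split: option.splits)
  have yd: "(case q of None \<Rightarrow> [] | Some q \<Rightarrow> fst ((\<rho>(p := d)) q)) = y" for d
    using q by (auto simp: y_def split: option.splits)
  have "snd (\<rho> p) @ (w @ y) \<in> L \<longleftrightarrow> (\<exists>d\<in>D. snd (\<rho> p) @ fst d \<in> L \<and> snd d @ (w @ y) \<in> L)"
    by (rule split_L) (use y M M' xq plugsD[OF \<rho>] in auto)
  then show ?thesis
    unfolding M' xq by (simp only: plugged_simps plugged_component.simps fst_\<alpha> * yd)
      (auto simp: y_def[symmetric] pairing_def Plus)
qed

lemma plugged_split_points:
  assumes "finite P" "\<forall>x\<in>#M. labelled_in \<Sigma> x" "\<rho> \<in> W"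
    and "\<forall>p\<in>P. count (finishes M) p = (if s p = Minus then 1 else 0) \<and>
      count (starts M) p = (if s p = Plus then 1 else 0)"
  shows "plugged \<alpha> \<rho> M \<longleftrightarrow> (\<exists>\<theta>. (\<forall>p\<in>P. \<theta> p \<in> D \<and> pairing L (s p) (\<theta> p) (\<rho> p)) \<and>
    plugged \<alpha> (override_on \<rho> \<theta> P) M)"
  using assms
proof (induction P arbitrary: \<rho> rule: finite_induct)
  case (insert p P)
  have "plugged \<alpha> \<rho> M \<longleftrightarrow> (\<exists>d\<in>D. plugged \<alpha> (\<rho>(p := d)) M \<and> pairing L (s p) d (\<rho> p))"
    using insert by (intro plugged_split_point) auto
  also have "\<dots> \<longleftrightarrow> (\<exists>d\<in>D. (\<exists>\<theta>. (\<forall>q\<in>P. \<theta> q \<in> D \<and> pairing L (s q) (\<theta> q) ((\<rho>(p := d)) q)) \<and>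
      plugged \<alpha> (override_on (\<rho>(p := d)) \<theta> P) M) \<and> pairing L (s p) d (\<rho> p))"
  proof (intro bex_cong refl conj_cong insert.IH)
    fix d assume "d \<in> D"
    then show "\<rho>(p := d) \<in> W" using insert.prems(2) D_lists by (auto simp: plugs_def mem_Times_iff)
  qed (use insert.prems in auto)
  \<comment> \<open>As p lies outside P, the pairings at the points of P see \<rho> and not the new
    value d.\<close>
  also have "\<dots> \<longleftrightarrow> (\<exists>\<theta>. (\<forall>q\<in>insert p P. \<theta> q \<in> D \<and> pairing L (s q) (\<theta> q) (\<rho> q)) \<and>
    plugged \<alpha> (override_on \<rho> \<theta> (insert p P)) M)" (is "?l \<longleftrightarrow> ?r")
  proof
    assume ?l
    then obtain d \<theta> where *: "d \<in> D" "\<forall>q\<in>P. \<theta> q \<in> D \<and> pairing L (s q) (\<theta> q) ((\<rho>(p := d)) q)"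
      "plugged \<alpha> (override_on (\<rho>(p := d)) \<theta> P) M" "pairing L (s p) d (\<rho> p)" by blast
    have "override_on (\<rho>(p := d)) \<theta> P = override_on \<rho> (\<theta>(p := d)) (insert p P)"
      using insert.hyps by (auto simp: override_on_def fun_eq_iff)
    moreover have "\<forall>q\<in>insert p P. (\<theta>(p := d)) q \<in> D \<and> pairing L (s q) ((\<theta>(p := d)) q) (\<rho> q)"
      using * insert.hyps by (auto split: if_splits)
    ultimately show ?r using *(3) by (intro exI[of _ "\<theta>(p := d)"]) auto
  next
    assume ?r
    then obtain \<theta> where *: "\<forall>q\<in>insert p P. \<theta> q \<in> D \<and> pairing L (s q) (\<theta> q) (\<rho> q)"
      "plugged \<alpha> (override_on \<rho> \<theta> (insert p P)) M" by blast
    have "override_on \<rho> \<theta> (insert p P) = override_on (\<rho>(p := \<theta> p)) \<theta> P"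
      by (auto simp: override_on_def fun_eq_iff)
    moreover have "\<forall>q\<in>P. \<theta> q \<in> D \<and> pairing L (s q) (\<theta> q) ((\<rho>(p := \<theta> p)) q)"
      using * insert.hyps by auto
    moreover have "\<theta> p \<in> D" "pairing L (s p) (\<theta> p) (\<rho> p)" using * by auto
    moreover have "\<forall>q\<in>P. \<theta> q \<in> D \<and> pairing L (s q) (\<theta> q) ((\<rho>(p := \<theta> p)) q)" using * insert.hyps by auto
    moreover have "plugged \<alpha> (override_on (\<rho>(p := \<theta> p)) \<theta> P) M" using * calculation(1) by simp
    ultimately show ?l by blast
  qed
  finally show ?case .
qed simp

text \<open>
  The summands of the decomposition inserted at the points \<open>0, \<dots>, n - 1\<close>. The values at other
  points are fixed in order to make the set finite.
\<close>

definition asg :: "nat \<Rightarrow> (nat \<Rightarrow> 'a list \<times> 'a list) set" where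
  "asg n = {\<theta>. (\<forall>i<n. \<theta> i \<in> D) \<and> (\<forall>i\<ge>n. \<theta> i = ([], []))}"

lemma asg_plugs: "\<theta> \<in> asg n \<Longrightarrow> \<theta> \<in> W"
proof -
  assume *: "\<theta> \<in> asg n"
  have "\<theta> i \<in> lists \<Sigma> \<times> lists \<Sigma>" for i
    using * D_lists[of "\<theta> i"] by (cases "i < n") (auto simp: asg_def mem_Times_iff)
  then show ?thesis by (simp add: plugs_def)
qed

lemma finite_asg: "finite (asg n)"
proof -
  have "inj_on (\<lambda>\<theta>. map \<theta> [0..<n]) (asg n)"
  proof (intro inj_onI ext)
    fix \<theta> \<theta>' i assume "\<theta> \<in> asg n" "\<theta>' \<in> asg n" "map \<theta> [0..<n] = map \<theta>' [0..<n]"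
    then show "\<theta> i = \<theta>' i" by (cases "i < n") (auto simp: asg_def)
  qed
  moreover have "(\<lambda>\<theta>. map \<theta> [0..<n]) ` asg n \<subseteq> {xs. set xs \<subseteq> D \<and> length xs = n}"
    by (auto simp: asg_def)
  ultimately show ?thesis
    using finite_lists_length_eq[OF finite_D] finite_subset finite_imageD by blast
qed

text \<open>This is \<open>plugged_fold_glue\<close> at the interface: an assignment of summands to
  the points \<open>Inr i\<close> amounts to an element of \<open>asg\<close>, the middle index of
  the matrix product.\<close>

lemma cob_eval_comp:
  assumes f: "f \<in> Cob \<Sigma> X X'" and g: "g \<in> Cob \<Sigma> X' X''" and a: "a \<in> W" and b: "b \<in> W"
  shows "ev (cob_comp X' g f) a b \<longleftrightarrow> (\<exists>\<theta>\<in>asg (length X'). ev f a \<theta> \<and> ev g \<theta> b)"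
proof -
  \<comment> \<open>On \<open>Inr\<close> points the value of \<open>projl\<close> is unspecified;
    \<open>override_on\<close> replaces the plug at the interface points.\<close>
  let ?P = "map Inr [0..<length X'] :: (pt + nat) list" and ?\<rho> = "case_pt a b \<circ> projl"
  have f': "ev f a \<theta> \<longleftrightarrow> plugged \<alpha> (override_on ?\<rho> \<theta>' (set ?P) \<circ> case_pt (\<lambda>i. Inl (Bot i)) (\<lambda>j. Inr j)) f"
    and g': "ev g \<theta> b \<longleftrightarrow> plugged \<alpha> (override_on ?\<rho> \<theta>' (set ?P) \<circ> case_pt (\<lambda>i. Inr i) (\<lambda>j. Inl (Top j))) g"
    if "\<forall>i<length X'. \<theta> i = \<theta>' (Inr i)" for \<theta> \<theta>'
    unfolding cob_eval_def
    by (rule plugged_cong; use that in \<open>auto simp: CobD[OF f] CobD[OF g] override_on_def\<close>)+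
  have "ev (cob_comp X' g f) a b \<longleftrightarrow> (\<exists>\<theta>. (\<forall>p\<in>set ?P. \<theta> p \<in> D) \<and>
      plugged \<alpha> (override_on ?\<rho> \<theta> (set ?P)) (rename (case_pt (\<lambda>i. Inl (Bot i)) (\<lambda>j. Inr j)) f +
          rename (case_pt (\<lambda>i. Inr i) (\<lambda>j. Inl (Top j))) g))"
    unfolding cob_eval_def cob_comp_def plugged_rename[of _ _ projl]
    by (rule plugged_fold_glue)
      (use cob_glue_conditions[OF f g] plugs_comp[OF plugs_case_pt[OF a b]] in \<open>auto simp: distinct_map\<close>)
  also have "\<dots> \<longleftrightarrow> (\<exists>\<theta>\<in>asg (length X'). ev f a \<theta> \<and> ev g \<theta> b)" (is "?l \<longleftrightarrow> ?r")
  proof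
    assume ?l
    then obtain \<theta> where \<theta>: "\<forall>p\<in>set ?P. \<theta> p \<in> D"
      "plugged \<alpha> (override_on ?\<rho> \<theta> (set ?P)) (rename (case_pt (\<lambda>i. Inl (Bot i)) (\<lambda>j. Inr j)) f +
          rename (case_pt (\<lambda>i. Inr i) (\<lambda>j. Inl (Top j))) g)" by blast
    define \<theta>' where "\<theta>' i = (if i < length X' then \<theta> (Inr i) else ([], []))" for i
    have "\<theta>' \<in> asg (length X')" using \<theta>(1) by (auto simp: asg_def \<theta>'_def)
    moreover have "\<forall>i<length X'. \<theta>' i = \<theta> (Inr i)" by (simp add: \<theta>'_def)
    ultimately show ?r using \<theta>(2) unfolding plugged_simps plugged_rename by (metis f' g')
  next
    assume ?r
    then obtain \<theta> where \<theta>: "\<theta> \<in> asg (length X')" "ev f a \<theta>" "ev g \<theta> b" by blast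
    define \<theta>' :: "pt + nat \<Rightarrow> _" where "\<theta>' p = \<theta> (projr p)" for p
    have 1: "\<forall>i<length X'. \<theta> i = \<theta>' (Inr i)" by (simp add: \<theta>'_def)
    then have "\<forall>p\<in>set ?P. \<theta>' p \<in> D" using \<theta>(1) by (auto simp: asg_def)
    then show ?l
      using \<theta>(2,3) f'[OF 1] g'[OF 1] unfolding plugged_simps plugged_rename by blast
  qed
  finally show ?thesis .
qed

text \<open>The trace of a product of two matrices, obtained by gluing at all outer points with
  empty words as initial plugs.\<close>

lemma eval_closure:
  assumes f: "f \<in> Cob \<Sigma> X X'" and h: "h \<in> Cob \<Sigma> X' X"
  shows "eval_closed \<alpha> (cob_closure X X' f h) \<longleftrightarrow>
    (\<exists>\<theta>\<in>asg (length X). \<exists>\<theta>'\<in>asg (length X'). ev f \<theta> \<theta>' \<and> ev h \<theta>' \<theta>)"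
proof -
  let ?P = "map Bot [0..<length X] @ map Top [0..<length X']" and ?\<rho> = "\<lambda>_::pt. ([] :: 'a list, [] :: 'a list)"
  have d: "distinct ?P" by (auto simp: distinct_map inj_on_def)
  have "eval_closed \<alpha> (cob_closure X X' f h) \<longleftrightarrow> (\<exists>\<theta>. (\<forall>p\<in>set ?P. \<theta> p \<in> D) \<and>
      plugged \<alpha> (override_on ?\<rho> \<theta> (set ?P)) (f + rename (case_pt Top Bot) h))"
    unfolding eval_closed_iff_plugged cob_closure_def
  proof (rule plugged_fold_glue[OF d])
    \<comment> \<open>At every bottom or top point one of \<open>f\<close> and \<open>h\<close>
      starts and the other ends.\<close>
    have s: "starts (f + rename (case_pt Top Bot) h) = mset ?P" "finishes (f + rename (case_pt Top Bot) h) = mset ?P"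
      by (auto simp: CobD[OF f] CobD[OF h] positions_Plus_Minus[symmetric] multiset.map_comp comp_def ac_simps simp flip: mset_upt)
    show "\<forall>p\<in>set ?P. count (starts (f + rename (case_pt Top Bot) h)) p = 1 \<and>
        count (finishes (f + rename (case_pt Top Bot) h)) p = 1"
      unfolding s using d by (simp add: distinct_count_atmost_1 del: mset_append mset_map distinct_append set_append set_map)
    show "\<forall>x\<in>#f + rename (case_pt Top Bot) h. labelled_in \<Sigma> x"
      using CobD(1)[OF f] CobD(1)[OF h] by auto
  qed simp
  also have "\<dots> \<longleftrightarrow> (\<exists>\<theta>\<in>asg (length X). \<exists>\<theta>'\<in>asg (length X'). ev f \<theta> \<theta>' \<and> ev h \<theta>' \<theta>)" (is "?l \<longleftrightarrow> ?r")
  proof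
    assume ?l
    then obtain \<theta> where \<theta>: "\<forall>p\<in>set ?P. \<theta> p \<in> D"
      "plugged \<alpha> (override_on ?\<rho> \<theta> (set ?P)) (f + rename (case_pt Top Bot) h)" by blast
    define u where "u i = (if i < length X then \<theta> (Bot i) else ([], []))" for i
    define v where "v i = (if i < length X' then \<theta> (Top i) else ([], []))" for i
    have "u \<in> asg (length X)" "v \<in> asg (length X')" using \<theta>(1) by (auto simp: asg_def u_def v_def)
    moreover have "override_on ?\<rho> \<theta> (set ?P) = case_pt u v"
      by (auto simp: override_on_def u_def v_def fun_eq_iff split: pt.splits)
    ultimately show ?r using \<theta>(2) by (auto simp: cob_eval_def plugged_rename_case_pt)
  next
    assume ?r
    then obtain u v where uv: "u \<in> asg (length X)" "v \<in> asg (length X')" "ev f u v" "ev h v u" by blast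
    have "override_on ?\<rho> (case_pt u v) (set ?P) = case_pt u v"
    proof
      fix p show "override_on ?\<rho> (case_pt u v) (set ?P) p = case_pt u v p"
        using uv(1,2) by (cases p) (auto simp: override_on_def asg_def image_iff)
    qed
    then show ?l using uv by (intro exI[of _ "case_pt u v"]) (auto simp: asg_def cob_eval_def plugged_rename_case_pt)
  qed
  finally show ?thesis .
qed

text \<open>Strands are attached at all outer endpoints. Thus a matrix may be multiplied by
  \<open>pairing\<close> on both sides without change, and its finitely many entries with both
  indices in \<open>asg\<close> determine it.\<close>

lemma cob_eval_split:
  assumes f: "f \<in> Cob \<Sigma> X X'" and a: "a \<in> W" and b: "b \<in> W"
  shows "ev f a b \<longleftrightarrow> (\<exists>\<theta>\<in>asg (length X). \<exists>\<theta>'\<in>asg (length X').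
    (\<forall>i<length X. pairing L (X ! i) (a i) (\<theta> i)) \<and> ev f \<theta> \<theta>' \<and>
    (\<forall>j<length X'. pairing L (X' ! j) (\<theta>' j) (b j)))"
proof -
  let ?P = "Bot ` {..<length X} \<union> Top ` {..<length X'}"
  \<comment> \<open>In \<open>plugged_split_points\<close> an end of a component has sign
    \<open>Minus\<close>, which is the convention at top points; at bottom points the roles are
    exchanged, whence \<open>neg\<close>.\<close>
  let ?s = "case_pt (\<lambda>i. neg (X ! i)) (\<lambda>j. X' ! j)"
  have sg: "s \<noteq> Minus \<longleftrightarrow> s = Plus" for s by (cases s) auto
  have "ev f a b \<longleftrightarrow> (\<exists>\<theta>. (\<forall>p\<in>?P. \<theta> p \<in> D \<and> pairing L (?s p) (\<theta> p) (case_pt a b p)) \<and>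
    plugged \<alpha> (override_on (case_pt a b) \<theta> ?P) f)"
    unfolding cob_eval_def
    by (rule plugged_split_points)
      (use CobD(1)[OF f] plugs_case_pt[OF a b] in \<open>auto simp: CobD[OF f] count_positions neg_eq_iff sg\<close>)
  also have "\<dots> \<longleftrightarrow> (\<exists>\<theta>\<in>asg (length X). \<exists>\<theta>'\<in>asg (length X').
    (\<forall>i<length X. pairing L (X ! i) (a i) (\<theta> i)) \<and> ev f \<theta> \<theta>' \<and>
    (\<forall>j<length X'. pairing L (X' ! j) (\<theta>' j) (b j)))" (is "?l \<longleftrightarrow> ?r")
  proof
    assume ?l
    then obtain \<theta> where \<theta>: "\<forall>p\<in>?P. \<theta> p \<in> D \<and> pairing L (?s p) (\<theta> p) (case_pt a b p)"
      "plugged \<alpha> (override_on (case_pt a b) \<theta> ?P) f" by blast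
    define u where "u i = (if i < length X then \<theta> (Bot i) else ([], []))" for i
    define v where "v i = (if i < length X' then \<theta> (Top i) else ([], []))" for i
    have "u \<in> asg (length X)" "v \<in> asg (length X')" using \<theta>(1) by (auto simp: asg_def u_def v_def)
    moreover have "ev f u v"
      unfolding cob_eval_def using \<theta>(2)
      by (rule iffD1[OF plugged_cong, rotated 2])
        (auto simp: CobD[OF f] override_on_def u_def v_def)
    moreover have "\<forall>i<length X. pairing L (X ! i) (a i) (u i)"
      "\<forall>j<length X'. pairing L (X' ! j) (v j) (b j)"
      using \<theta>(1) by (auto simp: u_def v_def pairing_neg ball_Un)
    ultimately show ?r by blast
  next
    assume ?r
    then obtain u v where uv: "u \<in> asg (length X)" "v \<in> asg (length X')" "ev f u v"
      "\<forall>i<length X. pairing L (X ! i) (a i) (u i)"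
      "\<forall>j<length X'. pairing L (X' ! j) (v j) (b j)" by blast
    have "plugged \<alpha> (override_on (case_pt a b) (case_pt u v) ?P) f"
      using uv(3) unfolding cob_eval_def
      by (rule iffD1[OF plugged_cong, rotated 2]) (auto simp: CobD[OF f] override_on_def)
    then show ?l using uv by (intro exI[of _ "case_pt u v"]) (auto simp: asg_def pairing_neg)
  qed
  finally show ?thesis .
qed

text \<open>Each value at plugs is the evaluation of a particular closure, and conversely every
  closure evaluates to a sum of products of values at plugs, by \<open>eval_closure\<close>. So
  testing by cobordisms and testing by words are equally strong.\<close>

lemma cob_equiv_iff:
  "(S, T) \<in> cob_equiv \<Sigma> \<alpha> X X' \<longleftrightarrow> S \<in> Fpow (Cob \<Sigma> X X') \<and> T \<in> Fpow (Cob \<Sigma> X X') \<and>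
    (\<forall>a\<in>W. \<forall>b\<in>W. (\<exists>f\<in>S. ev f a b) \<longleftrightarrow> (\<exists>f\<in>T. ev f a b))"
proof -
  have "(\<forall>h\<in>Cob \<Sigma> X' X. (\<exists>f\<in>S. eval_closed \<alpha> (cob_closure X X' f h)) \<longleftrightarrow>
                        (\<exists>g\<in>T. eval_closed \<alpha> (cob_closure X X' g h))) \<longleftrightarrow>
    (\<forall>a\<in>W. \<forall>b\<in>W. (\<exists>f\<in>S. ev f a b) \<longleftrightarrow> (\<exists>f\<in>T. ev f a b))" (is "?l \<longleftrightarrow> ?r")
    if S: "S \<subseteq> Cob \<Sigma> X X'" and T: "T \<subseteq> Cob \<Sigma> X X'"
  proof
    assume l: ?l
    show ?r
    proof (intro ballI)
      fix a b :: "nat \<Rightarrow> 'a list \<times> 'a list" assume a: "a \<in> W" and b: "b \<in> W"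
      \<comment> \<open>Half-intervals carrying words of b close the top points, those carrying
        words of a close the bottom points. By \<open>eval_closure\<close> the closure then takes
        the value that \<open>cob_eval_split\<close> identifies with the entry at a and b.\<close>
      define h where "h = cob_tensor X' [] (half_down X' b) (half X a)"
      have h: "h \<in> Cob \<Sigma> X' X"
        using cob_tensor_in_Cob[OF half_down_in_Cob[OF b] half_in_Cob[OF a], of X' X] by (simp add: h_def)
      have *: "eval_closed \<alpha> (cob_closure X X' f h) \<longleftrightarrow> ev f a b" if "f \<in> Cob \<Sigma> X X'" for f
        unfolding eval_closure[OF that h] cob_eval_split[OF that a b] unfolding h_def cob_eval_tensor
          cob_eval_half cob_eval_half_down fst_\<alpha> list.size add_0 by blast
      have "(\<exists>f\<in>U. eval_closed \<alpha> (cob_closure X X' f h)) \<longleftrightarrow> (\<exists>f\<in>U. ev f a b)"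
        if "U \<subseteq> Cob \<Sigma> X X'" for U
        using * that by (intro bex_cong) auto
      then show "(\<exists>f\<in>S. ev f a b) \<longleftrightarrow> (\<exists>f\<in>T. ev f a b)"
        using bspec[OF l h] S T by simp
    qed
  next
    assume r: ?r
    show ?l
    proof
      fix h assume h: "h \<in> Cob \<Sigma> X' X"
      \<comment> \<open>The sum over U and the sum over plugs are exchanged, so U enters only
        through its function.\<close>
      have *: "(\<exists>f\<in>U. eval_closed \<alpha> (cob_closure X X' f h)) \<longleftrightarrow>
        (\<exists>\<theta>\<in>asg (length X). \<exists>\<theta>'\<in>asg (length X'). (\<exists>f\<in>U. ev f \<theta> \<theta>') \<and> ev h \<theta>' \<theta>)"
        if "U \<subseteq> Cob \<Sigma> X X'" for U
        using eval_closure[OF _ h] that by blast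
      show "(\<exists>f\<in>S. eval_closed \<alpha> (cob_closure X X' f h)) \<longleftrightarrow>
          (\<exists>g\<in>T. eval_closed \<alpha> (cob_closure X X' g h))"
        unfolding *[OF S] *[OF T]
        by (rule bex_cong[OF HOL.refl], rule bex_cong[OF HOL.refl], rule conj_cong[OF _ HOL.refl])
          (use r asg_plugs in simp)
    qed
  qed
  note eq = this
  show ?thesis
  proof (cases "S \<in> Fpow (Cob \<Sigma> X X') \<and> T \<in> Fpow (Cob \<Sigma> X X')")
    case True
    then have "S \<subseteq> Cob \<Sigma> X X'" "T \<subseteq> Cob \<Sigma> X X'" by (auto simp: Fpow_def)
    from eq[OF this] show ?thesis unfolding cob_equiv_def by (simp only: mem_Collect_eq prod.case)
  qed (auto simp: cob_equiv_def)
qed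

end

section \<open>Homomorphisms of presented semimodules\<close>

lemma bhom_closed: "h \<in> bhom M N \<Longrightarrow> x \<in> carrier M \<Longrightarrow> h x \<in> carrier N"
  by (auto simp: bhom_def hom_def)

lemma bhom_mult: "h \<in> bhom M N \<Longrightarrow> x \<in> carrier M \<Longrightarrow> y \<in> carrier M \<Longrightarrow> h (x \<otimes>\<^bsub>M\<^esub> y) = h x \<otimes>\<^bsub>N\<^esub> h y"
  by (auto simp: bhom_def hom_def)

lemma bhom_one: "h \<in> bhom M N \<Longrightarrow> h \<one>\<^bsub>M\<^esub> = \<one>\<^bsub>N\<^esub>"
  by (auto simp: bhom_def)

lemma bhomI:
  assumes "\<And>x. x \<in> carrier M \<Longrightarrow> h x \<in> carrier N"
    "\<And>x y. x \<in> carrier M \<Longrightarrow> y \<in> carrier M \<Longrightarrow> h (x \<otimes>\<^bsub>M\<^esub> y) = h x \<otimes>\<^bsub>N\<^esub> h y" "h \<one>\<^bsub>M\<^esub> = \<one>\<^bsub>N\<^esub>"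
  shows "h \<in> bhom M N"
  using assms by (auto simp: bhom_def hom_def)

lemma bhom_comp: "f \<in> bhom M N \<Longrightarrow> g \<in> bhom N K \<Longrightarrow> (\<lambda>x. g (f x)) \<in> bhom M K"
  by (rule bhomI) (simp_all add: bhom_closed bhom_mult bhom_one)

lemma bhom_id: "(\<lambda>x. x) \<in> bhom M M"
  by (auto simp: bhom_def hom_def)

text \<open>Idempotence absorbs the repetitions that arise where h identifies indices, so h may be
  any map.\<close>

lemma finprod_image_idem:
  assumes K: "B_semimodule K" and "finite S" "\<phi> \<in> h ` S \<rightarrow> carrier K"
  shows "finprod K \<phi> (h ` S) = finprod K (\<lambda>x. \<phi> (h x)) S"
  using assms(2,3)
proof (induction S)
  case empty
  interpret comm_monoid K using K by (rule B_semimoduleD)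
  show ?case by simp
next
  case (insert a S)
  interpret comm_monoid K using K by (rule B_semimoduleD)
  have "finprod K \<phi> ({h a} \<union> h ` S) = finprod K \<phi> {h a} \<otimes>\<^bsub>K\<^esub> finprod K \<phi> (h ` S)"
    using insert by (intro finprod_Un_idem[OF K]) auto
  then show ?case using insert by (simp add: Pi_iff)
qed

lemma finprod_Times_idem:
  assumes K: "B_semimodule K" and "finite S" "finite T"
    and f: "\<And>x y. x \<in> S \<Longrightarrow> y \<in> T \<Longrightarrow> f x y \<in> carrier K"
  shows "finprod K (\<lambda>x. finprod K (f x) T) S = finprod K (\<lambda>(x, y). f x y) (S \<times> T)"
  using assms(2) f
proof (induction S)
  case empty
  interpret comm_monoid K using K by (rule B_semimoduleD)
  show ?case by simp
next
  case (insert a S)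
  interpret comm_monoid K using K by (rule B_semimoduleD)
  have "insert a S \<times> T = (\<lambda>y. (a, y)) ` T \<union> S \<times> T" by auto
  then have "finprod K (\<lambda>(x, y). f x y) (insert a S \<times> T) =
      finprod K (\<lambda>(x, y). f x y) ((\<lambda>y. (a, y)) ` T \<union> S \<times> T)" by simp
  also have "\<dots> = finprod K (\<lambda>(x, y). f x y) ((\<lambda>y. (a, y)) ` T) \<otimes>\<^bsub>K\<^esub> finprod K (\<lambda>(x, y). f x y) (S \<times> T)"
    using insert assms(3) by (intro finprod_Un_idem[OF K]) auto
  also have "finprod K (\<lambda>(x, y). f x y) ((\<lambda>y. (a, y)) ` T) = finprod K (f a) T"
    using insert assms(3) by (subst finprod_image_idem[OF K]) auto
  finally show ?case using insert by (auto simp: Pi_iff intro!: finprod_closed)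
qed

lemma bpres_comm_monoid: "comm_monoid (bpres X R)"
  using B_semimodule_bpres by (rule B_semimoduleD)

text \<open>Unions of representatives are sums of classes, so every class is built up from
  singletons. This reduces equality of homomorphisms to generators in
  \<open>bpres_hom_eqI\<close>.\<close>

lemma bpres_class_finprod:
  assumes "S \<in> Fpow X"
  shows "bcong X R `` {S} = finprod (bpres X R) (bgen X R) S"
proof -
  interpret comm_monoid "bpres X R" by (rule bpres_comm_monoid)
  have "finite S" "S \<subseteq> X" using assms by (auto simp: Fpow_def)
  then show ?thesis
  proof (induction S)
    case empty
    then show ?case by (simp add: bpres_one)
  next
    case (insert a S)
    have "{a} \<in> Fpow X" "S \<in> Fpow X" using insert by (auto simp: Fpow_def)
    from bpres_mult[OF this, of R] show ?case
      using insert by (auto simp: bgen_def[symmetric] bgen_closed subset_iff Pi_iff)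
  qed
qed

lemma bpres_hom_eqI:
  assumes h: "h \<in> bhom (bpres X R) K" "h' \<in> bhom (bpres X R) K" and K: "comm_monoid K"
    and eq: "\<And>x. x \<in> X \<Longrightarrow> h (bgen X R x) = h' (bgen X R x)" and A: "A \<in> carrier (bpres X R)"
  shows "h A = h' A"
proof -
  interpret K: comm_monoid K by (rule K)
  obtain S where S: "S \<in> Fpow X" "A = bcong X R `` {S}" using A by (rule bpres_carrierE)
  have S': "finite S" "S \<subseteq> X" using S by (auto simp: Fpow_def)
  then have c: "bgen X R \<in> S \<rightarrow> carrier (bpres X R)" by (auto intro: bgen_closed)
  show ?thesis
    unfolding S(2) bpres_class_finprod[OF S(1)]
      bhom_finprod[OF h(1) bpres_comm_monoid K S'(1) c] bhom_finprod[OF h(2) bpres_comm_monoid K S'(1) c]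
    using S'(2) eq c bhom_closed[OF h(2)] by (intro K.finprod_cong') auto
qed

lemma tensor_hom_eqI:
  assumes "h \<in> bhom (tensor M N) K" "h' \<in> bhom (tensor M N) K" "comm_monoid K"
    and "\<And>x y. x \<in> carrier M \<Longrightarrow> y \<in> carrier N \<Longrightarrow> h (pure M N x y) = h' (pure M N x y)"
    and "t \<in> carrier (tensor M N)"
  shows "h t = h' t"
  by (rule bpres_hom_eqI[OF assms(1-3)[unfolded tensor_def] _ assms(5)[unfolded tensor_def]]) (use assms(4) in \<open>auto simp: pure_def\<close>)

text \<open>
  The generators \<open>x i\<close> and the coefficients \<open>c\<close> form a dual basis. The inverse isomorphism sends
  \<open>k\<close> to the sum of the \<open>x i\<close> over \<open>c k\<close>.
\<close>

lemma bext_biso: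
  assumes K: "B_semimodule K" and \<phi>: "\<phi> \<in> X \<rightarrow> carrier K"
    and R: "\<And>S T. (S, T) \<in> R \<Longrightarrow> S \<in> Fpow X \<Longrightarrow> T \<in> Fpow X \<Longrightarrow> finprod K \<phi> S = finprod K \<phi> T"
    and I: "finite I" "x \<in> I \<rightarrow> X"
    and c: "\<And>k. k \<in> carrier K \<Longrightarrow> c k \<subseteq> I" "c \<one>\<^bsub>K\<^esub> = {}"
      "\<And>k l. k \<in> carrier K \<Longrightarrow> l \<in> carrier K \<Longrightarrow> c (k \<otimes>\<^bsub>K\<^esub> l) = c k \<union> c l"
    and expand: "\<And>k. k \<in> carrier K \<Longrightarrow> finprod K (\<lambda>i. \<phi> (x i)) (c k) = k"
    and gen: "\<And>y. y \<in> X \<Longrightarrow> bgen X R y = finprod (bpres X R) (\<lambda>i. bgen X R (x i)) (c (\<phi> y))"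
  shows "bext K \<phi> \<in> biso (bpres X R) K"
proof -
  interpret K: comm_monoid K using K by (rule B_semimoduleD)
  let ?B = "bpres X R"
  interpret B: comm_monoid ?B by (rule bpres_comm_monoid)
  define g where "g k = finprod ?B (\<lambda>i. bgen X R (x i)) (c k)" for k
  have h: "bext K \<phi> \<in> bhom ?B K" by (rule bpres_universal(1)[OF K \<phi> R])
  have bext_gen: "bext K \<phi> (bgen X R y) = \<phi> y" if "y \<in> X" for y
    by (rule bpres_universal(2)[OF K \<phi> R that])
  have xc: "(\<lambda>i. bgen X R (x i)) \<in> c k \<rightarrow> carrier ?B" if "k \<in> carrier K" for k
    using c(1)[OF that] I(2) by (auto intro!: bgen_closed)
  have fc: "finite (c k)" if "k \<in> carrier K" for k
    using c(1)[OF that] I(1) by (rule finite_subset)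
  \<comment> \<open>Since c turns sums into unions, idempotence makes g additive even where the
    unions overlap.\<close>
  have g: "g \<in> bhom K ?B"
  proof (rule bhomI)
    fix k l assume k: "k \<in> carrier K" and l: "l \<in> carrier K"
    show "g k \<in> carrier ?B" unfolding g_def by (rule B.finprod_closed[OF xc[OF k]])
    show "g (k \<otimes>\<^bsub>K\<^esub> l) = g k \<otimes>\<^bsub>?B\<^esub> g l"
      unfolding g_def c(3)[OF k l]
      by (rule finprod_Un_idem[OF B_semimodule_bpres fc[OF k] fc[OF l]]) (use xc[OF k] xc[OF l] in auto)
  qed (simp add: g_def c(2))
  \<comment> \<open>Compared on generators, where the claim is the hypothesis \<open>gen\<close>;
    the other composite reduces by linearity to \<open>expand\<close>.\<close>
  have gb: "g (bext K \<phi> A) = A" if A: "A \<in> carrier ?B" for A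
  proof (rule bpres_hom_eqI[OF bhom_comp[OF h g] bhom_id bpres_comm_monoid _ A])
    fix y assume y: "y \<in> X"
    show "g (bext K \<phi> (bgen X R y)) = bgen X R y"
      using bext_gen[OF y] gen[OF y] by (simp add: g_def)
  qed
  have bg: "bext K \<phi> (g k) = k" if k: "k \<in> carrier K" for k
  proof -
    have "bext K \<phi> (g k) = finprod K (\<lambda>i. bext K \<phi> (bgen X R (x i))) (c k)"
      unfolding g_def by (rule bhom_finprod[OF h B.comm_monoid_axioms K.comm_monoid_axioms fc[OF k] xc[OF k]])
    also have "\<dots> = finprod K (\<lambda>i. \<phi> (x i)) (c k)"
      using c(1)[OF k] I(2) \<phi> bext_gen by (intro K.finprod_cong') auto
    finally show ?thesis using expand[OF k] by simp
  qed
  have "bij_betw (bext K \<phi>) (carrier ?B) (carrier K)"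
    using gb bg bhom_closed[OF h] bhom_closed[OF g] by (intro bij_betw_byWitness[of _ g]) auto
  then show ?thesis using h by (simp add: biso_def)
qed

lemma bgen_base:
  assumes "(S, T) \<in> R" "S \<in> Fpow X" "T \<in> Fpow X"
  shows "bcong X R `` {S} = bcong X R `` {T}"
  by (rule equiv_class_eq[OF equiv_bcong bcong.base[OF assms]])

lemma bgen_insert:
  assumes "x \<in> X" "y \<in> X"
  shows "bcong X R `` {{x, y}} = bgen X R x \<otimes>\<^bsub>bpres X R\<^esub> bgen X R y"
  using bpres_mult[of "{x}" X "{y}" R] assms by (auto simp: bgen_def Fpow_def insert_commute)

section \<open>Bilinear maps and binary tensor products\<close>

lemma pure_closed: "x \<in> carrier M \<Longrightarrow> y \<in> carrier N \<Longrightarrow> pure M N x y \<in> carrier (tensor M N)"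
  by (auto simp: pure_def tensor_def intro: bgen_closed)

lemma pure_bhom_left:
  assumes M: "comm_monoid M" and y: "y \<in> carrier N"
  shows "(\<lambda>x. pure M N x y) \<in> bhom M (tensor M N)"
proof (rule bhomI)
  interpret comm_monoid M by (rule M)
  fix a b assume ab: "a \<in> carrier M" "b \<in> carrier M"
  show "pure M N (a \<otimes>\<^bsub>M\<^esub> b) y = pure M N a y \<otimes>\<^bsub>tensor M N\<^esub> pure M N b y"
    unfolding pure_def tensor_def using ab y
    by (subst bgen_insert[symmetric], simp, simp, unfold bgen_def, intro bgen_base)
      (auto simp: tensor_rel_def Fpow_def)
next
  interpret comm_monoid M by (rule M)
  show "pure M N \<one>\<^bsub>M\<^esub> y = \<one>\<^bsub>tensor M N\<^esub>"
    unfolding pure_def tensor_def bpres_one bgen_def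
    by (intro bgen_base) (use y in \<open>auto simp: tensor_rel_def Fpow_def\<close>)
qed (use y in \<open>simp add: pure_closed\<close>)

lemma pure_bhom_right:
  assumes N: "comm_monoid N" and x: "x \<in> carrier M"
  shows "pure M N x \<in> bhom N (tensor M N)"
proof (rule bhomI)
  interpret comm_monoid N by (rule N)
  fix a b assume ab: "a \<in> carrier N" "b \<in> carrier N"
  show "pure M N x (a \<otimes>\<^bsub>N\<^esub> b) = pure M N x a \<otimes>\<^bsub>tensor M N\<^esub> pure M N x b"
    unfolding pure_def tensor_def using ab x
    by (subst bgen_insert[symmetric], simp, simp, unfold bgen_def, intro bgen_base)
      (auto simp: tensor_rel_def Fpow_def)
next
  interpret comm_monoid N by (rule N)
  show "pure M N x \<one>\<^bsub>N\<^esub> = \<one>\<^bsub>tensor M N\<^esub>"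
    unfolding pure_def tensor_def bpres_one bgen_def
    by (intro bgen_base) (use x in \<open>auto simp: tensor_rel_def Fpow_def\<close>)
qed (use x in \<open>simp add: pure_closed\<close>)

lemma B_semimodule_tensor: "B_semimodule (tensor M N)"
  unfolding tensor_def by (rule B_semimodule_bpres)

lemma tensor_map_universal:
  assumes M': "B_semimodule M'" and N': "B_semimodule N'" and f: "f \<in> bhom M M'" and g: "g \<in> bhom N N'"
  shows tensor_map_bhom: "tensor_map M' N' f g \<in> bhom (tensor M N) (tensor M' N')"
    and tensor_map_pure: "x \<in> carrier M \<Longrightarrow> y \<in> carrier N \<Longrightarrow>
      tensor_map M' N' f g (pure M N x y) = pure M' N' (f x) (g y)"
proof -
  have l: "(\<lambda>x. pure M' N' (f x) (g y)) \<in> bhom M (tensor M' N')" if "y \<in> carrier N" for y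
    by (rule bhom_comp[OF f pure_bhom_left[OF B_semimoduleD(1)[OF M'] bhom_closed[OF g that]]])
  have r: "(\<lambda>y. pure M' N' (f x) (g y)) \<in> bhom N (tensor M' N')" if "x \<in> carrier M" for x
    by (rule bhom_comp[OF g pure_bhom_right[OF B_semimoduleD(1)[OF N'] bhom_closed[OF f that]]])
  show "tensor_map M' N' f g \<in> bhom (tensor M N) (tensor M' N')"
    unfolding tensor_map_def by (rule tensor_universal(1)[OF B_semimodule_tensor l r])
  show "tensor_map M' N' f g (pure M N x y) = pure M' N' (f x) (g y)"
    if "x \<in> carrier M" "y \<in> carrier N"
    unfolding tensor_map_def by (rule tensor_universal(2)[OF B_semimodule_tensor l r that])
qed

text \<open>The sum of b over U is the value of \<open>tensor_lift\<close> at the class of U, and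
  related sets have the same class. The universal property thus returns the well-definedness that
  \<open>bext_biso\<close> asks for.\<close>

lemma tensor_rel_respected:
  assumes K: "B_semimodule K"
    and l: "\<And>y. y \<in> carrier N \<Longrightarrow> (\<lambda>x. b x y) \<in> bhom M K"
    and r: "\<And>x. x \<in> carrier M \<Longrightarrow> b x \<in> bhom N K"
    and ST: "(S, T) \<in> tensor_rel M N" "S \<in> Fpow (carrier M \<times> carrier N)" "T \<in> Fpow (carrier M \<times> carrier N)"
  shows "finprod K (\<lambda>(x, y). b x y) S = finprod K (\<lambda>(x, y). b x y) T"
proof -
  interpret K: comm_monoid K using K by (rule B_semimoduleD)
  have \<phi>: "(\<lambda>(x, y). b x y) \<in> carrier M \<times> carrier N \<rightarrow> carrier K"
    using bhom_closed[OF r] by auto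
  have h: "tensor_lift K b \<in> bhom (tensor M N) K"
    and p: "\<And>x y. x \<in> carrier M \<Longrightarrow> y \<in> carrier N \<Longrightarrow> tensor_lift K b (pure M N x y) = b x y"
    using tensor_universal(1,2)[OF K l r] by auto
  have "finprod K (\<lambda>(x, y). b x y) U = tensor_lift K b (bcong (carrier M \<times> carrier N) (tensor_rel M N) `` {U})"
    if U: "U \<in> Fpow (carrier M \<times> carrier N)" for U
  proof -
    have U': "finite U" "U \<subseteq> carrier M \<times> carrier N" using U by (auto simp: Fpow_def)
    have "tensor_lift K b (bcong (carrier M \<times> carrier N) (tensor_rel M N) `` {U}) =
      finprod K (\<lambda>z. tensor_lift K b (bgen (carrier M \<times> carrier N) (tensor_rel M N) z)) U"
      unfolding bpres_class_finprod[OF U]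
      by (rule bhom_finprod[OF h[unfolded tensor_def] bpres_comm_monoid K.comm_monoid_axioms U'(1)])
        (use U' in \<open>auto intro!: bgen_closed\<close>)
    also have "\<dots> = finprod K (\<lambda>(x, y). b x y) U"
      using U'(2) p by (intro K.finprod_cong') (auto simp: pure_def subset_iff intro!: bhom_closed[OF r])
    finally show ?thesis by simp
  qed
  then show ?thesis using ST bgen_base[OF ST] by simp
qed

section \<open>Multilinear maps and multiple tensor products\<close>

lemma tuples_update: "xs \<in> tuples Ms \<Longrightarrow> i < length Ms \<Longrightarrow> x \<in> carrier (Ms ! i) \<Longrightarrow> xs[i := x] \<in> tuples Ms"
  by (auto simp: tuples_def nth_list_update)

lemma npure_closed: "xs \<in> tuples Ms \<Longrightarrow> npure Ms xs \<in> carrier (ntensor Ms)"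
  by (auto simp: npure_def ntensor_def intro: bgen_closed)

lemma B_semimodule_ntensor: "B_semimodule (ntensor Ms)"
  unfolding ntensor_def by (rule B_semimodule_bpres)

lemma npure_bhom:
  assumes M: "comm_monoid (Ms ! i)" and xs: "xs \<in> tuples Ms" "i < length Ms"
  shows "(\<lambda>x. npure Ms (xs[i := x])) \<in> bhom (Ms ! i) (ntensor Ms)"
proof (rule bhomI)
  interpret comm_monoid "Ms ! i" by (rule M)
  fix a b assume ab: "a \<in> carrier (Ms ! i)" "b \<in> carrier (Ms ! i)"
  note t = tuples_update[OF xs]
  show "npure Ms (xs[i := a \<otimes>\<^bsub>Ms ! i\<^esub> b]) = npure Ms (xs[i := a]) \<otimes>\<^bsub>ntensor Ms\<^esub> npure Ms (xs[i := b])"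
    unfolding npure_def ntensor_def using ab
    by (subst bgen_insert[symmetric], simp add: t, simp add: t, unfold bgen_def, intro bgen_base)
      (use xs in \<open>auto simp: ntensor_rel_def Fpow_def t\<close>)
next
  interpret comm_monoid "Ms ! i" by (rule M)
  show "npure Ms (xs[i := \<one>\<^bsub>Ms ! i\<^esub>]) = \<one>\<^bsub>ntensor Ms\<^esub>"
    unfolding npure_def ntensor_def bpres_one bgen_def
    by (intro bgen_base) (use xs in \<open>auto simp: ntensor_rel_def Fpow_def tuples_update\<close>)
qed (use xs in \<open>simp add: npure_closed tuples_update\<close>)

text \<open>Each relation of \<open>ntensor_rel\<close> concerns a single entry, so linearity in
  each entry separately suffices. This discharges the well-definedness hypothesis of
  \<open>bpres_universal\<close> and \<open>bext_biso\<close>.\<close>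

lemma ntensor_rel_respected:
  assumes K: "B_semimodule K" and \<phi>: "\<phi> \<in> tuples Ms \<rightarrow> carrier K"
    and lin: "\<And>xs i. xs \<in> tuples Ms \<Longrightarrow> i < length Ms \<Longrightarrow> (\<lambda>x. \<phi> (xs[i := x])) \<in> bhom (Ms ! i) K"
    and ST: "(S, T) \<in> ntensor_rel Ms" "S \<in> Fpow (tuples Ms)" "T \<in> Fpow (tuples Ms)"
  shows "finprod K \<phi> S = finprod K \<phi> T"
proof -
  interpret K: comm_monoid K using K by (rule B_semimoduleD)
  have two: "finprod K \<phi> {x, y} = \<phi> x \<otimes>\<^bsub>K\<^esub> \<phi> y" if "x \<in> tuples Ms" "y \<in> tuples Ms" for x y
  proof -
    have "finprod K \<phi> ({x} \<union> {y}) = finprod K \<phi> {x} \<otimes>\<^bsub>K\<^esub> finprod K \<phi> {y}"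
      using that \<phi> by (intro finprod_Un_idem[OF K]) auto
    then show ?thesis using that \<phi> by (auto simp: Pi_iff insert_commute)
  qed
  have one: "finprod K \<phi> {x} = \<phi> x" if "x \<in> tuples Ms" for x
    using that \<phi> by (auto simp: Pi_iff)
  consider (mult) xs i a b where "S = {xs[i := a \<otimes>\<^bsub>Ms ! i\<^esub> b]}" "T = {xs[i := a], xs[i := b]}"
      "xs \<in> tuples Ms" "i < length Ms" "a \<in> carrier (Ms ! i)" "b \<in> carrier (Ms ! i)"
    | (unit) xs i where "S = {xs[i := \<one>\<^bsub>Ms ! i\<^esub>]}" "T = {}" "xs \<in> tuples Ms" "i < length Ms"
    using ST(1) unfolding ntensor_rel_def by blast
  then show ?thesis
  proof cases
    case mult
    then show ?thesis using ST(2,3) bhom_mult[OF lin] by (simp add: one two Fpow_def)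
  next
    case unit
    then show ?thesis using ST(2) bhom_one[OF lin] by (simp add: one Fpow_def)
  qed
qed

lemma ntensor_hom_eqI:
  assumes "h \<in> bhom (ntensor Ms) K" "h' \<in> bhom (ntensor Ms) K" "comm_monoid K"
    and "\<And>xs. xs \<in> tuples Ms \<Longrightarrow> h (npure Ms xs) = h' (npure Ms xs)"
    and "t \<in> carrier (ntensor Ms)"
  shows "h t = h' t"
  by (rule bpres_hom_eqI[OF assms(1-3)[unfolded ntensor_def] _ assms(5)[unfolded ntensor_def]]) (use assms(4) in \<open>auto simp: npure_def\<close>)

section \<open>Classes of formal sums of cobordisms\<close>

context decomposed_language
begin

abbreviation "null \<equiv> (\<lambda>_. ([], []))"

definition cls :: "sign list \<Rightarrow> sign list \<Rightarrow> 'a cob set \<Rightarrow> 'a cob set set" where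
  "cls X X' S = cob_equiv \<Sigma> \<alpha> X X' `` {S}"

text \<open>
  The function of \<open>a\<close> and \<open>b\<close> defined by a formal sum of cobordisms. By \<open>cob_equiv_iff\<close> it is the
  same for all representatives of a class and determines the class, so that all identities between
  classes are checked on it.
\<close>

definition sat :: "'a cob set set \<Rightarrow> (nat \<Rightarrow> 'a list \<times> 'a list) \<Rightarrow> (nat \<Rightarrow> 'a list \<times> 'a list) \<Rightarrow> bool" where
  "sat A a b \<longleftrightarrow> (\<exists>S\<in>A. \<exists>f\<in>S. ev f a b)"

lemma cls_eqI:
  assumes "S \<in> Fpow (Cob \<Sigma> X X')" "T \<in> Fpow (Cob \<Sigma> X X')"
    "\<And>a b. a \<in> W \<Longrightarrow> b \<in> W \<Longrightarrow> (\<exists>f\<in>S. ev f a b) \<longleftrightarrow> (\<exists>f\<in>T. ev f a b)"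
  shows "cls X X' S = cls X X' T"
  using assms by (auto simp: cls_def cob_equiv_iff)

lemma cls_self: "S \<in> Fpow (Cob \<Sigma> X X') \<Longrightarrow> S \<in> cls X X' S"
  by (auto simp: cls_def cob_equiv_iff)

lemma sat_cls:
  assumes "S \<in> Fpow (Cob \<Sigma> X X')" "a \<in> W" "b \<in> W"
  shows "sat (cls X X' S) a b \<longleftrightarrow> (\<exists>f\<in>S. ev f a b)"
proof
  assume "sat (cls X X' S) a b"
  then obtain T where T: "(S, T) \<in> cob_equiv \<Sigma> \<alpha> X X'" "\<exists>f\<in>T. ev f a b"
    by (auto simp: sat_def cls_def)
  then show "\<exists>f\<in>S. ev f a b" using assms(2,3) unfolding cob_equiv_iff by blast
next
  assume "\<exists>f\<in>S. ev f a b"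
  then show "sat (cls X X' S) a b" using cls_self[OF assms(1)] by (auto simp: sat_def)
qed

lemma Hom_eval_carrier: "carrier (Homs X X') = cls X X' ` Fpow (Cob \<Sigma> X X')"
  by (auto simp: Hom_eval_def bquot_def quotient_def cls_def)

lemma cls_closed: "S \<in> Fpow (Cob \<Sigma> X X') \<Longrightarrow> cls X X' S \<in> carrier (Homs X X')"
  by (auto simp: Hom_eval_carrier)

lemma Hom_eval_carrierE:
  assumes "A \<in> carrier (Homs X X')"
  obtains S where "S \<in> Fpow (Cob \<Sigma> X X')" "A = cls X X' S"
  using assms by (auto simp: Hom_eval_carrier)

lemma Hom_eval_eqI:
  assumes "A \<in> carrier (Homs X X')" "B \<in> carrier (Homs X X')"
    "\<And>a b. a \<in> W \<Longrightarrow> b \<in> W \<Longrightarrow> sat A a b \<longleftrightarrow> sat B a b"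
  shows "A = B"
proof -
  obtain S T where ST: "S \<in> Fpow (Cob \<Sigma> X X')" "A = cls X X' S" "T \<in> Fpow (Cob \<Sigma> X X')" "B = cls X X' T"
    using assms(1,2) by (auto simp: Hom_eval_carrier)
  show ?thesis unfolding ST(2,4)
    using assms(3) by (intro cls_eqI ST) (simp add: ST sat_cls)
qed

text \<open>Operations on classes are defined as unions over all representatives. If the summand is
  constant on the class, the union collapses to its value, as the class is nonempty.\<close>

lemma UN_cls:
  assumes "S \<in> Fpow (Cob \<Sigma> X X')"
    and "\<And>T. T \<in> Fpow (Cob \<Sigma> X X') \<Longrightarrow> cls X X' T = cls X X' S \<Longrightarrow> F T = F S"
  shows "(\<Union>T\<in>cls X X' S. F T) = F S"
proof -
  have "F T = F S" if "T \<in> cls X X' S" for T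
  proof -
    note st = that[unfolded cls_def Image_singleton_iff cob_equiv_iff]
    have T: "T \<in> Fpow (Cob \<Sigma> X X')" by (rule st[THEN conjunct2, THEN conjunct1])
    have eq: "\<And>a b. a \<in> W \<Longrightarrow> b \<in> W \<Longrightarrow> (\<exists>f\<in>T. ev f a b) \<longleftrightarrow> (\<exists>f\<in>S. ev f a b)"
      by (rule st[THEN conjunct2, THEN conjunct2, rule_format, symmetric])
    from T show ?thesis by (rule assms(2)) (rule cls_eqI[OF T assms(1) eq])
  qed
  then have "(\<Union>T\<in>cls X X' S. F T) = (\<Union>T\<in>cls X X' S. F S)"
    by (intro SUP_cong HOL.refl)
  also have "cls X X' S \<noteq> {}" using cls_self[OF assms(1)] by blast
  then have "(\<Union>T\<in>cls X X' S. F S) = F S" by simp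
  finally show ?thesis .
qed

lemma sat_cls_eq:
  assumes "cls X X' T = cls X X' S" "S \<in> Fpow (Cob \<Sigma> X X')" "T \<in> Fpow (Cob \<Sigma> X X')"
    "a \<in> W" "b \<in> W"
  shows "(\<exists>f\<in>T. ev f a b) \<longleftrightarrow> (\<exists>f\<in>S. ev f a b)"
  using sat_cls[OF assms(2,4,5)] sat_cls[OF assms(3,4,5)] assms(1) by simp

section \<open>The semimodule of classes\<close>

lemma Hom_eval_mult:
  assumes S: "S \<in> Fpow (Cob \<Sigma> X X')" and T: "T \<in> Fpow (Cob \<Sigma> X X')"
  shows "cls X X' S \<otimes>\<^bsub>Homs X X'\<^esub> cls X X' T = cls X X' (S \<union> T)"
proof -
  have 1: "cls X X' (S' \<union> T') = cls X X' (S \<union> T)"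
    if "S' \<in> Fpow (Cob \<Sigma> X X')" "cls X X' S' = cls X X' S"
      "T' \<in> Fpow (Cob \<Sigma> X X')" "cls X X' T' = cls X X' T" for S' T'
    using sat_cls_eq[OF that(2) S that(1)] sat_cls_eq[OF that(4) T that(3)] that S T
    by (intro cls_eqI Fpow_Un) (auto simp: bex_Un)
  have "cls X X' S \<otimes>\<^bsub>Homs X X'\<^esub> cls X X' T =
      (\<Union>S'\<in>cls X X' S. \<Union>T'\<in>cls X X' T. cls X X' (S' \<union> T'))"
    by (simp add: Hom_eval_def bquot_def cls_def)
  also have "\<dots> = (\<Union>T'\<in>cls X X' T. cls X X' (S \<union> T'))"
  proof (rule UN_cls[OF S])
    fix S' assume S': "S' \<in> Fpow (Cob \<Sigma> X X')" "cls X X' S' = cls X X' S"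
    show "(\<Union>T'\<in>cls X X' T. cls X X' (S' \<union> T')) = (\<Union>T'\<in>cls X X' T. cls X X' (S \<union> T'))"
    proof (intro SUP_cong HOL.refl)
      fix T' assume "T' \<in> cls X X' T"
      then have "T' \<in> Fpow (Cob \<Sigma> X X')" by (auto simp: cls_def cob_equiv_iff)
      then show "cls X X' (S' \<union> T') = cls X X' (S \<union> T')"
        using sat_cls_eq[OF S'(2) S S'(1)] S S' by (intro cls_eqI Fpow_Un) (auto simp: bex_Un)
    qed
  qed
  also have "\<dots> = cls X X' (S \<union> T)"
    by (rule UN_cls[OF T]) (use 1[OF S] in auto)
  finally show ?thesis .
qed

lemma Hom_eval_one: "\<one>\<^bsub>Homs X X'\<^esub> = cls X X' {}"
  by (simp add: Hom_eval_def bquot_def cls_def)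

lemma empty_Fpow: "{} \<in> Fpow X"
  by (simp add: Fpow_def)

lemma Hom_eval_one_closed: "\<one>\<^bsub>Homs X X'\<^esub> \<in> carrier (Homs X X')"
  by (simp add: Hom_eval_one cls_closed empty_Fpow)

lemma sat_one: "a \<in> W \<Longrightarrow> b \<in> W \<Longrightarrow> \<not> sat \<one>\<^bsub>Homs X X'\<^esub> a b"
  by (simp add: Hom_eval_one sat_cls empty_Fpow)

lemma sat_mult:
  assumes "A \<in> carrier (Homs X X')" "B \<in> carrier (Homs X X')" "a \<in> W" "b \<in> W"
  shows "sat (A \<otimes>\<^bsub>Homs X X'\<^esub> B) a b \<longleftrightarrow> sat A a b \<or> sat B a b"
  using assms by (auto elim!: Hom_eval_carrierE simp: Hom_eval_mult sat_cls Fpow_Un bex_Un)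

lemma B_semimodule_Hom_eval: "B_semimodule (Homs X X')"
  unfolding B_semimodule_def
  by (intro conjI ballI comm_monoidI)
    (auto elim!: Hom_eval_carrierE simp: Hom_eval_mult Hom_eval_one cls_closed Fpow_Un empty_Fpow Un_ac)

lemma comm_monoid_Hom_eval: "comm_monoid (Homs X X')"
  using B_semimodule_Hom_eval by (rule B_semimoduleD)

lemma sat_finprod:
  assumes "finite I" "\<phi> \<in> I \<rightarrow> carrier (Homs X X')" "a \<in> W" "b \<in> W"
  shows "sat (finprod (Homs X X') \<phi> I) a b \<longleftrightarrow> (\<exists>i\<in>I. sat (\<phi> i) a b)"
  using assms(1,2)
proof (induction I)
  case empty
  interpret comm_monoid "Homs X X'" by (rule comm_monoid_Hom_eval)
  show ?case using assms by (simp add: sat_one)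
next
  case (insert i I)
  interpret comm_monoid "Homs X X'" by (rule comm_monoid_Hom_eval)
  have "finprod (Homs X X') \<phi> I \<in> carrier (Homs X X')"
    using insert by (intro finprod_closed) auto
  then show ?case using insert assms(3,4) by (auto simp: sat_mult)
qed

text \<open>A map that acts on functions by summation over a set \<open>R a b\<close> of entries is
  additive, because existential quantifiers distribute over disjunctions. Boolean matrices,
  relabellings of points and Boolean scalars are all of this form.\<close>

lemma Hom_eval_bhomI:
  assumes closed: "\<And>A. A \<in> carrier (Homs X X') \<Longrightarrow> h A \<in> carrier (Homs Y Y')"
    and sat: "\<And>A a b. A \<in> carrier (Homs X X') \<Longrightarrow> a \<in> W \<Longrightarrow> b \<in> W \<Longrightarrow>
      sat (h A) a b \<longleftrightarrow> (\<exists>(c, d)\<in>R a b. sat A c d)"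
    and R: "\<And>a b. a \<in> W \<Longrightarrow> b \<in> W \<Longrightarrow> R a b \<subseteq> W \<times> W"
  shows "h \<in> bhom (Homs X X') (Homs Y Y')"
proof (rule bhomI)
  interpret M: comm_monoid "Homs X X'" by (rule comm_monoid_Hom_eval)
  interpret N: comm_monoid "Homs Y Y'" by (rule comm_monoid_Hom_eval)
  fix A assume A: "A \<in> carrier (Homs X X')"
  show "h A \<in> carrier (Homs Y Y')" by (rule closed[OF A])
  fix B assume B: "B \<in> carrier (Homs X X')"
  show "h (A \<otimes>\<^bsub>Homs X X'\<^esub> B) = h A \<otimes>\<^bsub>Homs Y Y'\<^esub> h B"
  proof (rule Hom_eval_eqI[of _ Y Y'])
    fix a b :: "nat \<Rightarrow> 'a list \<times> 'a list" assume ab: "a \<in> W" "b \<in> W"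
    have "sat (A \<otimes>\<^bsub>Homs X X'\<^esub> B) c d \<longleftrightarrow> sat A c d \<or> sat B c d" if "(c, d) \<in> R a b" for c d
      using R[OF ab] that by (intro sat_mult A B) auto
    then show "sat (h (A \<otimes>\<^bsub>Homs X X'\<^esub> B)) a b \<longleftrightarrow> sat (h A \<otimes>\<^bsub>Homs Y Y'\<^esub> h B) a b"
      unfolding sat_mult[OF closed[OF A] closed[OF B] ab] sat[OF M.m_closed[OF A B] ab]
        sat[OF A ab] sat[OF B ab] by fastforce
  qed (use A B closed in auto)
next
  interpret M: comm_monoid "Homs X X'" by (rule comm_monoid_Hom_eval)
  show "h \<one>\<^bsub>Homs X X'\<^esub> = \<one>\<^bsub>Homs Y Y'\<^esub>"
  proof (rule Hom_eval_eqI[of _ Y Y'])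
    fix a b :: "nat \<Rightarrow> 'a list \<times> 'a list" assume ab: "a \<in> W" "b \<in> W"
    show "sat (h \<one>\<^bsub>Homs X X'\<^esub>) a b \<longleftrightarrow> sat \<one>\<^bsub>Homs Y Y'\<^esub> a b"
      unfolding sat[OF M.one_closed ab] using R[OF ab] by (auto simp: sat_one ab)
  qed (simp_all add: closed Hom_eval_one_closed)
qed

text \<open>Exchanging the sum over the cobordisms of a representative with the sum over
  \<open>R a b\<close> shows that the function of the image depends only on the function of A, hence
  only on its class.\<close>

lemma induced_linear:
  assumes \<phi>: "\<And>f. f \<in> Cob \<Sigma> X X' \<Longrightarrow> \<phi> f \<in> Cob \<Sigma> Y Y'"
    and H: "\<And>f a b. f \<in> Cob \<Sigma> X X' \<Longrightarrow> a \<in> W \<Longrightarrow> b \<in> W \<Longrightarrow>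
      ev (\<phi> f) a b \<longleftrightarrow> (\<exists>(c, d)\<in>R a b. ev f c d)"
    and R: "\<And>a b. a \<in> W \<Longrightarrow> b \<in> W \<Longrightarrow> R a b \<subseteq> W \<times> W"
  shows "induced (cob_equiv \<Sigma> \<alpha> Y Y') \<phi> \<in> bhom (Homs X X') (Homs Y Y')"
    and "A \<in> carrier (Homs X X') \<Longrightarrow> a \<in> W \<Longrightarrow> b \<in> W \<Longrightarrow>
      sat (induced (cob_equiv \<Sigma> \<alpha> Y Y') \<phi> A) a b \<longleftrightarrow> (\<exists>(c, d)\<in>R a b. sat A c d)"
proof -
  let ?h = "induced (cob_equiv \<Sigma> \<alpha> Y Y') \<phi>"
  have \<phi>S: "\<phi> ` S \<in> Fpow (Cob \<Sigma> Y Y')" if "S \<in> Fpow (Cob \<Sigma> X X')" for S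
    using that \<phi> by (auto simp: Fpow_def)
  have H': "(\<exists>f\<in>\<phi> ` S. ev f a b) \<longleftrightarrow> (\<exists>(c, d)\<in>R a b. \<exists>f\<in>S. ev f c d)"
    if "S \<in> Fpow (Cob \<Sigma> X X')" "a \<in> W" "b \<in> W" for S a b
  proof -
    have "(\<exists>f\<in>\<phi> ` S. ev f a b) \<longleftrightarrow> (\<exists>f\<in>S. \<exists>(c, d)\<in>R a b. ev f c d)"
      using that H[OF _ that(2,3)] by (auto simp: Fpow_def subset_iff)
    then show ?thesis by blast
  qed
  have h: "?h (cls X X' S) = cls Y Y' (\<phi> ` S)" if S: "S \<in> Fpow (Cob \<Sigma> X X')" for S
    unfolding induced_def cls_def[symmetric]
  proof (rule UN_cls[OF S])
    fix T assume T: "T \<in> Fpow (Cob \<Sigma> X X')" "cls X X' T = cls X X' S"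
    show "cls Y Y' (\<phi> ` T) = cls Y Y' (\<phi> ` S)"
    proof (rule cls_eqI[OF \<phi>S[OF T(1)] \<phi>S[OF S]])
      fix a b :: "nat \<Rightarrow> 'a list \<times> 'a list" assume ab: "a \<in> W" "b \<in> W"
      show "(\<exists>f\<in>\<phi> ` T. ev f a b) \<longleftrightarrow> (\<exists>f\<in>\<phi> ` S. ev f a b)"
        unfolding H'[OF S ab] H'[OF T(1) ab]
      proof (intro bex_cong HOL.refl)
        fix z assume "z \<in> R a b"
        then show "(case z of (c, d) \<Rightarrow> \<exists>f\<in>T. ev f c d) \<longleftrightarrow> (case z of (c, d) \<Rightarrow> \<exists>f\<in>S. ev f c d)"
          using subsetD[OF R[OF ab]] sat_cls_eq[OF T(2) S T(1), of "fst z" "snd z"]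
          by (simp add: case_prod_unfold mem_Times_iff)
      qed
    qed
  qed
  show s: "sat (?h A) a b \<longleftrightarrow> (\<exists>(c, d)\<in>R a b. sat A c d)"
    if A: "A \<in> carrier (Homs X X')" and ab: "a \<in> W" "b \<in> W" for A a b
  proof -
    obtain S where S: "S \<in> Fpow (Cob \<Sigma> X X')" "A = cls X X' S" using A by (rule Hom_eval_carrierE)
    show ?thesis
      unfolding S(2) h[OF S(1)] sat_cls[OF \<phi>S[OF S(1)] ab] H'[OF S(1) ab]
      by (intro bex_cong HOL.refl)
        (use subsetD[OF R[OF ab]] in \<open>simp add: case_prod_unfold mem_Times_iff sat_cls[OF S(1)]\<close>)
  qed
  show "?h \<in> bhom (Homs X X') (Homs Y Y')"
    by (rule Hom_eval_bhomI[OF _ s R]) (auto elim!: Hom_eval_carrierE simp: h cls_closed \<phi>S)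
qed

lemma
  assumes h: "h \<in> Cob \<Sigma> Y X" and g: "g \<in> Cob \<Sigma> X' Y'"
  shows Hom_map_bhom: "Hom_map \<Sigma> \<alpha> Y X X' Y' h g \<in> bhom (Homs X X') (Homs Y Y')"
    and sat_Hom_map: "A \<in> carrier (Homs X X') \<Longrightarrow> a \<in> W \<Longrightarrow> b \<in> W \<Longrightarrow>
      sat (Hom_map \<Sigma> \<alpha> Y X X' Y' h g A) a b \<longleftrightarrow>
      (\<exists>\<theta>\<in>asg (length X). \<exists>\<theta>'\<in>asg (length X'). ev h a \<theta> \<and> sat A \<theta> \<theta>' \<and> ev g \<theta>' b)"
proof -
  \<comment> \<open>The pairs of inner indices at which both h and g have entry 1: multiplication by
    their matrices from both sides.\<close>
  define R where "R a b = {(\<theta>, \<theta>'). \<theta> \<in> asg (length X) \<and> \<theta>' \<in> asg (length X') \<and> ev h a \<theta> \<and> ev g \<theta>' b}" for a b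
  have 1: "cob_comp X' g (cob_comp X f h) \<in> Cob \<Sigma> Y Y'" if "f \<in> Cob \<Sigma> X X'" for f
    by (rule cob_comp_in_Cob[OF cob_comp_in_Cob[OF h that] g])
  have 2: "ev (cob_comp X' g (cob_comp X f h)) a b \<longleftrightarrow> (\<exists>(c, d)\<in>R a b. ev f c d)"
    if f: "f \<in> Cob \<Sigma> X X'" and ab: "a \<in> W" "b \<in> W" for f a b
  proof -
    have "ev (cob_comp X f h) a \<theta> \<longleftrightarrow> (\<exists>\<theta>'\<in>asg (length X). ev h a \<theta>' \<and> ev f \<theta>' \<theta>)"
      if "\<theta> \<in> asg (length X')" for \<theta>
      by (rule cob_eval_comp[OF h f ab(1) asg_plugs[OF that]])
    then show ?thesis
      unfolding cob_eval_comp[OF cob_comp_in_Cob[OF h f] g ab] by (auto simp: R_def)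
  qed
  have 3: "R a b \<subseteq> W \<times> W" for a b
    using asg_plugs by (auto simp: R_def)
  show "Hom_map \<Sigma> \<alpha> Y X X' Y' h g \<in> bhom (Homs X X') (Homs Y Y')"
    unfolding Hom_map_def by (rule induced_linear(1)[of X X' "\<lambda>f. cob_comp X' g (cob_comp X f h)" Y Y' R, OF 1 2 3])
  show "sat (Hom_map \<Sigma> \<alpha> Y X X' Y' h g A) a b \<longleftrightarrow>
      (\<exists>\<theta>\<in>asg (length X). \<exists>\<theta>'\<in>asg (length X'). ev h a \<theta> \<and> sat A \<theta> \<theta>' \<and> ev g \<theta>' b)"
    if "A \<in> carrier (Homs X X')" "a \<in> W" "b \<in> W"
  proof -
    have "sat (Hom_map \<Sigma> \<alpha> Y X X' Y' h g A) a b \<longleftrightarrow> (\<exists>(c, d)\<in>R a b. sat A c d)"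
      unfolding Hom_map_def by (rule induced_linear(2)[of X X' "\<lambda>f. cob_comp X' g (cob_comp X f h)" Y Y' R, OF 1 2 3 that])
    then show ?thesis by (auto simp: R_def)
  qed
qed

lemma
  shows bend_map_bhom: "V_bend X X' \<in> bhom (Homs X X') (V (dual X @ X'))"
    and sat_bend_map: "A \<in> carrier (Homs X X') \<Longrightarrow> a \<in> W \<Longrightarrow> b \<in> W \<Longrightarrow>
      sat (V_bend X X' A) a b \<longleftrightarrow> sat A (\<lambda>i. b (length X - 1 - i)) (\<lambda>j. b (length X + j))"
proof -
  \<comment> \<open>Bending only relocates endpoints, so a single entry is read off.\<close>
  define R where "R a b = {(\<lambda>i. b (length X - 1 - i), \<lambda>j. b (length X + j))}"
    for a b :: "nat \<Rightarrow> 'a list \<times> 'a list"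
  have 2: "ev (cob_bend X f) a b \<longleftrightarrow> (\<exists>(c, d)\<in>R a b. ev f c d)" for f a b
    by (simp add: R_def cob_eval_bend)
  have 3: "R a b \<subseteq> W \<times> W" if "b \<in> W" for a b
    using plugs_comp(2)[OF that] by (auto simp: R_def)
  show "V_bend X X' \<in> bhom (Homs X X') (V (dual X @ X'))"
    unfolding bend_map_def state_space_def by (rule induced_linear(1)[of X X' "cob_bend X" "[]" "dual X @ X'" R, OF cob_bend_in_Cob 2 3])
  show "sat (V_bend X X' A) a b \<longleftrightarrow> sat A (\<lambda>i. b (length X - 1 - i)) (\<lambda>j. b (length X + j))"
    if "A \<in> carrier (Homs X X')" "a \<in> W" "b \<in> W"
  proof -
    have "sat (V_bend X X' A) a b \<longleftrightarrow> (\<exists>(c, d)\<in>R a b. sat A c d)"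
      unfolding bend_map_def by (rule induced_linear(2)[of X X' "cob_bend X" "[]" "dual X @ X'" R, OF cob_bend_in_Cob 2 3 that])
    then show ?thesis by (auto simp: R_def)
  qed
qed

lemma
  assumes g: "g \<in> Cob \<Sigma> X X'"
  shows state_map_bhom: "V_map X X' g \<in> bhom (V X) (V X')"
    and sat_state_map: "A \<in> carrier (V X) \<Longrightarrow> a \<in> W \<Longrightarrow> b \<in> W \<Longrightarrow>
      sat (V_map X X' g A) a b \<longleftrightarrow> (\<exists>\<theta>\<in>asg (length X). sat A a \<theta> \<and> ev g \<theta> b)"
proof -
  define R where "R a b = {(a, \<theta>) | \<theta>. \<theta> \<in> asg (length X) \<and> ev g \<theta> b}" for a b :: "nat \<Rightarrow> 'a list \<times> 'a list"
  have 2: "ev (cob_comp X g f) a b \<longleftrightarrow> (\<exists>(c, d)\<in>R a b. ev f c d)"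
    if f: "f \<in> Cob \<Sigma> [] X" and ab: "a \<in> W" "b \<in> W" for f a b
    unfolding cob_eval_comp[OF f g ab] by (auto simp: R_def)
  have 3: "R a b \<subseteq> W \<times> W" if "a \<in> W" for a b
    using asg_plugs that by (auto simp: R_def)
  show "V_map X X' g \<in> bhom (V X) (V X')"
    unfolding state_map_def state_space_def by (rule induced_linear(1)[of "[]" X "cob_comp X g" "[]" X' R, OF cob_comp_in_Cob[OF _ g] 2 3])
  show "sat (V_map X X' g A) a b \<longleftrightarrow> (\<exists>\<theta>\<in>asg (length X). sat A a \<theta> \<and> ev g \<theta> b)"
    if "A \<in> carrier (V X)" "a \<in> W" "b \<in> W"
  proof -
    have "sat (V_map X X' g A) a b \<longleftrightarrow> (\<exists>(c, d)\<in>R a b. sat A c d)"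
      unfolding state_map_def by (rule induced_linear(2)[of "[]" X "cob_comp X g" "[]" X' R, OF cob_comp_in_Cob[OF _ g] 2 3 that[unfolded state_space_def]])
    then show ?thesis by (auto simp: R_def)
  qed
qed

lemma Hom_sat_cong:
  assumes "A \<in> carrier (Homs X X')" "a \<in> W" "b \<in> W" "a' \<in> W" "b' \<in> W"
    "\<And>i. i < length X \<Longrightarrow> a i = a' i" "\<And>i. i < length X' \<Longrightarrow> b i = b' i"
  shows "sat A a b \<longleftrightarrow> sat A a' b'"
proof -
  obtain S where S: "S \<in> Fpow (Cob \<Sigma> X X')" "A = cls X X' S"
    using assms(1) by (rule Hom_eval_carrierE)
  have "ev f a b \<longleftrightarrow> ev f a' b'" if "f \<in> S" for f
    using S(1) that assms(6,7) by (intro cob_eval_cong[of f \<Sigma> X X']) (auto simp: Fpow_def)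
  then show ?thesis using assms S by (simp add: sat_cls)
qed

lemma state_sat_cong:
  assumes "A \<in> carrier (V X)" "a \<in> W" "b \<in> W" "a' \<in> W" "b' \<in> W"
    "\<And>i. i < length X \<Longrightarrow> b i = b' i"
  shows "sat A a b \<longleftrightarrow> sat A a' b'"
  using assms by (intro Hom_sat_cong[of A "[]" X]) (simp_all add: state_space_def)

text \<open>A state has no bottom points, so its function depends on the top plug alone and the
  first index can be fixed to \<open>null\<close>.\<close>

lemma state_eqI:
  assumes "A \<in> carrier (V X)" "B \<in> carrier (V X)"
    "\<And>b. b \<in> W \<Longrightarrow> sat A null b \<longleftrightarrow> sat B null b"
  shows "A = B"
proof (rule Hom_eval_eqI[OF assms(1,2)[unfolded state_space_def]])
  fix a b :: "nat \<Rightarrow> 'a list \<times> 'a list" assume ab: "a \<in> W" "b \<in> W"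
  have "sat A a b \<longleftrightarrow> sat A null b" "sat B a b \<longleftrightarrow> sat B null b"
    using state_sat_cong[OF assms(1) ab plugs_Nil ab(2)] state_sat_cong[OF assms(2) ab plugs_Nil ab(2)]
    by auto
  then show "sat A a b \<longleftrightarrow> sat B a b" using assms(3) ab by simp
qed

section \<open>Expansion of states in half-intervals\<close>

lemma asg_0: "asg 0 = {null}"
  by (auto simp: asg_def)

text \<open>This is \<open>cob_eval_split\<close> with empty bottom, summed over a representative;
  \<open>asg 0\<close> contributes the single index \<open>null\<close>. It says that identity
  strands fix the function of a state.\<close>

lemma state_split:
  assumes "A \<in> carrier (V X)" "b \<in> W"
  shows "sat A null b \<longleftrightarrow>
    (\<exists>\<theta>\<in>asg (length X). sat A null \<theta> \<and> (\<forall>j<length X. pairing L (X ! j) (\<theta> j) (b j)))"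
proof -
  obtain S where S: "S \<in> Fpow (Cob \<Sigma> [] X)" "A = cls [] X S"
    using assms(1) unfolding state_space_def by (rule Hom_eval_carrierE)
  have "ev f null b \<longleftrightarrow> (\<exists>\<theta>\<in>asg (length X). ev f null \<theta> \<and> (\<forall>j<length X. pairing L (X ! j) (\<theta> j) (b j)))"
    if "f \<in> S" for f
    using cob_eval_split[of f "[]" X null b] S(1) that assms(2) by (auto simp: Fpow_def asg_0)
  moreover have "sat A null \<theta> \<longleftrightarrow> (\<exists>f\<in>S. ev f null \<theta>)" if "\<theta> \<in> W" for \<theta>
    using S that by (simp add: sat_cls)
  ultimately show ?thesis using assms(2) asg_plugs by auto
qed

text \<open>By \<open>state_expand\<close> below these classes, for \<open>x\<close> in \<^term>\<open>asg (length X)\<close>, span the state space.\<close>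

definition basis :: "sign list \<Rightarrow> (nat \<Rightarrow> 'a list \<times> 'a list) \<Rightarrow> 'a cob set set" where
  "basis X x = cls [] X {half X x}"

lemma basis_closed: "x \<in> W \<Longrightarrow> basis X x \<in> carrier (V X)"
  unfolding basis_def state_space_def by (rule cls_closed) (simp add: Fpow_def half_in_Cob)

lemma sat_basis:
  assumes "x \<in> W" "a \<in> W" "b \<in> W"
  shows "sat (basis X x) a b \<longleftrightarrow> (\<forall>i<length X. pairing L (X ! i) (x i) (b i))"
  unfolding basis_def using assms by (subst sat_cls) (auto simp: Fpow_def half_in_Cob cob_eval_half)

lemma B_semimodule_state_space: "B_semimodule (V X)"
  unfolding state_space_def by (rule B_semimodule_Hom_eval)

lemma comm_monoid_state_space: "comm_monoid (V X)"
  unfolding state_space_def by (rule comm_monoid_Hom_eval)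

text \<open>The pairings of \<theta> with b are the value at b of the half-intervals labelled by
  \<theta>, so \<open>state_split\<close> already is an expansion, with the values at
  \<open>asg\<close> as coefficients.\<close>

lemma state_expand:
  assumes "A \<in> carrier (V X)"
  shows "finprod (V X) (basis X) {\<theta> \<in> asg (length X). sat A null \<theta>} = A"
proof (rule state_eqI[OF _ assms])
  interpret comm_monoid "V X" by (rule comm_monoid_state_space)
  have c: "basis X \<in> {\<theta> \<in> asg (length X). sat A null \<theta>} \<rightarrow> carrier (V X)"
    using asg_plugs by (auto intro!: basis_closed)
  then show "finprod (V X) (basis X) {\<theta> \<in> asg (length X). sat A null \<theta>} \<in> carrier (V X)"
    by (rule finprod_closed)
  fix b :: "nat \<Rightarrow> 'a list \<times> 'a list" assume b: "b \<in> W"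
  show "sat (finprod (V X) (basis X) {\<theta> \<in> asg (length X). sat A null \<theta>}) null b \<longleftrightarrow> sat A null b"
    unfolding state_split[OF assms b]
    using c b finite_asg[of "length X"] asg_plugs unfolding state_space_def
    by (subst sat_finprod) (auto simp: sat_basis)
qed

text \<open>A product of sums is the sum of the products, so disjoint union multiplies functions,
  each on its own block. Independence of representatives is checked in one factor at a time.\<close>

lemma sat_state_union:
  assumes A: "A \<in> carrier (V X)" and B: "B \<in> carrier (V Y)"
  shows state_union_closed: "V_union X Y A B \<in> carrier (V (X @ Y))"
    and "a \<in> W \<Longrightarrow> b \<in> W \<Longrightarrow>
      sat (V_union X Y A B) a b \<longleftrightarrow> sat A a b \<and> sat B a (\<lambda>j. b (length X + j))"
proof -
  obtain S where S: "S \<in> Fpow (Cob \<Sigma> [] X)" "A = cls [] X S"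
    using A unfolding state_space_def by (rule Hom_eval_carrierE)
  obtain T where T: "T \<in> Fpow (Cob \<Sigma> [] Y)" "B = cls [] Y T"
    using B unfolding state_space_def by (rule Hom_eval_carrierE)
  let ?p = "\<lambda>S T. (\<lambda>(f, g). cob_tensor [] X f g) ` (S \<times> T)"
  have p: "?p S T \<in> Fpow (Cob \<Sigma> [] (X @ Y))"
    if "S \<in> Fpow (Cob \<Sigma> [] X)" "T \<in> Fpow (Cob \<Sigma> [] Y)" for S T
    using that cob_tensor_in_Cob[of _ \<Sigma> "[]" X _ "[]" Y] by (auto simp: Fpow_def)
  have H: "(\<exists>f\<in>?p S T. ev f a b) \<longleftrightarrow> (\<exists>f\<in>S. ev f a b) \<and> (\<exists>f\<in>T. ev f a (\<lambda>j. b (length X + j)))" for S T a b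
    by (auto simp: cob_eval_tensor)
  have "V_union X Y A B = (\<Union>S'\<in>cls [] X S. \<Union>T'\<in>cls [] Y T. cls [] (X @ Y) (?p S' T'))"
    unfolding state_union_def S(2) T(2) cls_def ..
  also have "\<dots> = (\<Union>T'\<in>cls [] Y T. cls [] (X @ Y) (?p S T'))"
  proof (rule UN_cls[OF S(1)], intro SUP_cong HOL.refl)
    fix S' T' assume *: "S' \<in> Fpow (Cob \<Sigma> [] X)" "cls [] X S' = cls [] X S" "T' \<in> cls [] Y T"
    then have T': "T' \<in> Fpow (Cob \<Sigma> [] Y)" by (auto simp: cls_def cob_equiv_iff)
    show "cls [] (X @ Y) (?p S' T') = cls [] (X @ Y) (?p S T')"
      by (rule cls_eqI[OF p[OF *(1) T'] p[OF S(1) T']]) (simp only: H sat_cls_eq[OF *(2) S(1) *(1)])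
  qed
  also have "\<dots> = cls [] (X @ Y) (?p S T)"
  proof (rule UN_cls[OF T(1)])
    fix T' assume *: "T' \<in> Fpow (Cob \<Sigma> [] Y)" "cls [] Y T' = cls [] Y T"
    show "cls [] (X @ Y) (?p S T') = cls [] (X @ Y) (?p S T)"
      by (rule cls_eqI[OF p[OF S(1) *(1)] p[OF S(1) T(1)]])
        (simp only: H sat_cls_eq[OF *(2) T(1) *(1)] plugs_comp)
  qed
  finally have u: "V_union X Y A B = cls [] (X @ Y) (?p S T)" .
  show "V_union X Y A B \<in> carrier (V (X @ Y))"
    unfolding u state_space_def by (rule cls_closed[OF p[OF S(1) T(1)]])
  show "sat (V_union X Y A B) a b \<longleftrightarrow> sat A a b \<and> sat B a (\<lambda>j. b (length X + j))"
    if ab: "a \<in> W" "b \<in> W"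
    unfolding u sat_cls[OF p[OF S(1) T(1)] ab] H
    using S T ab sat_cls[OF T(1) ab(1) plugs_comp(2)[OF ab(2), of "(+) (length X)"]] by (simp add: sat_cls)
qed

lemma state_unit_closed: "V_unit c \<in> carrier (V [])"
  unfolding state_unit_def cls_def[symmetric] state_space_def
  by (rule cls_closed) (auto simp: Fpow_def Cob_iff)

lemma sat_state_unit:
  assumes "a \<in> W" "b \<in> W"
  shows "sat (V_unit c) a b \<longleftrightarrow> c"
  unfolding state_unit_def cls_def[symmetric]
  by (subst sat_cls) (use assms in \<open>auto simp: Fpow_def Cob_iff cob_eval_def\<close>)

end

section \<open>The tensor constraint\<close>

lemma all_less_append:
  "(\<forall>i<length (X @ Y). P i ((X @ Y) ! i)) \<longleftrightarrow>
    (\<forall>i<length X. P i (X ! i)) \<and> (\<forall>j<length Y. P (length X + j) (Y ! j))"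
proof -
  have "P i ((X @ Y) ! i)" if "\<forall>i<length X. P i (X ! i)"
    "\<forall>j<length Y. P (length X + j) (Y ! j)" "i < length (X @ Y)" for i
    using that(1) that(2)[rule_format, of "i - length X"] that(3) by (auto simp: nth_append)
  moreover have "P i (X ! i)" if "\<forall>i<length (X @ Y). P i ((X @ Y) ! i)" "i < length X" for i
    using that(1)[rule_format, of i] that(2) by (simp add: nth_append)
  moreover have "P (length X + j) (Y ! j)" if "\<forall>i<length (X @ Y). P i ((X @ Y) ! i)" "j < length Y" for j
    using that(1)[rule_format, of "length X + j"] that(2) by simp
  ultimately show ?thesis by blast
qed

definition concat_asg :: "nat \<Rightarrow> (nat \<Rightarrow> 'b) \<Rightarrow> (nat \<Rightarrow> 'b) \<Rightarrow> nat \<Rightarrow> 'b" where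
  "concat_asg m \<theta> \<theta>' i = (if i < m then \<theta> i else \<theta>' (i - m))"

lemma concat_asg_simps [simp]: "i < m \<Longrightarrow> concat_asg m \<theta> \<theta>' i = \<theta> i" "concat_asg m \<theta> \<theta>' (m + j) = \<theta>' j"
  by (simp_all add: concat_asg_def)

context decomposed_language
begin

lemma concat_asg_closed: "\<theta> \<in> asg m \<Longrightarrow> \<theta>' \<in> asg n \<Longrightarrow> concat_asg m \<theta> \<theta>' \<in> asg (m + n)"
  by (auto simp: asg_def concat_asg_def)

text \<open>The assumption says that P sees the first m values only. Cutting an assignment for m + n
  points down to the first m resets the other values to the default of \<open>asg\<close>, and P
  must survive this.\<close>

lemma concat_asg_image:
  assumes P: "\<And>\<theta> \<theta>'. \<theta> \<in> W \<Longrightarrow> \<theta>' \<in> W \<Longrightarrow> (\<And>i. i < m \<Longrightarrow> \<theta> i = \<theta>' i) \<Longrightarrow> P \<theta> \<Longrightarrow> P \<theta>'"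
  shows "{\<theta> \<in> asg (m + n). P \<theta> \<and> Q (\<lambda>j. \<theta> (m + j))} =
    (\<lambda>(\<theta>, \<theta>'). concat_asg m \<theta> \<theta>') ` ({\<theta> \<in> asg m. P \<theta>} \<times> {\<theta>' \<in> asg n. Q \<theta>'})"
proof (intro equalityI subsetI)
  fix \<theta> assume "\<theta> \<in> {\<theta> \<in> asg (m + n). P \<theta> \<and> Q (\<lambda>j. \<theta> (m + j))}"
  then have \<theta>: "\<theta> \<in> asg (m + n)" "P \<theta>" "Q (\<lambda>j. \<theta> (m + j))" by auto
  define u where "u i = (if i < m then \<theta> i else ([], []))" for i
  have u: "u \<in> asg m" using \<theta>(1) by (auto simp: asg_def u_def)
  have "P u" using P[OF asg_plugs[OF \<theta>(1)] asg_plugs[OF u] _ \<theta>(2)] by (simp add: u_def)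
  moreover have "(\<lambda>j. \<theta> (m + j)) \<in> asg n" using \<theta>(1) by (auto simp: asg_def)
  moreover have "\<theta> = concat_asg m u (\<lambda>j. \<theta> (m + j))" by (auto simp: concat_asg_def u_def)
  ultimately show "\<theta> \<in> (\<lambda>(\<theta>, \<theta>'). concat_asg m \<theta> \<theta>') ` ({\<theta> \<in> asg m. P \<theta>} \<times> {\<theta>' \<in> asg n. Q \<theta>'})"
    using u \<theta>(3) by force
next
  fix \<theta> assume "\<theta> \<in> (\<lambda>(\<theta>, \<theta>'). concat_asg m \<theta> \<theta>') ` ({\<theta> \<in> asg m. P \<theta>} \<times> {\<theta>' \<in> asg n. Q \<theta>'})"
  then obtain u v where uv: "\<theta> = concat_asg m u v" "u \<in> asg m" "P u" "v \<in> asg n" "Q v" by auto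
  have j: "\<theta> \<in> asg (m + n)" using uv concat_asg_closed by simp
  moreover have "P \<theta>" using P[OF asg_plugs[OF uv(2)] asg_plugs[OF j] _ uv(3)] uv(1) by simp
  ultimately show "\<theta> \<in> {\<theta> \<in> asg (m + n). P \<theta> \<and> Q (\<lambda>j. \<theta> (m + j))}" using uv by simp
qed

text \<open>A sum over indices of a concatenated sequence factors if the summand is a product of one
  factor per block; this is the multiplicativity behind Kronecker products.\<close>

lemma ex_asg_append:
  assumes "\<And>\<theta> \<theta>'. \<theta> \<in> W \<Longrightarrow> \<theta>' \<in> W \<Longrightarrow> (\<And>i. i < m \<Longrightarrow> \<theta> i = \<theta>' i) \<Longrightarrow> P \<theta> \<Longrightarrow> P \<theta>'"
  shows "(\<exists>\<theta>\<in>asg (m + n). P \<theta> \<and> Q (\<lambda>j. \<theta> (m + j))) \<longleftrightarrow> (\<exists>\<theta>\<in>asg m. P \<theta>) \<and> (\<exists>\<theta>\<in>asg n. Q \<theta>)"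
proof -
  have img: "{\<theta> \<in> asg (m + n). P \<theta> \<and> Q (\<lambda>j. \<theta> (m + j))} =
      (\<lambda>(\<theta>, \<theta>'). concat_asg m \<theta> \<theta>') ` ({\<theta> \<in> asg m. P \<theta>} \<times> {\<theta>' \<in> asg n. Q \<theta>'})"
    by (rule concat_asg_image) (rule assms)
  have "(\<exists>\<theta>\<in>asg (m + n). P \<theta> \<and> Q (\<lambda>j. \<theta> (m + j))) \<longleftrightarrow>
      {\<theta> \<in> asg (m + n). P \<theta> \<and> Q (\<lambda>j. \<theta> (m + j))} \<noteq> {}" by blast
  also have "\<dots> \<longleftrightarrow> {\<theta> \<in> asg m. P \<theta>} \<times> {\<theta>' \<in> asg n. Q \<theta>'} \<noteq> {}"
    unfolding img image_is_empty ..
  also have "\<dots> \<longleftrightarrow> (\<exists>\<theta>\<in>asg m. P \<theta>) \<and> (\<exists>\<theta>\<in>asg n. Q \<theta>)" by auto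
  finally show ?thesis .
qed

text \<open>The value of the fixed state B on its block is a Boolean scalar, expressed by a set R
  that is a singleton or empty.\<close>

lemma state_union_bhom_left:
  assumes B: "B \<in> carrier (V Y)"
  shows "(\<lambda>A. V_union X Y A B) \<in> bhom (V X) (V (X @ Y))"
  unfolding state_space_def
  by (rule Hom_eval_bhomI[where R = "\<lambda>a b. {(a, b) |_::unit. sat B a (\<lambda>j. b (length X + j))}"])
    (use state_union_closed[OF _ B] sat_state_union(2)[OF _ B] in \<open>auto simp: state_space_def\<close>)

lemma state_union_bhom_right:
  assumes A: "A \<in> carrier (V X)"
  shows "V_union X Y A \<in> bhom (V Y) (V (X @ Y))"
  unfolding state_space_def
  by (rule Hom_eval_bhomI[where R = "\<lambda>a b. {(a, \<lambda>j. b (length X + j)) |_::unit. sat A a b}"])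
    (use state_union_closed[OF A] sat_state_union(2)[OF A] plugs_comp(2)[where r = "(+) (length X)"]
      in \<open>auto simp: state_space_def\<close>)

lemma state_tensor_bhom:
  "V_tensor X Y \<in> bhom (tensor (V X) (V Y)) (V (X @ Y))"
  unfolding state_tensor_def
  by (rule tensor_universal(1)[OF B_semimodule_state_space state_union_bhom_left state_union_bhom_right])

lemma state_tensor_pure:
  assumes "A \<in> carrier (V X)" "B \<in> carrier (V Y)"
  shows "V_tensor X Y (pure (V X) (V Y) A B) = V_union X Y A B"
  unfolding state_tensor_def
  by (rule tensor_universal(2)[OF B_semimodule_state_space state_union_bhom_left state_union_bhom_right assms])

lemma basis_cong: "(\<And>i. i < length X \<Longrightarrow> x i = y i) \<Longrightarrow> basis X x = basis X y"
  unfolding basis_def half_def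
  by (rule arg_cong[where f = "\<lambda>M. cls [] X {M}"], rule arg_cong[where f = mset], rule map_cong[OF HOL.refl])
    (auto split: sign.splits)

lemma state_union_basis:
  assumes "x \<in> W"
  shows "V_union X Y (basis X x) (basis Y (\<lambda>j. x (length X + j))) = basis (X @ Y) x"
proof (rule state_eqI)
  have s: "(\<lambda>j. x (length X + j)) \<in> W" using assms by (rule plugs_comp)
  show "V_union X Y (basis X x) (basis Y (\<lambda>j. x (length X + j))) \<in> carrier (V (X @ Y))"
    by (rule state_union_closed[OF basis_closed[OF assms] basis_closed[OF s]])
  fix b :: "nat \<Rightarrow> 'a list \<times> 'a list" assume b: "b \<in> W"
  show "sat (V_union X Y (basis X x) (basis Y (\<lambda>j. x (length X + j)))) null b \<longleftrightarrow> sat (basis (X @ Y) x) null b"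
    unfolding sat_state_union(2)[OF basis_closed[OF assms] basis_closed[OF s] plugs_Nil b]
      sat_basis[OF assms plugs_Nil b] sat_basis[OF s plugs_Nil plugs_comp(2)[OF b]]
      all_less_append[where P = "\<lambda>i s. pairing L s (x i) (b i)"] ..
qed (rule basis_closed[OF assms])

text \<open>Both factors are expanded, bilinearity gives a double sum, and this is reindexed by
  assignments for the concatenated sequence. It becomes the hypothesis \<open>gen\<close> of
  \<open>bext_biso\<close> in \<open>state_tensor_biso\<close>.\<close>

lemma pure_state_expand:
  fixes X Y
  defines "M \<equiv> V X" and "N \<equiv> V Y"
  assumes A: "A \<in> carrier M" and B: "B \<in> carrier N"
  shows "pure M N A B = finprod (tensor M N) (\<lambda>\<theta>. pure M N (basis X \<theta>) (basis Y (\<lambda>j. \<theta> (length X + j))))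
    {\<theta> \<in> asg (length X + length Y). sat A null \<theta> \<and> sat B null (\<lambda>j. \<theta> (length X + j))}"
proof -
  let ?S = "{\<theta> \<in> asg (length X). sat A null \<theta>}" and ?T = "{\<theta> \<in> asg (length Y). sat B null \<theta>}"
  have cm: "comm_monoid M" "comm_monoid N" "comm_monoid (tensor M N)"
    using comm_monoid_state_space B_semimodule_tensor by (auto simp: M_def N_def B_semimodule_def)
  interpret T: comm_monoid "tensor M N" by (rule cm)
  have fin: "finite ?S" "finite ?T" using finite_asg by auto
  have bS: "basis X \<in> ?S \<rightarrow> carrier M" and bT: "basis Y \<in> ?T \<rightarrow> carrier N"
    using asg_plugs by (auto simp: M_def N_def intro!: basis_closed)
  have "pure M N A B = pure M N (finprod M (basis X) ?S) (finprod N (basis Y) ?T)"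
    using state_expand A B by (simp add: M_def N_def)
  also have "\<dots> = finprod (tensor M N) (\<lambda>\<theta>. pure M N (basis X \<theta>) (finprod N (basis Y) ?T)) ?S"
  proof (rule bhom_finprod[OF pure_bhom_left cm(1,3) fin(1) bS])
    interpret N: comm_monoid N by (rule cm)
    show "finprod N (basis Y) ?T \<in> carrier N" by (rule N.finprod_closed[OF bT])
  qed (rule cm)
  also have "\<dots> = finprod (tensor M N) (\<lambda>\<theta>. finprod (tensor M N) (\<lambda>\<theta>'. pure M N (basis X \<theta>) (basis Y \<theta>')) ?T) ?S"
  proof (rule T.finprod_cong')
    fix \<theta> assume \<theta>: "\<theta> \<in> ?S"
    show "pure M N (basis X \<theta>) (finprod N (basis Y) ?T) =
        finprod (tensor M N) (\<lambda>\<theta>'. pure M N (basis X \<theta>) (basis Y \<theta>')) ?T"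
      using bS \<theta> by (intro bhom_finprod[OF pure_bhom_right cm(2,3) fin(2) bT] cm) auto
  qed (use bS bT in \<open>auto intro!: T.finprod_closed pure_closed\<close>)
  also have "\<dots> = finprod (tensor M N) (\<lambda>(\<theta>, \<theta>'). pure M N (basis X \<theta>) (basis Y \<theta>')) (?S \<times> ?T)"
    using fin bS bT by (intro finprod_Times_idem B_semimodule_tensor pure_closed) auto
  also have "\<dots> = finprod (tensor M N)
      (\<lambda>z. pure M N (basis X (case_prod (concat_asg (length X)) z)) (basis Y (\<lambda>j. case_prod (concat_asg (length X)) z (length X + j)))) (?S \<times> ?T)"
  proof (rule T.finprod_cong')
    fix z assume "z \<in> ?S \<times> ?T"
    \<comment> \<open>A basis element over X reads only the first \<open>length X\<close>
      values.\<close>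
    have "basis X (concat_asg (length X) \<theta> \<theta>') = basis X \<theta>" for \<theta> \<theta>'
      by (rule basis_cong) simp
    then show "(case z of (\<theta>, \<theta>') \<Rightarrow> pure M N (basis X \<theta>) (basis Y \<theta>')) =
      pure M N (basis X (case_prod (concat_asg (length X)) z)) (basis Y (\<lambda>j. case_prod (concat_asg (length X)) z (length X + j)))"
      by (simp add: case_prod_unfold)
  next
    show "(\<lambda>z. pure M N (basis X (case_prod (concat_asg (length X)) z)) (basis Y (\<lambda>j. case_prod (concat_asg (length X)) z (length X + j))))
      \<in> ?S \<times> ?T \<rightarrow> carrier (tensor M N)"
      using asg_plugs by (auto simp: M_def N_def intro!: pure_closed basis_closed concat_asg_closed[THEN asg_plugs])
  qed simp
  also have "\<dots> = finprod (tensor M N) (\<lambda>\<theta>. pure M N (basis X \<theta>) (basis Y (\<lambda>j. \<theta> (length X + j))))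
      (case_prod (concat_asg (length X)) ` (?S \<times> ?T))"
    using fin
    by (intro finprod_image_idem[OF B_semimodule_tensor, symmetric])
      (auto simp: M_def N_def asg_plugs concat_asg_closed[THEN asg_plugs]
        intro!: pure_closed basis_closed plugs_comp(2)[where r = "(+) (length X)"])
  also have "case_prod (concat_asg (length X)) ` (?S \<times> ?T) =
      {\<theta> \<in> asg (length X + length Y). sat A null \<theta> \<and> sat B null (\<lambda>j. \<theta> (length X + j))}"
    using state_sat_cong[OF A[unfolded M_def] plugs_Nil _ plugs_Nil]
    by (intro concat_asg_image[symmetric]) blast
  finally show ?thesis .
qed

lemma state_tensor_biso:
  "V_tensor X Y \<in> biso (tensor (V X) (V Y)) (V (X @ Y))"
proof -
  let ?M = "V X" and ?N = "V Y" and ?K = "V (X @ Y)"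
  let ?x = "\<lambda>\<theta>. (basis X \<theta>, basis Y (\<lambda>j. \<theta> (length X + j)))"
  let ?c = "\<lambda>k. {\<theta> \<in> asg (length (X @ Y)). sat k null \<theta>}"
  interpret K: comm_monoid ?K by (rule comm_monoid_state_space)
  have "bext ?K (\<lambda>(x, y). V_union X Y x y) \<in>
    biso (bpres (carrier ?M \<times> carrier ?N) (tensor_rel ?M ?N)) ?K"
  proof (rule bext_biso[where x = ?x and c = ?c and I = "asg (length (X @ Y))", OF B_semimodule_state_space])
    show "(\<lambda>(x, y). V_union X Y x y) \<in> carrier ?M \<times> carrier ?N \<rightarrow> carrier ?K"
      by (auto intro: state_union_closed)
    show "finprod ?K (\<lambda>(x, y). V_union X Y x y) S = finprod ?K (\<lambda>(x, y). V_union X Y x y) T"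
      if "(S, T) \<in> tensor_rel ?M ?N" "S \<in> Fpow (carrier ?M \<times> carrier ?N)" "T \<in> Fpow (carrier ?M \<times> carrier ?N)" for S T
      by (rule tensor_rel_respected[OF B_semimodule_state_space state_union_bhom_left state_union_bhom_right that])
    show "?x \<in> asg (length (X @ Y)) \<rightarrow> carrier ?M \<times> carrier ?N"
      using asg_plugs by (auto intro!: basis_closed plugs_comp(2)[where r = "(+) (length X)"])
    show "?c \<one>\<^bsub>?K\<^esub> = {}" using asg_plugs by (auto simp: state_space_def sat_one)
    show "?c (k \<otimes>\<^bsub>?K\<^esub> l) = ?c k \<union> ?c l" if "k \<in> carrier ?K" "l \<in> carrier ?K" for k l
      using that asg_plugs by (auto simp: state_space_def sat_mult)
    show "finprod ?K (\<lambda>\<theta>. case ?x \<theta> of (x, y) \<Rightarrow> V_union X Y x y) (?c k) = k" if k: "k \<in> carrier ?K" for k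
    proof -
      have "finprod ?K (\<lambda>\<theta>. case ?x \<theta> of (x, y) \<Rightarrow> V_union X Y x y) (?c k) = finprod ?K (basis (X @ Y)) (?c k)"
        by (rule K.finprod_cong') (use asg_plugs state_union_basis basis_closed in auto)
      then show ?thesis using state_expand[OF k] by simp
    qed
    fix z assume "z \<in> carrier ?M \<times> carrier ?N"
    then obtain A B where z: "z = (A, B)" and AB: "A \<in> carrier ?M" "B \<in> carrier ?N" by blast
    \<comment> \<open>Coefficients of a disjoint union are products of coefficients, which matches
      the index set of \<open>pure_state_expand\<close>.\<close>
    have "?c (V_union X Y A B) =
        {\<theta> \<in> asg (length X + length Y). sat A null \<theta> \<and> sat B null (\<lambda>j. \<theta> (length X + j))}"
      using sat_state_union(2)[OF AB] asg_plugs by auto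
    then show "bgen (carrier ?M \<times> carrier ?N) (tensor_rel ?M ?N) z =
        finprod (bpres (carrier ?M \<times> carrier ?N) (tensor_rel ?M ?N))
          (\<lambda>\<theta>. bgen (carrier ?M \<times> carrier ?N) (tensor_rel ?M ?N) (?x \<theta>))
          (?c (case z of (x, y) \<Rightarrow> V_union X Y x y))"
      using pure_state_expand[OF AB] unfolding z pure_def tensor_def by simp
  qed (use finite_asg in auto)
  then show ?thesis unfolding state_tensor_def tensor_lift_def tensor_def .
qed

end

section \<open>The symmetric monoidal functor\<close>

text \<open>\<open>tensor_assoc\<close> is a lift inside a lift. The outer lift needs the inner one
  to be linear in z at every t, not only at pure t; this follows by comparing homomorphisms in t
  that agree on pure tensors.\<close>

lemma tensor_assoc_universal:
  assumes M: "B_semimodule M" and N: "B_semimodule N" and K: "B_semimodule K"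
  shows "tensor_assoc M N K \<in> bhom (tensor (tensor M N) K) (tensor M (tensor N K))"
    and "x \<in> carrier M \<Longrightarrow> y \<in> carrier N \<Longrightarrow> z \<in> carrier K \<Longrightarrow>
      tensor_assoc M N K (pure (tensor M N) K (pure M N x y) z) = pure M (tensor N K) x (pure N K y z)"
proof -
  let ?T = "tensor M (tensor N K)"
  define F where "F z = tensor_lift ?T (\<lambda>x y. pure M (tensor N K) x (pure N K y z))" for z
  interpret T: comm_monoid ?T using B_semimodule_tensor by (rule B_semimoduleD)
  interpret KK: comm_monoid K using K by (rule B_semimoduleD)
  note cm = B_semimoduleD(1)[OF M] B_semimoduleD(1)[OF N] B_semimoduleD(1)[OF K]
    B_semimoduleD(1)[OF B_semimodule_tensor]
  have l: "(\<lambda>x. pure M (tensor N K) x (pure N K y z)) \<in> bhom M ?T" if "y \<in> carrier N" "z \<in> carrier K" for y z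
    by (rule pure_bhom_left[OF cm(1) pure_closed[OF that]])
  have r: "(\<lambda>y. pure M (tensor N K) x (pure N K y z)) \<in> bhom N ?T" if "x \<in> carrier M" "z \<in> carrier K" for x z
    by (rule bhom_comp[OF pure_bhom_left[OF cm(2) that(2)] pure_bhom_right[OF cm(4) that(1)]])
  have s: "(\<lambda>z. pure M (tensor N K) x (pure N K y z)) \<in> bhom K ?T" if "x \<in> carrier M" "y \<in> carrier N" for x y
    by (rule bhom_comp[OF pure_bhom_right[OF cm(3) that(2)] pure_bhom_right[OF cm(4) that(1)]])
  have F: "F z \<in> bhom (tensor M N) ?T" if "z \<in> carrier K" for z
    unfolding F_def by (rule tensor_universal(1)[OF B_semimodule_tensor l[OF _ that] r[OF _ that]])
  have Fp: "F z (pure M N x y) = pure M (tensor N K) x (pure N K y z)"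
    if "x \<in> carrier M" "y \<in> carrier N" "z \<in> carrier K" for x y z
    unfolding F_def by (rule tensor_universal(2)[OF B_semimodule_tensor l[OF _ that(3)] r[OF _ that(3)] that(1,2)])
  have Fz: "(\<lambda>z. F z t) \<in> bhom K ?T" if t: "t \<in> carrier (tensor M N)" for t
  proof (rule bhomI)
    fix z z' assume z: "z \<in> carrier K" "z' \<in> carrier K"
    show "F z t \<in> carrier ?T" by (rule bhom_closed[OF F[OF z(1)] t])
    \<comment> \<open>A pointwise sum of homomorphisms is a homomorphism because the target is
      commutative.\<close>
    have p: "(\<lambda>t. F z t \<otimes>\<^bsub>?T\<^esub> F z' t) \<in> bhom (tensor M N) ?T"
      by (rule bhomI) (simp_all add: bhom_closed[OF F] bhom_mult[OF F] bhom_one[OF F] z T.m_ac)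
    show "F (z \<otimes>\<^bsub>K\<^esub> z') t = F z t \<otimes>\<^bsub>?T\<^esub> F z' t"
      by (rule tensor_hom_eqI[OF F p cm(4) _ t])
        (use z in \<open>simp_all add: Fp bhom_mult[OF s]\<close>)
  next
    have p: "(\<lambda>t. \<one>\<^bsub>?T\<^esub>) \<in> bhom (tensor M N) ?T"
      by (rule bhomI) simp_all
    show "F \<one>\<^bsub>K\<^esub> t = \<one>\<^bsub>?T\<^esub>"
      by (rule tensor_hom_eqI[OF F p cm(4) _ t]) (simp_all add: Fp bhom_one[OF s])
  qed
  have eq: "tensor_assoc M N K = tensor_lift ?T (\<lambda>t z. F z t)"
    unfolding tensor_assoc_def F_def ..
  show "tensor_assoc M N K \<in> bhom (tensor (tensor M N) K) ?T"
    unfolding eq by (rule tensor_universal(1)[OF B_semimodule_tensor F Fz])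
  show "tensor_assoc M N K (pure (tensor M N) K (pure M N x y) z) = pure M (tensor N K) x (pure N K y z)"
    if "x \<in> carrier M" "y \<in> carrier N" "z \<in> carrier K"
    unfolding eq
    by (subst tensor_universal(2)[OF B_semimodule_tensor F Fz]) (use that in \<open>simp_all add: Fp pure_closed\<close>)
qed

lemma
  assumes M: "B_semimodule M" and N: "B_semimodule N"
  shows tensor_swap_bhom: "tensor_swap M N \<in> bhom (tensor M N) (tensor N M)"
    and tensor_swap_pure: "x \<in> carrier M \<Longrightarrow> y \<in> carrier N \<Longrightarrow> tensor_swap M N (pure M N x y) = pure N M y x"
proof -
  note l = pure_bhom_right[OF B_semimoduleD(1)[OF M]] and r = pure_bhom_left[OF B_semimoduleD(1)[OF N]]
  show "tensor_swap M N \<in> bhom (tensor M N) (tensor N M)"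
    unfolding tensor_swap_def by (rule tensor_universal(1)[OF B_semimodule_tensor]) (auto intro: l r)
  show "tensor_swap M N (pure M N x y) = pure N M y x" if "x \<in> carrier M" "y \<in> carrier N"
    unfolding tensor_swap_def by (rule tensor_universal(2)[OF B_semimodule_tensor]) (auto intro: l r that)
qed

text \<open>Scalar multiplication by Boolean values. Additivity in the scalar is the idempotence of
  M: 1 + 1 = 1 acts as x + x = x.\<close>

lemma scale_bhom:
  assumes M: "B_semimodule M"
  shows "x \<in> carrier M \<Longrightarrow> (\<lambda>c. if c then x else \<one>\<^bsub>M\<^esub>) \<in> bhom Bool M"
    and "(\<lambda>x. if c then x else \<one>\<^bsub>M\<^esub>) \<in> bhom M M"
proof -
  interpret comm_monoid M using M by (rule B_semimoduleD)
  show "(\<lambda>c. if c then x else \<one>\<^bsub>M\<^esub>) \<in> bhom Bool M" if "x \<in> carrier M"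
    by (rule bhomI) (use that B_semimoduleD(2)[OF M] in \<open>auto simp: Bool_def\<close>)
  show "(\<lambda>x. if c then x else \<one>\<^bsub>M\<^esub>) \<in> bhom M M"
    by (rule bhomI) auto
qed

lemma
  assumes M: "B_semimodule M"
  shows tensor_lunit_bhom: "tensor_lunit M \<in> bhom (tensor Bool M) M"
    and tensor_lunit_pure: "x \<in> carrier M \<Longrightarrow> tensor_lunit M (pure Bool M c x) = (if c then x else \<one>\<^bsub>M\<^esub>)"
  unfolding tensor_lunit_def
   apply (rule tensor_universal(1)[OF M scale_bhom[OF M]], assumption)
  apply (rule tensor_universal(2)[OF M scale_bhom[OF M]], assumption)
   apply (simp_all add: Bool_def)
  done

lemma
  assumes M: "B_semimodule M"
  shows tensor_runit_bhom: "tensor_runit M \<in> bhom (tensor M Bool) M"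
    and tensor_runit_pure: "x \<in> carrier M \<Longrightarrow> tensor_runit M (pure M Bool x c) = (if c then x else \<one>\<^bsub>M\<^esub>)"
  unfolding tensor_runit_def
   apply (rule tensor_universal(1)[OF M scale_bhom(2)[OF M] scale_bhom(1)[OF M]], assumption)
  apply (rule tensor_universal(2)[OF M scale_bhom(2)[OF M] scale_bhom(1)[OF M]], assumption)
   apply (simp_all add: Bool_def)
  done

context decomposed_language
begin

section \<open>Action of cobordisms on states\<close>

lemma state_map_closed:
  "g \<in> Cob \<Sigma> X X' \<Longrightarrow> A \<in> carrier (V X) \<Longrightarrow>
    V_map X X' g A \<in> carrier (V X')"
  by (rule bhom_closed[OF state_map_bhom])

lemma strands_id_in_Cob: "strands X (\<lambda>i. i) \<in> Cob \<Sigma> X X"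
  by (rule strands_in_Cob) (auto simp: bij_betw_def)

text \<open>The matrix of the strands is \<open>pairing\<close>, and \<open>state_split\<close> says
  that it fixes functions of states.\<close>

lemma state_map_id:
  assumes A: "A \<in> carrier (V X)"
  shows "V_map X X (strands X (\<lambda>i. i)) A = A"
proof (rule state_eqI[OF state_map_closed[OF strands_id_in_Cob A] A])
  fix b :: "nat \<Rightarrow> 'a list \<times> 'a list" assume b: "b \<in> W"
  show "sat (V_map X X (strands X (\<lambda>i. i)) A) null b \<longleftrightarrow> sat A null b"
    unfolding sat_state_map[OF strands_id_in_Cob A plugs_Nil b] state_split[OF A b] cob_eval_strands fst_\<alpha> ..
qed

text \<open>Both sides are the same double sum over indices at X and X': associativity of the matrix
  product replaces associativity of gluing.\<close>

lemma state_map_comp: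
  assumes f: "f \<in> Cob \<Sigma> X X'" and g: "g \<in> Cob \<Sigma> X' X''" and A: "A \<in> carrier (V X)"
  shows "V_map X X'' (cob_comp X' g f) A = V_map X' X'' g (V_map X X' f A)"
proof (rule state_eqI)
  note gf = cob_comp_in_Cob[OF f g]
  note fA = state_map_closed[OF f A]
  show "V_map X X'' (cob_comp X' g f) A \<in> carrier (V X'')"
    "V_map X' X'' g (V_map X X' f A) \<in> carrier (V X'')"
    by (rule state_map_closed[OF gf A], rule state_map_closed[OF g fA])
  fix b :: "nat \<Rightarrow> 'a list \<times> 'a list" assume b: "b \<in> W"
  have 1: "sat (V_map X X'' (cob_comp X' g f) A) null b \<longleftrightarrow>
      (\<exists>\<theta>\<in>asg (length X). sat A null \<theta> \<and> (\<exists>\<theta>'\<in>asg (length X'). ev f \<theta> \<theta>' \<and> ev g \<theta>' b))"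
    unfolding sat_state_map[OF gf A plugs_Nil b]
    by (intro bex_cong conj_cong HOL.refl cob_eval_comp[OF f g _ b] asg_plugs)
  have 2: "sat (V_map X' X'' g (V_map X X' f A)) null b \<longleftrightarrow>
      (\<exists>\<theta>'\<in>asg (length X'). (\<exists>\<theta>\<in>asg (length X). sat A null \<theta> \<and> ev f \<theta> \<theta>') \<and> ev g \<theta>' b)"
    unfolding sat_state_map[OF g fA plugs_Nil b]
    by (intro bex_cong conj_cong HOL.refl sat_state_map[OF f A plugs_Nil] asg_plugs)
  show "sat (V_map X X'' (cob_comp X' g f) A) null b \<longleftrightarrow>
      sat (V_map X' X'' g (V_map X X' f A)) null b"
    unfolding 1 2 by blast
qed

lemma state_unit_biso: "V_unit \<in> biso Bool (V [])"
proof -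
  have h: "V_unit \<in> bhom Bool (V [])"
  proof (rule bhomI)
    fix c d
    have "sat (V_unit c \<otimes>\<^bsub>V []\<^esub> V_unit d) null b \<longleftrightarrow> c \<or> d"
      if "b \<in> W" for b
      using that state_unit_closed unfolding state_space_def
      by (simp add: sat_mult[OF _ _ plugs_Nil] sat_state_unit)
    moreover have "V_unit c \<otimes>\<^bsub>V []\<^esub> V_unit d \<in> carrier (V [])"
      using comm_monoid_state_space[of "[]"] state_unit_closed
      by (intro monoid.m_closed) (auto simp: comm_monoid_def)
    ultimately show "V_unit (c \<otimes>\<^bsub>Bool\<^esub> d) = V_unit c \<otimes>\<^bsub>V []\<^esub> V_unit d"
      by (intro state_eqI[OF state_unit_closed]) (simp_all add: sat_state_unit Bool_def)
  next
    show "V_unit \<one>\<^bsub>Bool\<^esub> = \<one>\<^bsub>V []\<^esub>"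
      by (simp add: state_unit_def state_space_def Hom_eval_one Bool_def cls_def)
  qed (rule state_unit_closed)
  have "inj V_unit"
  proof (rule injI)
    fix c d assume "V_unit c = V_unit d"
    from arg_cong[OF this, of "\<lambda>A. sat A null null"] show "c = d"
      by (simp only: sat_state_unit plugs_Nil)
  qed
  moreover have "A \<in> range V_unit" if A: "A \<in> carrier (V [])" for A
  proof -
    \<comment> \<open>Without outer points a state is determined by its single value.\<close>
    have "A = V_unit (sat A null null)"
    proof (rule state_eqI[OF A state_unit_closed])
      fix b :: "nat \<Rightarrow> 'a list \<times> 'a list" assume b: "b \<in> W"
      show "sat A null b \<longleftrightarrow> sat (V_unit (sat A null null)) null b"
        unfolding sat_state_unit[OF plugs_Nil b]
        by (rule state_sat_cong[OF A plugs_Nil b plugs_Nil plugs_Nil]) simp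
    qed
    then show ?thesis by blast
  qed
  ultimately have "bij_betw V_unit UNIV (carrier (V []))"
    using state_unit_closed by (auto simp: bij_betw_def)
  then show ?thesis using h by (simp add: biso_def Bool_def)
qed

text \<open>The matrix of a tensor product and the function of a disjoint union both split along the
  blocks, so the sum over the interface factors by \<open>ex_asg_append\<close>.\<close>

lemma state_map_cob_tensor:
  assumes f: "f \<in> Cob \<Sigma> X X'" and g: "g \<in> Cob \<Sigma> Y Y'"
    and A: "A \<in> carrier (V X)" and B: "B \<in> carrier (V Y)"
  shows "V_map (X @ Y) (X' @ Y') (cob_tensor X X' f g) (V_union X Y A B) =
    V_union X' Y' (V_map X X' f A) (V_map Y Y' g B)"
proof (rule state_eqI)
  note fg = cob_tensor_in_Cob[OF f g] and u = state_union_closed[OF A B]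
  note fA = state_map_closed[OF f A] and gB = state_map_closed[OF g B]
  show "V_map (X @ Y) (X' @ Y') (cob_tensor X X' f g) (V_union X Y A B)
      \<in> carrier (V (X' @ Y'))"
    by (rule state_map_closed[OF fg u])
  show "V_union X' Y' (V_map X X' f A) (V_map Y Y' g B)
      \<in> carrier (V (X' @ Y'))"
    by (rule state_union_closed[OF fA gB])
  fix b :: "nat \<Rightarrow> 'a list \<times> 'a list" assume b: "b \<in> W"
  let ?b = "\<lambda>j. b (length X' + j)"
  have b': "?b \<in> W" using b by (rule plugs_comp)
  have "sat (V_map (X @ Y) (X' @ Y') (cob_tensor X X' f g) (V_union X Y A B)) null b \<longleftrightarrow>
    (\<exists>\<theta>\<in>asg (length X + length Y). (sat A null \<theta> \<and> ev f \<theta> b) \<and>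
      (sat B null (\<lambda>j. \<theta> (length X + j)) \<and> ev g (\<lambda>j. \<theta> (length X + j)) ?b))"
    unfolding sat_state_map[OF fg u plugs_Nil b] length_append cob_eval_tensor
    by (intro bex_cong HOL.refl) (auto simp: sat_state_union(2)[OF A B plugs_Nil asg_plugs])
  also have "\<dots> \<longleftrightarrow> (\<exists>\<theta>\<in>asg (length X). sat A null \<theta> \<and> ev f \<theta> b) \<and>
      (\<exists>\<theta>\<in>asg (length Y). sat B null \<theta> \<and> ev g \<theta> ?b)"
  proof (rule ex_asg_append)
    fix \<theta> \<theta>' :: "nat \<Rightarrow> 'a list \<times> 'a list"
    assume *: "\<theta> \<in> W" "\<theta>' \<in> W" "\<And>i. i < length X \<Longrightarrow> \<theta> i = \<theta>' i" "sat A null \<theta> \<and> ev f \<theta> b"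
    then show "sat A null \<theta>' \<and> ev f \<theta>' b"
      using state_sat_cong[OF A plugs_Nil, of \<theta> null \<theta>'] cob_eval_cong[OF f, of \<theta> \<theta>' b b \<alpha>] by simp
  qed
  also have "\<dots> \<longleftrightarrow> sat (V_union X' Y' (V_map X X' f A) (V_map Y Y' g B)) null b"
    unfolding sat_state_union(2)[OF fA gB plugs_Nil b] sat_state_map[OF f A plugs_Nil b]
      sat_state_map[OF g B plugs_Nil b'] ..
  finally show "sat (V_map (X @ Y) (X' @ Y') (cob_tensor X X' f g) (V_union X Y A B)) null b \<longleftrightarrow>
    sat (V_union X' Y' (V_map X X' f A) (V_map Y Y' g B)) null b" .
qed

lemma state_union_assoc:
  assumes A: "A \<in> carrier (V X)" and B: "B \<in> carrier (V Y)"
    and C: "C \<in> carrier (V \<gamma>)"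
  shows "V_union (X @ Y) \<gamma> (V_union X Y A B) C =
    V_union X (Y @ \<gamma>) A (V_union Y \<gamma> B C)"
proof (rule state_eqI)
  note AB = state_union_closed[OF A B] and BC = state_union_closed[OF B C]
  show "V_union (X @ Y) \<gamma> (V_union X Y A B) C \<in> carrier (V ((X @ Y) @ \<gamma>))"
    by (rule state_union_closed[OF AB C])
  show "V_union X (Y @ \<gamma>) A (V_union Y \<gamma> B C) \<in> carrier (V ((X @ Y) @ \<gamma>))"
    using state_union_closed[OF A BC] by simp
  fix b :: "nat \<Rightarrow> 'a list \<times> 'a list" assume b: "b \<in> W"
  show "sat (V_union (X @ Y) \<gamma> (V_union X Y A B) C) null b \<longleftrightarrow>
    sat (V_union X (Y @ \<gamma>) A (V_union Y \<gamma> B C)) null b"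
    unfolding sat_state_union(2)[OF AB C plugs_Nil b] sat_state_union(2)[OF A BC plugs_Nil b]
      sat_state_union(2)[OF A B plugs_Nil b] sat_state_union(2)[OF B C plugs_Nil plugs_comp(2)[OF b]]
    by (simp add: add.assoc)
qed

lemma state_union_unit:
  assumes A: "A \<in> carrier (V X)"
  shows "V_union [] X (V_unit c) A = (if c then A else \<one>\<^bsub>V X\<^esub>)"
    and "V_union X [] A (V_unit c) = (if c then A else \<one>\<^bsub>V X\<^esub>)"
proof -
  have r: "(if c then A else \<one>\<^bsub>V X\<^esub>) \<in> carrier (V X)"
    using A by (auto simp: state_space_def Hom_eval_one_closed)
  have s: "sat (if c then A else \<one>\<^bsub>V X\<^esub>) null b \<longleftrightarrow> c \<and> sat A null b" if "b \<in> W" for b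
    using that by (auto simp: state_space_def sat_one)
  show "V_union [] X (V_unit c) A = (if c then A else \<one>\<^bsub>V X\<^esub>)"
    using state_union_closed[OF state_unit_closed A] sat_state_union(2)[OF state_unit_closed A plugs_Nil]
    by (intro state_eqI[OF _ r]) (simp_all add: s sat_state_unit)
  show "V_union X [] A (V_unit c) = (if c then A else \<one>\<^bsub>V X\<^esub>)"
    using state_union_closed[OF A state_unit_closed] sat_state_union(2)[OF A state_unit_closed plugs_Nil]
    by (intro state_eqI[OF _ r]) (auto simp: s sat_state_unit plugs_comp(2))
qed

lemma cob_braid_in_Cob: "cob_braid X Y \<in> Cob \<Sigma> (X @ Y) (Y @ X)"
  unfolding cob_braid_def
proof (rule strands_in_Cob)
  show "bij_betw (\<lambda>i. if i < length X then length Y + i else i - length X) {..<length (X @ Y)} {..<length (Y @ X)}"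
    \<comment> \<open>The inverse is the position map of the opposite braiding.\<close>
    by (rule bij_betw_byWitness[where f' = "\<lambda>i. if i < length Y then length X + i else i - length Y"]) auto
qed (auto simp: nth_append)

text \<open>The matrix of the braiding pairs each block with its image after the exchange. The sum
  factors into one per block, and \<open>state_split\<close> evaluates each factor.\<close>

lemma state_map_braid:
  assumes A: "A \<in> carrier (V X)" and B: "B \<in> carrier (V Y)"
  shows "V_map (X @ Y) (Y @ X) (cob_braid X Y) (V_union X Y A B) = V_union Y X B A"
proof (rule state_eqI)
  note u = state_union_closed[OF A B]
  show "V_map (X @ Y) (Y @ X) (cob_braid X Y) (V_union X Y A B) \<in> carrier (V (Y @ X))"
    by (rule state_map_closed[OF cob_braid_in_Cob u])
  show "V_union Y X B A \<in> carrier (V (Y @ X))"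
    by (rule state_union_closed[OF B A])
  fix b :: "nat \<Rightarrow> 'a list \<times> 'a list" assume b: "b \<in> W"
  let ?b = "\<lambda>j. b (length Y + j)"
  have b': "?b \<in> W" using b by (rule plugs_comp)
  have H: "ev (cob_braid X Y) \<theta> b \<longleftrightarrow> (\<forall>i<length X. pairing L (X ! i) (\<theta> i) (?b i)) \<and>
      (\<forall>j<length Y. pairing L (Y ! j) (\<theta> (length X + j)) (b j))" for \<theta>
    unfolding cob_braid_def cob_eval_strands fst_\<alpha>
    using all_less_append[where P = "\<lambda>i s. pairing L s (\<theta> i) (b (if i < length X then length Y + i else i - length X))"]
    by simp
  have "sat (V_map (X @ Y) (Y @ X) (cob_braid X Y) (V_union X Y A B)) null b \<longleftrightarrow>
    (\<exists>\<theta>\<in>asg (length X + length Y). (sat A null \<theta> \<and> (\<forall>i<length X. pairing L (X ! i) (\<theta> i) (?b i))) \<and>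
      (sat B null (\<lambda>j. \<theta> (length X + j)) \<and> (\<forall>j<length Y. pairing L (Y ! j) (\<theta> (length X + j)) (b j))))"
    unfolding sat_state_map[OF cob_braid_in_Cob u plugs_Nil b] length_append H
    by (intro bex_cong HOL.refl) (auto simp: sat_state_union(2)[OF A B plugs_Nil asg_plugs])
  also have "\<dots> \<longleftrightarrow> (\<exists>\<theta>\<in>asg (length X). sat A null \<theta> \<and> (\<forall>i<length X. pairing L (X ! i) (\<theta> i) (?b i))) \<and>
      (\<exists>\<theta>\<in>asg (length Y). sat B null \<theta> \<and> (\<forall>j<length Y. pairing L (Y ! j) (\<theta> j) (b j)))"
  proof (rule ex_asg_append)
    fix \<theta> \<theta>' :: "nat \<Rightarrow> 'a list \<times> 'a list"
    assume *: "\<theta> \<in> W" "\<theta>' \<in> W" "\<And>i. i < length X \<Longrightarrow> \<theta> i = \<theta>' i"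
      "sat A null \<theta> \<and> (\<forall>i<length X. pairing L (X ! i) (\<theta> i) (?b i))"
    then show "sat A null \<theta>' \<and> (\<forall>i<length X. pairing L (X ! i) (\<theta>' i) (?b i))"
      using state_sat_cong[OF A plugs_Nil, of \<theta> null \<theta>'] by simp
  qed
  also have "\<dots> \<longleftrightarrow> sat (V_union Y X B A) null b"
    unfolding sat_state_union(2)[OF B A plugs_Nil b] state_split[OF A b'] state_split[OF B b] by blast
  finally show "sat (V_map (X @ Y) (Y @ X) (cob_braid X Y) (V_union X Y A B)) null b \<longleftrightarrow>
    sat (V_union Y X B A) null b" .
qed

text \<open>The axioms on the tensor constraint equate homomorphisms out of tensor products, so they
  are compared on pure tensors, where \<open>state_tensor\<close> is disjoint union. Strict
  associativity of concatenation gives both sides of the associativity axiom the same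
  target.\<close>

theorem state_space_functor:
  "symmetric_monoidal_functor (Cob_cat \<Sigma>)
    V V_map V_unit V_tensor"
proof -
  let ?F = "V" and ?m = "V_map" and ?\<mu> = "V_tensor"
  note B = B_semimodule_state_space and cm = comm_monoid_state_space
  have nat: "?m (a @ c) (b @ d) (cob_tensor a b f g) (?\<mu> a c t) =
      ?\<mu> b d (tensor_map (?F b) (?F d) (?m a b f) (?m c d g) t)"
    if f: "f \<in> Cob \<Sigma> a b" and g: "g \<in> Cob \<Sigma> c d" and t: "t \<in> carrier (tensor (?F a) (?F c))"
    for a b c d f g t
    by (rule tensor_hom_eqI[OF
        bhom_comp[OF state_tensor_bhom state_map_bhom[OF cob_tensor_in_Cob[OF f g]]]
        bhom_comp[OF tensor_map_bhom[OF B B state_map_bhom[OF f] state_map_bhom[OF g]] state_tensor_bhom] cm _ t])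
      (simp add: state_tensor_pure tensor_map_pure[OF B B state_map_bhom[OF f] state_map_bhom[OF g]]
        state_map_cob_tensor[OF f g] state_map_closed[OF f] state_map_closed[OF g])
  have assoc: "?\<mu> (a @ b) c (tensor_map (?F (a @ b)) (?F c) (?\<mu> a b) (\<lambda>z. z) t) =
      ?\<mu> a (b @ c) (tensor_map (?F a) (?F (b @ c)) (\<lambda>z. z) (?\<mu> b c) (tensor_assoc (?F a) (?F b) (?F c) t))"
    if t: "t \<in> carrier (tensor (tensor (?F a) (?F b)) (?F c))" for a b c t
  proof -
    let ?l = "\<lambda>t. ?\<mu> (a @ b) c (tensor_map (?F (a @ b)) (?F c) (?\<mu> a b) (\<lambda>z. z) t)"
    let ?r = "\<lambda>t. ?\<mu> a (b @ c) (tensor_map (?F a) (?F (b @ c)) (\<lambda>z. z) (?\<mu> b c) (tensor_assoc (?F a) (?F b) (?F c) t))"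
    note tl = tensor_map_universal[OF B[of "a @ b"] B[of c] state_tensor_bhom[of a b] bhom_id]
    note tr = tensor_map_universal[OF B[of a] B[of "b @ c"] bhom_id state_tensor_bhom[of b c]]
    note ta = tensor_assoc_universal[OF B[of a] B[of b] B[of c]]
    have hl: "?l \<in> bhom (tensor (tensor (?F a) (?F b)) (?F c)) (?F ((a @ b) @ c))"
      by (rule bhom_comp[OF tl(1) state_tensor_bhom])
    have hr: "?r \<in> bhom (tensor (tensor (?F a) (?F b)) (?F c)) (?F ((a @ b) @ c))"
      using bhom_comp[OF bhom_comp[OF ta(1) tr(1)] state_tensor_bhom] by simp
    show ?thesis
    proof (rule tensor_hom_eqI[OF hl hr cm _ t])
      fix s z assume s: "s \<in> carrier (tensor (?F a) (?F b))" and z: "z \<in> carrier (?F c)"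
      \<comment> \<open>The inner element s need not be pure. With z fixed both sides are
        homomorphisms in s, which allows a second reduction to pure tensors.\<close>
      have p: "(\<lambda>s. pure (tensor (?F a) (?F b)) (?F c) s z) \<in>
          bhom (tensor (?F a) (?F b)) (tensor (tensor (?F a) (?F b)) (?F c))"
        by (rule pure_bhom_left[OF B_semimoduleD(1)[OF B_semimodule_tensor] z])
      show "?l (pure (tensor (?F a) (?F b)) (?F c) s z) = ?r (pure (tensor (?F a) (?F b)) (?F c) s z)"
      proof (rule tensor_hom_eqI[OF bhom_comp[OF p hl] bhom_comp[OF p hr] cm _ s])
        fix x y assume xy: "x \<in> carrier (?F a)" "y \<in> carrier (?F b)"
        show "?l (pure (tensor (?F a) (?F b)) (?F c) (pure (?F a) (?F b) x y) z) =
            ?r (pure (tensor (?F a) (?F b)) (?F c) (pure (?F a) (?F b) x y) z)"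
          using xy z
          by (simp add: tl(2) tr(2) ta(2) pure_closed state_tensor_pure state_union_closed state_union_assoc)
      qed
    qed
  qed
  have h\<eta>: "V_unit \<in> bhom Bool (?F [])" using state_unit_biso by (simp add: biso_def)
  have cB: "c \<in> carrier Bool" for c by (simp add: Bool_def)
  have lunit: "?\<mu> [] a (tensor_map (?F []) (?F a) V_unit (\<lambda>z. z) t) = tensor_lunit (?F a) t"
    if t: "t \<in> carrier (tensor Bool (?F a))" for a t
  proof -
    note tm = tensor_map_universal[OF B[of "[]"] B[of a] h\<eta> bhom_id]
    have h: "(\<lambda>t. ?\<mu> [] a (tensor_map (?F []) (?F a) V_unit (\<lambda>z. z) t)) \<in> bhom (tensor Bool (?F a)) (?F a)"
      using bhom_comp[OF tm(1) state_tensor_bhom] by simp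
    show ?thesis
      by (rule tensor_hom_eqI[OF h tensor_lunit_bhom[OF B] cm _ t])
        (simp add: tm(2) tensor_lunit_pure[OF B] state_tensor_pure state_unit_closed state_union_unit)
  qed
  have runit: "?\<mu> a [] (tensor_map (?F a) (?F []) (\<lambda>z. z) V_unit t) = tensor_runit (?F a) t"
    if t: "t \<in> carrier (tensor (?F a) Bool)" for a t
  proof -
    note tm = tensor_map_universal[OF B[of a] B[of "[]"] bhom_id h\<eta>]
    have h: "(\<lambda>t. ?\<mu> a [] (tensor_map (?F a) (?F []) (\<lambda>z. z) V_unit t)) \<in> bhom (tensor (?F a) Bool) (?F a)"
      using bhom_comp[OF tm(1) state_tensor_bhom[of a "[]"]] by simp
    show ?thesis
      by (rule tensor_hom_eqI[OF h tensor_runit_bhom[OF B] cm _ t])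
        (simp add: tm(2) tensor_runit_pure[OF B] state_tensor_pure state_unit_closed state_union_unit)
  qed
  have braid: "?m (a @ b) (b @ a) (cob_braid a b) (?\<mu> a b t) = ?\<mu> b a (tensor_swap (?F a) (?F b) t)"
    if t: "t \<in> carrier (tensor (?F a) (?F b))" for a b t
    by (rule tensor_hom_eqI[OF bhom_comp[OF state_tensor_bhom state_map_bhom[OF cob_braid_in_Cob]]
        bhom_comp[OF tensor_swap_bhom[OF B B] state_tensor_bhom] cm _ t])
      (simp add: state_tensor_pure tensor_swap_pure[OF B B] state_map_braid)
  show ?thesis
    unfolding symmetric_monoidal_functor_def Cob_cat_def smcat.simps
    by (intro conjI allI ballI B state_map_bhom state_map_id state_map_comp state_unit_biso
        state_tensor_biso nat assoc lunit runit braid)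
qed

end

section \<open>Multiple tensor products and duality\<close>

lemma ntensor_map_universal:
  assumes len: "length fs = length Ms" "length Ns = length Ms"
    and f: "\<And>i. i < length Ms \<Longrightarrow> fs ! i \<in> bhom (Ms ! i) (Ns ! i)"
    and N: "\<And>i. i < length Ms \<Longrightarrow> B_semimodule (Ns ! i)"
  shows ntensor_map_bhom: "ntensor_map Ns fs \<in> bhom (ntensor Ms) (ntensor Ns)"
    and ntensor_map_npure: "xs \<in> tuples Ms \<Longrightarrow>
      ntensor_map Ns fs (npure Ms xs) = npure Ns (map2 (\<lambda>f x. f x) fs xs)"
proof -
  let ?\<phi> = "\<lambda>xs. npure Ns (map2 (\<lambda>f x. f x) fs xs)"
  have t: "map2 (\<lambda>f x. f x) fs xs \<in> tuples Ns" if "xs \<in> tuples Ms" for xs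
    using that len bhom_closed[OF f] by (auto simp: tuples_def)
  have \<phi>: "?\<phi> \<in> tuples Ms \<rightarrow> carrier (ntensor Ns)"
    using t by (auto intro: npure_closed)
  have lin: "(\<lambda>x. ?\<phi> (xs[i := x])) \<in> bhom (Ms ! i) (ntensor Ns)"
    if xs: "xs \<in> tuples Ms" and i: "i < length Ms" for xs i
  proof -
    \<comment> \<open>Applying the maps entrywise commutes with changing one entry, so linearity in
      that entry carries over.\<close>
    have "map2 (\<lambda>f x. f x) fs (xs[i := x]) = (map2 (\<lambda>f x. f x) fs xs)[i := (fs ! i) x]" for x
      using xs i len by (intro nth_equalityI) (auto simp: tuples_def nth_list_update)
    then show ?thesis
      using bhom_comp[OF f[OF i] npure_bhom[OF B_semimoduleD(1)[OF N[OF i]] t[OF xs]]] i len by simp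
  qed
  note R = ntensor_rel_respected[OF B_semimodule_ntensor \<phi> lin]
  show "ntensor_map Ns fs \<in> bhom (ntensor Ms) (ntensor Ns)"
    unfolding ntensor_map_def ntensor_def[of Ms]
    by (rule bpres_universal(1)[OF B_semimodule_ntensor \<phi> R])
  show "ntensor_map Ns fs (npure Ms xs) = npure Ns (map2 (\<lambda>f x. f x) fs xs)" if "xs \<in> tuples Ms"
    unfolding ntensor_map_def npure_def[of Ms]
    by (rule bpres_universal(2)[OF B_semimodule_ntensor \<phi> R that])
qed

lemma cob_tensors_in_Cob:
  assumes "length X = length fs" "length Y = length fs"
    "\<forall>i<length fs. fs ! i \<in> Cob \<Sigma> [X ! i] [Y ! i]"
  shows "cob_tensors X Y fs \<in> Cob \<Sigma> X Y"
  using assms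
proof (induction fs arbitrary: X Y)
  case Nil
  then show ?case by (simp add: Cob_iff)
next
  case (Cons f fs)
  obtain s X' s' Y' where X: "X = s # X'" "Y = s' # Y'"
    using Cons.prems by (cases X; cases Y) auto
  have "f \<in> Cob \<Sigma> [s] [s']" "\<forall>i<length fs. fs ! i \<in> Cob \<Sigma> [X' ! i] [Y' ! i]"
    using Cons.prems(3) unfolding X by (auto simp: All_less_Suc2)
  then have "cob_tensor [s] [s'] f (cob_tensors X' Y' fs) \<in> Cob \<Sigma> ([s] @ X') ([s'] @ Y')"
    using Cons.prems(1,2) X by (intro cob_tensor_in_Cob Cons.IH) auto
  then show ?case by (simp add: X)
qed

context decomposed_language
begin

section \<open>Disjoint unions of one-point states\<close>

lemma length_sign_spaces [simp]: "length (Vs X) = length X"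
  by (simp add: sign_spaces_def)

lemma nth_sign_spaces [simp]: "i < length X \<Longrightarrow> Vs X ! i = V [X ! i]"
  by (simp add: sign_spaces_def)

lemma tuples_sign_spaces:
  "xs \<in> tuples (Vs X) \<longleftrightarrow>
    length xs = length X \<and> (\<forall>i<length X. xs ! i \<in> carrier (V [X ! i]))"
  by (auto simp: tuples_def)

lemma tuples_sign_spaces_Cons:
  "xs \<in> tuples (Vs (s # X)) \<longleftrightarrow>
    (\<exists>x ys. xs = x # ys \<and> x \<in> carrier (V [s]) \<and> ys \<in> tuples (Vs X))"
  by (cases xs) (auto simp: tuples_sign_spaces All_less_Suc2)

text \<open>Every factor lives over a single point, so the shift by i brings the i-th plug to its
  position 0. Both conclusions share one induction because \<open>sat_state_union\<close> applies
  only to members of the state spaces.\<close>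

lemma sat_state_unions:
  assumes "xs \<in> tuples (Vs X)"
  shows state_unions_closed: "V_unions X xs \<in> carrier (V X)"
    and "a \<in> W \<Longrightarrow> b \<in> W \<Longrightarrow>
      sat (V_unions X xs) a b \<longleftrightarrow> (\<forall>i<length X. sat (xs ! i) a (\<lambda>j. b (i + j)))"
proof -
  have "V_unions X xs \<in> carrier (V X) \<and> (\<forall>a\<in>W. \<forall>b\<in>W.
      sat (V_unions X xs) a b \<longleftrightarrow> (\<forall>i<length X. sat (xs ! i) a (\<lambda>j. b (i + j))))"
    using assms
  proof (induction X arbitrary: xs)
    case Nil
    then show ?case by (simp add: state_unit_closed sat_state_unit)
  next
    case (Cons s X)
    then obtain x ys where xs: "xs = x # ys" "x \<in> carrier (V [s])" "ys \<in> tuples (Vs X)"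
      unfolding tuples_sign_spaces_Cons by blast
    note IH = Cons.IH[OF xs(3), THEN conjunct1] Cons.IH[OF xs(3), THEN conjunct2, rule_format]
    have "sat (V_unions (s # X) xs) a b \<longleftrightarrow> (\<forall>i<length (s # X). sat (xs ! i) a (\<lambda>j. b (i + j)))"
      if ab: "a \<in> W" "b \<in> W" for a b
      using sat_state_union(2)[OF xs(2) IH(1) ab] IH(2)[OF ab(1) plugs_comp(2)[OF ab(2)]] xs(1)
      by (simp add: All_less_Suc2)
    then show ?case using state_union_closed[OF xs(2) IH(1)] xs(1) by simp
  qed
  then show "V_unions X xs \<in> carrier (V X)"
    "a \<in> W \<Longrightarrow> b \<in> W \<Longrightarrow>
      sat (V_unions X xs) a b \<longleftrightarrow> (\<forall>i<length X. sat (xs ! i) a (\<lambda>j. b (i + j)))" by blast+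
qed

lemma state_unions_bhom:
  assumes xs: "xs \<in> tuples (Vs X)" and i: "i < length X"
  shows "(\<lambda>x. V_unions X (xs[i := x])) \<in> bhom (Vs X ! i) (V X)"
proof -
  have t: "xs[i := x] \<in> tuples (Vs X)" if "x \<in> carrier (V [X ! i])" for x
    using tuples_update[OF xs, of i x] i that by simp
  have len: "length xs = length X" using xs by (simp add: tuples_sign_spaces)
  have "(\<lambda>x. V_unions X (xs[i := x])) \<in> bhom (Homs [] [X ! i]) (Homs [] X)"
  \<comment> \<open>The entries other than the i-th act as a Boolean scalar that does not depend on
    x.\<close>
  proof (rule Hom_eval_bhomI[where R = "\<lambda>a b. {(a, \<lambda>j. b (i + j)) |_::unit.
        \<forall>k<length X. k \<noteq> i \<longrightarrow> sat (xs ! k) a (\<lambda>j. b (k + j))}"])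
    fix x assume x: "x \<in> carrier (Homs [] [X ! i])"
    then have x': "x \<in> carrier (V [X ! i])" by (simp add: state_space_def)
    show "V_unions X (xs[i := x]) \<in> carrier (Homs [] X)"
      using state_unions_closed[OF t[OF x']] by (simp add: state_space_def)
    fix a b :: "nat \<Rightarrow> 'a list \<times> 'a list" assume ab: "a \<in> W" "b \<in> W"
    show "sat (V_unions X (xs[i := x])) a b \<longleftrightarrow> (\<exists>(c, d)\<in>{(a, \<lambda>j. b (i + j)) |_::unit.
        \<forall>k<length X. k \<noteq> i \<longrightarrow> sat (xs ! k) a (\<lambda>j. b (k + j))}. sat x c d)"
      unfolding sat_state_unions(2)[OF t[OF x'] ab] using i len by (auto simp: nth_list_update)
  qed (use plugs_comp(2)[where r = "(+) i"] in auto)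
  then show ?thesis using i by (simp add: state_space_def)
qed

lemma state_unions_respects:
  assumes "(S, T) \<in> ntensor_rel (Vs X)" "S \<in> Fpow (tuples (Vs X))"
    "T \<in> Fpow (tuples (Vs X))"
  shows "finprod (V X) (V_unions X) S = finprod (V X) (V_unions X) T"
  using state_unions_closed state_unions_bhom
  by (intro ntensor_rel_respected[OF B_semimodule_state_space _ _ assms]) auto

lemma state_ntensor_bhom:
  "state_ntensor \<Sigma> \<alpha> X \<in> bhom (ntensor (Vs X)) (V X)"
  unfolding state_ntensor_def ntensor_def
  by (rule bpres_universal(1)[OF B_semimodule_state_space _ state_unions_respects])
    (auto intro: state_unions_closed)

lemma state_ntensor_npure:
  assumes "xs \<in> tuples (Vs X)"
  shows "state_ntensor \<Sigma> \<alpha> X (npure (Vs X) xs) = V_unions X xs"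
  unfolding state_ntensor_def npure_def
  by (rule bpres_universal(2)[OF B_semimodule_state_space _ state_unions_respects assms])
    (auto intro: state_unions_closed)

text \<open>The i-th entry is a state over one point and reads \<theta> at i only. The bound k lets
  the entries of a tuple be replaced one after another.\<close>

abbreviation basis_tuple :: "sign list \<Rightarrow> (nat \<Rightarrow> 'a list \<times> 'a list) \<Rightarrow> nat \<Rightarrow> 'a cob set set list" where
  "basis_tuple X \<theta> k \<equiv> map (\<lambda>i. basis [X ! i] (\<lambda>j. \<theta> (i + j))) [0..<k]"

lemma basis_tuple_in_tuples:
  assumes xs: "xs \<in> tuples (Vs X)" and k: "k \<le> length X" and \<theta>: "\<theta> \<in> W"
  shows "basis_tuple X \<theta> k @ drop k xs \<in> tuples (Vs X)"
  using xs k basis_closed[OF plugs_comp(2)[OF \<theta>]] by (auto simp: tuples_sign_spaces nth_append)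

text \<open>Induction on the number k of entries already expanded: \<open>state_expand\<close> is
  applied to entry k, linearity in this entry pulls out the sum, and \<open>concat_asg\<close>
  appends the new index. At k = \<open>length X\<close> it is the hypothesis \<open>gen\<close> of
  \<open>bext_biso\<close>.\<close>

lemma npure_expand:
  fixes X defines "Ms \<equiv> Vs X"
  assumes xs: "xs \<in> tuples Ms" and "k \<le> length X"
  shows "npure Ms xs = finprod (ntensor Ms) (\<lambda>\<theta>. npure Ms (basis_tuple X \<theta> k @ drop k xs))
    {\<theta> \<in> asg k. \<forall>i<k. sat (xs ! i) null (\<lambda>j. \<theta> (i + j))}"
  using assms(3)
proof (induction k)
  case 0
  interpret T: comm_monoid "ntensor Ms" using B_semimodule_ntensor by (rule B_semimoduleD)
  show ?case using npure_closed[OF xs] by (simp add: asg_0)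
next
  case (Suc k)
  interpret T: comm_monoid "ntensor Ms" using B_semimodule_ntensor by (rule B_semimoduleD)
  have k: "k < length X" using Suc.prems by simp
  have xs': "length xs = length X" "\<And>i. i < length X \<Longrightarrow> xs ! i \<in> carrier (V [X ! i])"
    using xs by (auto simp: Ms_def tuples_sign_spaces)
  let ?y = "\<lambda>\<theta>. basis_tuple X \<theta> k @ drop k xs"
  let ?F = "\<lambda>\<theta>. npure Ms (basis_tuple X \<theta> (Suc k) @ drop (Suc k) xs)"
  let ?P = "\<lambda>\<theta>. \<forall>i<k. sat (xs ! i) null (\<lambda>j. \<theta> (i + j))"
  let ?A = "{\<theta> \<in> asg k. ?P \<theta>}" and ?B = "{\<eta> \<in> asg 1. sat (xs ! k) null \<eta>}"
  have y: "?y \<theta> \<in> tuples Ms" if "\<theta> \<in> W" for \<theta>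
    using basis_tuple_in_tuples[OF xs[unfolded Ms_def] _ that, of k] k by (simp add: Ms_def)
  have F: "?F \<theta> \<in> carrier (ntensor Ms)" if "\<theta> \<in> W" for \<theta>
    using basis_tuple_in_tuples[OF xs[unfolded Ms_def] _ that, of "Suc k"] k
    by (intro npure_closed) (simp add: Ms_def)
  have FG: "?F (concat_asg k \<theta> \<eta>) \<in> carrier (ntensor Ms)" if "\<theta> \<in> ?A" "\<eta> \<in> ?B" for \<theta> \<eta>
    using that by (intro F asg_plugs[OF concat_asg_closed[of \<theta> k \<eta> 1]]) auto
  have fin: "finite ?A" "finite ?B" using finite_asg by auto
  have bB: "basis [X ! k] \<in> ?B \<rightarrow> carrier (V [X ! k])"
    using asg_plugs by (auto intro: basis_closed)
  have xk: "finprod (V [X ! k]) (basis [X ! k]) ?B = xs ! k"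
    using state_expand[OF xs'(2)[OF k]] by simp
  \<comment> \<open>Appending \<eta> leaves the first k entries as they are, since each reads one of
    the first k values.\<close>
  have yF: "npure Ms ((?y \<theta>)[k := basis [X ! k] \<eta>]) = ?F (concat_asg k \<theta> \<eta>)" for \<theta> \<eta>
  proof -
    have "basis [X ! i] (\<lambda>j. concat_asg k \<theta> \<eta> (i + j)) = basis [X ! i] (\<lambda>j. \<theta> (i + j))" if "i < k" for i
      by (rule basis_cong) (use that in simp)
    then have b: "basis_tuple X (concat_asg k \<theta> \<eta>) (Suc k) = basis_tuple X \<theta> k @ [basis [X ! k] \<eta>]"
      by (simp cong: map_cong)
    have d: "drop k xs = xs ! k # drop (Suc k) xs" using k xs' by (simp add: Cons_nth_drop_Suc)
    show ?thesis unfolding b d by (simp add: list_update_append)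
  qed
  have Mk: "Ms ! k = V [X ! k]" using k by (simp add: Ms_def)
  have step: "npure Ms (?y \<theta>) = finprod (ntensor Ms) (\<lambda>\<eta>. ?F (concat_asg k \<theta> \<eta>)) ?B" if \<theta>: "\<theta> \<in> ?A" for \<theta>
  proof -
    have "\<theta> \<in> W" using \<theta> asg_plugs by blast
    note ty = y[OF this]
    have yk: "?y \<theta> ! k = xs ! k" using k xs' by (simp add: nth_append)
    have "(?y \<theta>)[k := xs ! k] = ?y \<theta>" by (subst yk[symmetric]) (rule list_update_id)
    then have "npure Ms (?y \<theta>) = npure Ms ((?y \<theta>)[k := finprod (V [X ! k]) (basis [X ! k]) ?B])"
      unfolding xk by (simp only:)
    also have "\<dots> = finprod (ntensor Ms) (\<lambda>\<eta>. npure Ms ((?y \<theta>)[k := basis [X ! k] \<eta>])) ?B"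
      by (rule bhom_finprod[OF npure_bhom[of Ms k, unfolded Mk] comm_monoid_state_space T.comm_monoid_axioms fin(2) bB])
        (use ty k in \<open>simp_all add: comm_monoid_state_space Ms_def\<close>)
    finally show ?thesis unfolding yF .
  qed
  have "npure Ms xs = finprod (ntensor Ms) (\<lambda>\<theta>. npure Ms (?y \<theta>)) ?A"
    using Suc by simp
  also have "\<dots> = finprod (ntensor Ms) (\<lambda>\<theta>. finprod (ntensor Ms) (\<lambda>\<eta>. ?F (concat_asg k \<theta> \<eta>)) ?B) ?A"
  proof (rule T.finprod_cong'[OF HOL.refl])
    show "(\<lambda>\<theta>. finprod (ntensor Ms) (\<lambda>\<eta>. ?F (concat_asg k \<theta> \<eta>)) ?B) \<in> ?A \<rightarrow> carrier (ntensor Ms)"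
      by (intro Pi_I T.finprod_closed FG)
  qed (rule step)
  also have "\<dots> = finprod (ntensor Ms) (\<lambda>(\<theta>, \<eta>). ?F (concat_asg k \<theta> \<eta>)) (?A \<times> ?B)"
    by (rule finprod_Times_idem[OF B_semimodule_ntensor fin FG])
  also have "\<dots> = finprod (ntensor Ms) (\<lambda>z. ?F (case_prod (concat_asg k) z)) (?A \<times> ?B)"
    by (simp add: case_prod_unfold)
  also have "\<dots> = finprod (ntensor Ms) ?F (case_prod (concat_asg k) ` (?A \<times> ?B))"
  proof (rule finprod_image_idem[OF B_semimodule_ntensor, symmetric])
    show "?F \<in> case_prod (concat_asg k) ` (?A \<times> ?B) \<rightarrow> carrier (ntensor Ms)"
      by (intro Pi_I, elim imageE SigmaE, simp only: prod.case FG)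
  qed (use fin in simp)
  also have "case_prod (concat_asg k) ` (?A \<times> ?B) = {\<theta> \<in> asg (k + 1). ?P \<theta> \<and> sat (xs ! k) null (\<lambda>j. \<theta> (k + j))}"
  proof (rule concat_asg_image[symmetric])
    fix \<theta> \<theta>' :: "nat \<Rightarrow> 'a list \<times> 'a list"
    assume *: "\<theta> \<in> W" "\<theta>' \<in> W" "\<And>i. i < k \<Longrightarrow> \<theta> i = \<theta>' i" "?P \<theta>"
    show "?P \<theta>'"
    proof (intro allI impI)
      fix i assume i: "i < k"
      have "sat (xs ! i) null (\<lambda>j. \<theta> (i + j)) \<longleftrightarrow> sat (xs ! i) null (\<lambda>j. \<theta>' (i + j))"
        by (rule state_sat_cong[OF xs'(2)]) (use i k * plugs_comp(2) in auto)
      then show "sat (xs ! i) null (\<lambda>j. \<theta>' (i + j))" using *(4) i by simp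
    qed
  qed
  also have "\<dots> = {\<theta> \<in> asg (Suc k). \<forall>i<Suc k. sat (xs ! i) null (\<lambda>j. \<theta> (i + j))}"
    by (auto simp: less_Suc_eq)
  finally show ?case .
qed

lemma state_unions_basis:
  assumes \<theta>: "\<theta> \<in> W"
  shows "V_unions X (basis_tuple X \<theta> (length X)) = basis X \<theta>"
proof (rule state_eqI)
  have t: "basis_tuple X \<theta> (length X) \<in> tuples (Vs X)"
    using basis_closed[OF plugs_comp(2)[OF \<theta>]] by (simp add: tuples_sign_spaces)
  show "V_unions X (basis_tuple X \<theta> (length X)) \<in> carrier (V X)"
    by (rule state_unions_closed[OF t])
  fix b :: "nat \<Rightarrow> 'a list \<times> 'a list" assume b: "b \<in> W"
  show "sat (V_unions X (basis_tuple X \<theta> (length X))) null b \<longleftrightarrow> sat (basis X \<theta>) null b"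
    unfolding sat_state_unions(2)[OF t plugs_Nil b] sat_basis[OF \<theta> plugs_Nil b]
    by (simp add: sat_basis[OF plugs_comp(2)[OF \<theta>] plugs_Nil plugs_comp(2)[OF b]])
qed (rule basis_closed[OF \<theta>])

lemma state_ntensor_biso:
  "state_ntensor \<Sigma> \<alpha> X \<in> biso (ntensor (Vs X)) (V X)"
proof -
  let ?Ms = "Vs X" and ?K = "V X" and ?n = "length X"
  let ?c = "\<lambda>k. {\<theta> \<in> asg ?n. sat k null \<theta>}"
  interpret K: comm_monoid ?K by (rule comm_monoid_state_space)
  have "bext ?K (V_unions X) \<in> biso (bpres (tuples ?Ms) (ntensor_rel ?Ms)) ?K"
  proof (rule bext_biso[where x = "\<lambda>\<theta>. basis_tuple X \<theta> ?n" and c = ?c and I = "asg ?n", OF B_semimodule_state_space])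
    show "V_unions X \<in> tuples ?Ms \<rightarrow> carrier ?K"
      by (auto intro: state_unions_closed)
    show "finprod ?K (V_unions X) S = finprod ?K (V_unions X) T"
      if "(S, T) \<in> ntensor_rel ?Ms" "S \<in> Fpow (tuples ?Ms)" "T \<in> Fpow (tuples ?Ms)" for S T
      by (rule state_unions_respects[OF that])
    show "(\<lambda>\<theta>. basis_tuple X \<theta> ?n) \<in> asg ?n \<rightarrow> tuples ?Ms"
      using basis_closed[OF plugs_comp(2)[OF asg_plugs]] by (simp add: tuples_sign_spaces)
    show "?c \<one>\<^bsub>?K\<^esub> = {}" using asg_plugs by (auto simp: state_space_def sat_one)
    show "?c (k \<otimes>\<^bsub>?K\<^esub> l) = ?c k \<union> ?c l" if "k \<in> carrier ?K" "l \<in> carrier ?K" for k l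
      using that asg_plugs by (auto simp: state_space_def sat_mult)
    show "finprod ?K (\<lambda>\<theta>. V_unions X (basis_tuple X \<theta> ?n)) (?c k) = k" if k: "k \<in> carrier ?K" for k
    proof -
      have "finprod ?K (\<lambda>\<theta>. V_unions X (basis_tuple X \<theta> ?n)) (?c k) = finprod ?K (basis X) (?c k)"
        by (rule K.finprod_cong') (use asg_plugs state_unions_basis basis_closed in auto)
      then show ?thesis using state_expand[OF k] by simp
    qed
    fix xs assume xs: "xs \<in> tuples ?Ms"
    have "?c (V_unions X xs) = {\<theta> \<in> asg ?n. \<forall>i<?n. sat (xs ! i) null (\<lambda>j. \<theta> (i + j))}"
      using sat_state_unions(2)[OF xs] asg_plugs by auto
    then show "bgen (tuples ?Ms) (ntensor_rel ?Ms) xs = finprod (bpres (tuples ?Ms) (ntensor_rel ?Ms))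
        (\<lambda>\<theta>. bgen (tuples ?Ms) (ntensor_rel ?Ms) (basis_tuple X \<theta> ?n)) (?c (V_unions X xs))"
      using npure_expand[OF xs order_refl] xs unfolding npure_def ntensor_def
      by (simp add: tuples_sign_spaces)
  qed (use finite_asg in auto)
  then show ?thesis unfolding state_ntensor_def ntensor_def .
qed

lemma state_map_cob_tensors:
  assumes "length X = length fs" "length Y = length fs"
    "\<forall>i<length fs. fs ! i \<in> Cob \<Sigma> [X ! i] [Y ! i]" "xs \<in> tuples (Vs X)"
  shows "V_map X Y (cob_tensors X Y fs) (V_unions X xs) =
    V_unions Y (map2 (\<lambda>f x. f x) (map (\<lambda>i. V_map [X ! i] [Y ! i] (fs ! i)) [0..<length fs]) xs)"
  using assms
proof (induction fs arbitrary: X Y xs)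
  case Nil
  \<comment> \<open>The empty multiset is the identity cobordism of the empty sequence.\<close>
  then show ?case
    using state_map_id[OF state_unit_closed[of True]] by (simp add: strands_def)
next
  case (Cons f fs)
  obtain s X' s' Y' where X: "X = s # X'" "Y = s' # Y'"
    using Cons.prems by (cases X; cases Y) auto
  obtain x ys where xs: "xs = x # ys" "x \<in> carrier (V [s])" "ys \<in> tuples (Vs X')"
    using Cons.prems(4) unfolding X tuples_sign_spaces_Cons by blast
  have len: "length X' = length fs" "length Y' = length fs" using Cons.prems X by auto
  have f: "f \<in> Cob \<Sigma> [s] [s']" and fs: "\<forall>i<length fs. fs ! i \<in> Cob \<Sigma> [X' ! i] [Y' ! i]"
    using Cons.prems(3) unfolding X by (auto simp: All_less_Suc2)
  have "V_map ([s] @ X') ([s'] @ Y') (cob_tensor [s] [s'] f (cob_tensors X' Y' fs))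
      (V_union [s] X' x (V_unions X' ys)) =
    V_union [s'] Y' (V_map [s] [s'] f x)
      (V_map X' Y' (cob_tensors X' Y' fs) (V_unions X' ys))"
    by (rule state_map_cob_tensor[OF f cob_tensors_in_Cob[OF len fs] xs(2) state_unions_closed[OF xs(3)]])
  then show ?case
    using Cons.IH[OF len fs xs(3)] unfolding X xs(1) list.size(4) add_0_right add_Suc_right map_upt_Suc by simp
qed

lemma state_ntensor_natural:
  assumes len: "length X = length fs" "length Y = length fs"
    and fs: "\<forall>i<length fs. fs ! i \<in> Cob \<Sigma> [X ! i] [Y ! i]"
    and t: "t \<in> carrier (ntensor (Vs X))"
  shows "V_map X Y (cob_tensors X Y fs) (state_ntensor \<Sigma> \<alpha> X t) =
    state_ntensor \<Sigma> \<alpha> Y (ntensor_map (Vs Y)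
      (map (\<lambda>i. V_map [X ! i] [Y ! i] (fs ! i)) [0..<length fs]) t)"
proof -
  let ?gs = "map (\<lambda>i. V_map [X ! i] [Y ! i] (fs ! i)) [0..<length fs]"
  let ?Ms = "Vs X" and ?Ns = "Vs Y"
  have l: "length ?gs = length ?Ms" "length ?Ns = length ?Ms" using len by auto
  have g: "?gs ! i \<in> bhom (?Ms ! i) (?Ns ! i)" and N: "B_semimodule (?Ns ! i)" if "i < length ?Ms" for i
    using that len fs by (auto intro: state_map_bhom B_semimodule_state_space)
  note nm = ntensor_map_universal[OF l g N]
  have c: "map2 (\<lambda>f x. f x) ?gs xs \<in> tuples ?Ns" if "xs \<in> tuples ?Ms" for xs
    using that len bhom_closed[OF g] by (auto simp: tuples_def)
  show ?thesis
    by (rule ntensor_hom_eqI[OF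
        bhom_comp[OF state_ntensor_bhom state_map_bhom[OF cob_tensors_in_Cob[OF len fs]]]
        bhom_comp[OF ntensor_map_bhom[OF l g N] state_ntensor_bhom] comm_monoid_state_space _ t])
      (simp_all only: ntensor_map_npure[OF l g N] state_ntensor_npure c state_map_cob_tensors[OF len fs])
qed

section \<open>Bending and duality\<close>

lemma bend_map_biso: "V_bend X X' \<in> biso (Homs X X') (V (dual X @ X'))"
proof -
  let ?n = "length X" and ?h = "V_bend X X'"
  have "inj_on ?h (carrier (Homs X X'))"
  proof (rule inj_onI)
    fix A B assume A: "A \<in> carrier (Homs X X')" and B: "B \<in> carrier (Homs X X')"
      and eq: "?h A = ?h B"
    show "A = B"
    proof (rule Hom_eval_eqI[OF A B])
      fix a b :: "nat \<Rightarrow> 'a list \<times> 'a list" assume ab: "a \<in> W" "b \<in> W"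
      \<comment> \<open>c lists the plugs a and b in the order in which bending arranges the points.
        The bent class at c has the value of the original at a and b, so it determines the
        function.\<close>
      define c where "c j = (if j < ?n then a (?n - 1 - j) else b (j - ?n))" for j
      have c: "c \<in> W" using ab by (auto simp: c_def plugs_def)
      have "sat C a b \<longleftrightarrow> sat (?h C) null c" if C: "C \<in> carrier (Homs X X')" for C
        unfolding sat_bend_map[OF C plugs_Nil c]
        by (rule Hom_sat_cong[OF C ab plugs_comp(2)[OF c] plugs_comp(2)[OF c]]) (auto simp: c_def)
      then show "sat A a b \<longleftrightarrow> sat B a b" using A B eq by simp
    qed
  qed
  \<comment> \<open>Unbending every cobordism of a representative gives a preimage; that bending
    returns B is checked on functions.\<close>
  moreover have "B \<in> ?h ` carrier (Homs X X')" if B: "B \<in> carrier (V (dual X @ X'))" for B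
  proof -
    obtain S where S: "S \<in> Fpow (Cob \<Sigma> [] (dual X @ X'))" "B = cls [] (dual X @ X') S"
      using B unfolding state_space_def by (rule Hom_eval_carrierE)
    have uS: "cob_unbend X ` S \<in> Fpow (Cob \<Sigma> X X')"
      using S(1) by (auto simp: Fpow_def subset_iff intro!: cob_unbend_in_Cob)
    note A = cls_closed[OF uS]
    have "?h (cls X X' (cob_unbend X ` S)) = B"
    proof (rule state_eqI[OF bhom_closed[OF bend_map_bhom A] B])
      fix b :: "nat \<Rightarrow> 'a list \<times> 'a list" assume b: "b \<in> W"
      let ?a = "\<lambda>i. b (?n - 1 - i)" and ?b = "\<lambda>j. b (?n + j)"
      have "ev (cob_unbend X f) ?a ?b \<longleftrightarrow> ev f null b" if "f \<in> S" for f
        unfolding cob_eval_unbend using S(1) that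
        by (intro cob_eval_cong[of f \<Sigma> "[]" "dual X @ X'"]) (auto simp: Fpow_def)
      then show "sat (?h (cls X X' (cob_unbend X ` S))) null b \<longleftrightarrow> sat B null b"
        unfolding sat_bend_map[OF A plugs_Nil b] S(2) sat_cls[OF S(1) plugs_Nil b]
          sat_cls[OF uS plugs_comp(2)[OF b] plugs_comp(2)[OF b]] by auto
    qed
    then show ?thesis using A by blast
  qed
  ultimately show ?thesis
    using bend_map_bhom bhom_closed[OF bend_map_bhom] by (auto simp: biso_def bij_betw_def)
qed

text \<open>Both sides sum the same products over indices at X and X'. On the right the points of X
  are listed in reverse and form one sequence with those of X', so the proof translates between the
  two indexings.\<close>

lemma bend_map_natural:
  assumes h: "h \<in> Cob \<Sigma> Y X" and g: "g \<in> Cob \<Sigma> X' Y'" and A: "A \<in> carrier (Homs X X')"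
  shows "V_bend Y Y' (Hom_map \<Sigma> \<alpha> Y X X' Y' h g A) =
    V_map (dual X @ X') (dual Y @ Y')
      (cob_tensor (dual X) (dual Y) (cob_dual Y X h) g) (V_bend X X' A)"
proof (rule state_eqI)
  note hA = bhom_closed[OF Hom_map_bhom[OF h g] A] and bA = bhom_closed[OF bend_map_bhom A]
  note dg = cob_tensor_in_Cob[OF cob_dual_in_Cob[OF h] g]
  show "V_bend Y Y' (Hom_map \<Sigma> \<alpha> Y X X' Y' h g A) \<in> carrier (V (dual Y @ Y'))"
    by (rule bhom_closed[OF bend_map_bhom hA])
  show "V_map (dual X @ X') (dual Y @ Y')
      (cob_tensor (dual X) (dual Y) (cob_dual Y X h) g) (V_bend X X' A) \<in> carrier (V (dual Y @ Y'))"
    by (rule state_map_closed[OF dg bA])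
  fix b :: "nat \<Rightarrow> 'a list \<times> 'a list" assume b: "b \<in> W"
  let ?a = "\<lambda>i. b (length Y - 1 - i)" and ?b = "\<lambda>j. b (length Y + j)"
  let ?r = "\<lambda>\<theta> i. \<theta> (length X - 1 - i)" and ?s = "\<lambda>\<theta> j. \<theta> (length X + j)"
  have l: "sat (V_bend Y Y' (Hom_map \<Sigma> \<alpha> Y X X' Y' h g A)) null b \<longleftrightarrow>
    (\<exists>\<theta>\<in>asg (length X). \<exists>\<theta>'\<in>asg (length X'). ev h ?a \<theta> \<and> sat A \<theta> \<theta>' \<and> ev g \<theta>' ?b)" (is "_ \<longleftrightarrow> ?lhs")
    unfolding sat_bend_map[OF hA plugs_Nil b]
    by (rule sat_Hom_map[OF h g A plugs_comp(2)[OF b] plugs_comp(2)[OF b]])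
  have r: "sat (V_map (dual X @ X') (dual Y @ Y')
      (cob_tensor (dual X) (dual Y) (cob_dual Y X h) g) (V_bend X X' A)) null b \<longleftrightarrow>
    (\<exists>\<theta>\<in>asg (length X + length X'). sat A (?r \<theta>) (?s \<theta>) \<and> ev h ?a (?r \<theta>) \<and> ev g (?s \<theta>) ?b)" (is "_ \<longleftrightarrow> ?rhs")
    unfolding sat_state_map[OF dg bA plugs_Nil b] length_append length_dual cob_eval_tensor cob_eval_dual
    by (intro bex_cong conj_cong HOL.refl sat_bend_map[OF A plugs_Nil asg_plugs])
  have "?lhs \<longleftrightarrow> ?rhs"
  proof
    assume ?lhs
    then obtain \<theta> \<theta>' where \<theta>: "\<theta> \<in> asg (length X)" "\<theta>' \<in> asg (length X')"
      "ev h ?a \<theta>" "sat A \<theta> \<theta>'" "ev g \<theta>' ?b" by blast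
    define u where "u i = (if i < length X then \<theta> (length X - 1 - i) else ([], []))" for i
    have u: "u \<in> asg (length X)" using \<theta>(1) by (auto simp: asg_def u_def)
    let ?\<eta> = "concat_asg (length X) u \<theta>'"
    have \<eta>: "?\<eta> \<in> asg (length X + length X')" by (rule concat_asg_closed[OF u \<theta>(2)])
    have e: "?r ?\<eta> i = \<theta> i" if "i < length X" for i
    proof -
      have "length X - Suc i < length X" using that by linarith
      then show ?thesis using that by (simp add: concat_asg_def u_def)
    qed
    have "sat A (?r ?\<eta>) (?s ?\<eta>) \<longleftrightarrow> sat A \<theta> \<theta>'"
      by (rule Hom_sat_cong[OF A])
        (use e in \<open>auto intro: plugs_comp(2)[OF asg_plugs[OF \<eta>]] asg_plugs[OF \<theta>(1)] asg_plugs[OF \<theta>(2)]\<close>)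
    moreover have "ev h ?a (?r ?\<eta>) \<longleftrightarrow> ev h ?a \<theta>"
      by (rule cob_eval_cong[OF h]) (use e in auto)
    ultimately show ?rhs using \<theta> \<eta> by (intro bexI[of _ ?\<eta>]) simp_all
  next
    assume ?rhs
    then obtain \<theta> where \<theta>: "\<theta> \<in> asg (length X + length X')" "sat A (?r \<theta>) (?s \<theta>)" "ev h ?a (?r \<theta>)" "ev g (?s \<theta>) ?b"
      by blast
    \<comment> \<open>Beyond \<open>length X\<close> truncated subtraction makes
      \<open>?r \<theta>\<close> equal to \<theta> 0 rather than to the default of
      \<open>asg\<close>; u agrees with it at the points of X and lies in
      \<open>asg\<close>.\<close>
    define u where "u i = (if i < length X then \<theta> (length X - 1 - i) else ([], []))" for i
    have u: "u \<in> asg (length X)" and s: "?s \<theta> \<in> asg (length X')"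
      using \<theta>(1) by (auto simp: asg_def u_def)
    have "sat A (?r \<theta>) (?s \<theta>) \<longleftrightarrow> sat A u (?s \<theta>)"
      by (rule Hom_sat_cong[OF A plugs_comp(2)[OF asg_plugs[OF \<theta>(1)]] asg_plugs[OF s] asg_plugs[OF u] asg_plugs[OF s]])
        (auto simp: u_def)
    moreover have "ev h ?a (?r \<theta>) \<longleftrightarrow> ev h ?a u"
      by (rule cob_eval_cong[OF h]) (auto simp: u_def)
    ultimately show ?lhs using \<theta> u s by (intro bexI[of _ u] bexI[of _ "?s \<theta>"]) simp_all
  qed
  then show "sat (V_bend Y Y' (Hom_map \<Sigma> \<alpha> Y X X' Y' h g A)) null b \<longleftrightarrow>
    sat (V_map (dual X @ X') (dual Y @ Y')
      (cob_tensor (dual X) (dual Y) (cob_dual Y X h) g) (V_bend X X' A)) null b"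
    unfolding l r .
qed

end

section \<open>Existence of a decomposition of the identity\<close>

text \<open>Prefixes leading to the same state are interchangeable, and so are suffixes accepted
  from the same set of states. There are finitely many states and sets of states, so finite systems
  of representatives exist.\<close>

lemma regular_finite_index:
  assumes "regular_language \<Sigma> L"
  obtains X U where "finite X" "X \<subseteq> lists \<Sigma>" "finite U" "U \<subseteq> lists \<Sigma>"
    "\<And>x. x \<in> lists \<Sigma> \<Longrightarrow> \<exists>x'\<in>X. \<forall>u\<in>lists \<Sigma>. x @ u \<in> L \<longleftrightarrow> x' @ u \<in> L"
    "\<And>u. u \<in> lists \<Sigma> \<Longrightarrow> \<exists>u'\<in>U. \<forall>x\<in>lists \<Sigma>. x @ u \<in> L \<longleftrightarrow> x @ u' \<in> L"
proof -
  obtain n :: nat and \<delta> q\<^sub>0 F where q0: "q\<^sub>0 < n" and \<delta>: "\<forall>q<n. \<forall>a\<in>\<Sigma>. \<delta> q a < n"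
    and L: "L = {w \<in> lists \<Sigma>. foldl \<delta> q\<^sub>0 w \<in> F}"
    using assms unfolding regular_language_def by blast
  let ?st = "foldl \<delta> q\<^sub>0"
  let ?acc = "\<lambda>u. {q. q < n \<and> foldl \<delta> q u \<in> F}"
  have st: "foldl \<delta> q w < n" if "w \<in> lists \<Sigma>" "q < n" for q w
    using that \<delta> by (induction w arbitrary: q) auto
  have mem: "x @ u \<in> L \<longleftrightarrow> ?st x \<in> ?acc u" if "x \<in> lists \<Sigma>" "u \<in> lists \<Sigma>" for x u
    using that st[OF that(1) q0] by (auto simp: L)
  have "finite (?st ` lists \<Sigma>)"
    by (rule finite_subset[of _ "{..<n}"]) (use st q0 in auto)
  from finite_subset_image[OF this subset_refl]
  obtain X where X: "X \<subseteq> lists \<Sigma>" "finite X" "?st ` lists \<Sigma> = ?st ` X"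
    by (elim exE conjE)
  have "finite (?acc ` lists \<Sigma>)"
    by (rule finite_subset[of _ "Pow {..<n}"]) auto
  from finite_subset_image[OF this subset_refl]
  obtain U where U: "U \<subseteq> lists \<Sigma>" "finite U" "?acc ` lists \<Sigma> = ?acc ` U"
    by (elim exE conjE)
  show thesis
  proof (rule that[OF X(2,1) U(2,1)])
    fix x assume x: "x \<in> lists \<Sigma>"
    have "?st x \<in> ?st ` X" unfolding X(3)[symmetric] by (rule imageI[OF x])
    then obtain x' where x': "x' \<in> X" "?st x = ?st x'" by (elim imageE) simp
    have "x @ u \<in> L \<longleftrightarrow> x' @ u \<in> L" if "u \<in> lists \<Sigma>" for u
      using mem[OF x that] mem[of x' u] that x' X(1) by auto
    then show "\<exists>x'\<in>X. \<forall>u\<in>lists \<Sigma>. x @ u \<in> L \<longleftrightarrow> x' @ u \<in> L" using x'(1) by blast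
  next
    fix u assume u: "u \<in> lists \<Sigma>"
    have "?acc u \<in> ?acc ` U" unfolding U(3)[symmetric] by (rule imageI[OF u])
    then obtain u' where u': "u' \<in> U" "?acc u = ?acc u'" by (elim imageE)
    have u'': "u' \<in> lists \<Sigma>" using u' U(1) by blast
    have "x @ u \<in> L \<longleftrightarrow> x @ u' \<in> L" if "x \<in> lists \<Sigma>" for x
      unfolding mem[OF that u] mem[OF that u''] u'(2) ..
    then show "\<exists>u'\<in>U. \<forall>x\<in>lists \<Sigma>. x @ u \<in> L \<longleftrightarrow> x @ u' \<in> L" using u'(1) by blast
  qed
qed

text \<open>
  Projectivity splits the surjection from the free semimodule on words onto $A(-)$: \<open>G x\<close> is the
  set of words whose sum is the chosen preimage of the class of \<open>x\<close>. The last property expresses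
  that the splitting is monotone.
\<close>

lemma projective_section:
  assumes proj: "projective (state_space_minus \<Sigma> L)"
  obtains G where "\<And>x. x \<in> lists \<Sigma> \<Longrightarrow> finite (G x) \<and> G x \<subseteq> lists \<Sigma>"
    "\<And>x u. x \<in> lists \<Sigma> \<Longrightarrow> u \<in> lists \<Sigma> \<Longrightarrow> x @ u \<in> L \<longleftrightarrow> (\<exists>w\<in>G x. w @ u \<in> L)"
    "\<And>x S. x \<in> lists \<Sigma> \<Longrightarrow> finite S \<Longrightarrow> S \<subseteq> lists \<Sigma> \<Longrightarrow>
      (\<And>u. u \<in> lists \<Sigma> \<Longrightarrow> x @ u \<in> L \<Longrightarrow> \<exists>s\<in>S. s @ u \<in> L) \<Longrightarrow> G x \<subseteq> (\<Union>s\<in>S. G s)"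
proof -
  define X where "X = lists \<Sigma>"
  define E where "E = {(S, T). S \<in> Fpow X \<and> T \<in> Fpow X \<and>
          (\<forall>u\<in>X. (\<exists>w\<in>S. w @ u \<in> L) \<longleftrightarrow> (\<exists>w\<in>T. w @ u \<in> L))}"
  let ?P = "bquot X E"
  have P: "projective ?P" using proj by (simp add: state_space_minus_def X_def E_def)
  then have BP: "B_semimodule ?P" by (simp add: projective_def)
  have eqv: "equiv (Fpow X) E"
    by (rule equivI) (auto simp: E_def refl_on_def sym_def trans_def)
  have class_eq: "E `` {S} = E `` {T} \<longleftrightarrow> (S, T) \<in> E" if "S \<in> Fpow X" "T \<in> Fpow X" for S T
    using eq_equiv_class_iff[OF eqv that] .
  have E_Un: "(S \<union> T, S' \<union> T') \<in> E" if "(S, S') \<in> E" "(T, T') \<in> E" for S S' T T'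
    using that by (simp add: E_def Fpow_Un bex_Un)
  have mult: "E `` {S} \<otimes>\<^bsub>?P\<^esub> E `` {T} = E `` {S \<union> T}" if S: "S \<in> Fpow X" and T: "T \<in> Fpow X" for S T
  proof -
    have "E `` {S' \<union> T'} = E `` {S \<union> T}" if "S' \<in> E `` {S}" "T' \<in> E `` {T}" for S' T'
      using E_Un[of S S' T T'] that by (intro equiv_class_eq[OF eqv, symmetric]) simp
    then have "(\<Union>S'\<in>E `` {S}. \<Union>T'\<in>E `` {T}. E `` {S' \<union> T'}) = (\<Union>S'\<in>E `` {S}. \<Union>T'\<in>E `` {T}. E `` {S \<union> T})"
      by (intro SUP_cong HOL.refl)
    also have "S \<in> E `` {S}" "T \<in> E `` {T}" using eqv S T by (auto dest: equiv_class_self)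
    then have "(\<Union>S'\<in>E `` {S}. \<Union>T'\<in>E `` {T}. E `` {S \<union> T}) = E `` {S \<union> T}" by blast
    finally show ?thesis by (simp add: bquot_def)
  qed
  have carrier: "E `` {S} \<in> carrier ?P" if "S \<in> Fpow X" for S
    using that by (auto simp: bquot_def intro: quotientI)
  define Free :: "'a list set monoid" where
    "Free = \<lparr>carrier = Fpow X, monoid.mult = (\<union>), one = {}\<rparr>"
  have BF: "B_semimodule Free"
    unfolding B_semimodule_def Free_def by (auto intro!: comm_monoidI simp: Fpow_def)
  have p: "(\<lambda>S. E `` {S}) \<in> bhom Free ?P"
    by (rule bhomI) (simp_all add: Free_def carrier mult, simp add: bquot_def)
  have surj: "(\<lambda>S. E `` {S}) ` carrier Free = carrier ?P"
    by (auto simp: Free_def bquot_def quotient_def)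
  obtain g where g: "g \<in> bhom ?P Free" "\<forall>x\<in>carrier ?P. E `` {g x} = x"
    using projective_lift[OF P BF BP p surj bhom_id] by blast
  define G where "G x = g (E `` {{x}})" for x
  have sing: "{x} \<in> Fpow X" if "x \<in> X" for x using that by (simp add: Fpow_def)
  have GF: "G x \<in> Fpow X" if "x \<in> X" for x
    using bhom_closed[OF g(1) carrier[OF sing[OF that]]] by (simp add: G_def Free_def)
  \<comment> \<open>By additivity the splitting at any class is the union over the words of a
    representative.\<close>
  have gS: "g (E `` {S}) = (\<Union>s\<in>S. G s)" if "finite S" "S \<subseteq> X" for S
    using that
  proof (induction S)
    case empty
    then show ?case using bhom_one[OF g(1)] by (simp add: bquot_def Free_def)
  next
    case (insert s S)
    then have F: "{s} \<in> Fpow X" "S \<in> Fpow X" by (auto simp: Fpow_def)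
    have "g (E `` {{s} \<union> S}) = G s \<union> g (E `` {S})"
      using bhom_mult[OF g(1) carrier[OF F(1)] carrier[OF F(2)]] by (simp add: mult F G_def Free_def)
    then show ?case using insert by simp
  qed
  show thesis
  proof (rule that)
    show "finite (G x) \<and> G x \<subseteq> lists \<Sigma>" if "x \<in> lists \<Sigma>" for x
      using GF that by (auto simp: X_def Fpow_def)
    show "x @ u \<in> L \<longleftrightarrow> (\<exists>w\<in>G x. w @ u \<in> L)" if "x \<in> lists \<Sigma>" "u \<in> lists \<Sigma>" for x u
    proof -
      have x: "x \<in> X" using that by (simp add: X_def)
      have "E `` {G x} = E `` {{x}}" using g(2) carrier[OF sing[OF x]] by (simp add: G_def)
      then have "(G x, {x}) \<in> E" using class_eq GF[OF x] sing[OF x] by blast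
      then show ?thesis using that by (simp add: E_def X_def)
    qed
    show "G x \<subseteq> (\<Union>s\<in>S. G s)" if x: "x \<in> lists \<Sigma>" and S: "finite S" "S \<subseteq> lists \<Sigma>"
      and le: "\<And>u. u \<in> lists \<Sigma> \<Longrightarrow> x @ u \<in> L \<Longrightarrow> \<exists>s\<in>S. s @ u \<in> L" for x S
    proof -
      \<comment> \<open>The hypothesis says that x lies below the sum of S in A(-), that is, adding
        x does not change this sum; an additive map preserves such a relation.\<close>
      have "({x} \<union> S, S) \<in> E"
        using x S le by (auto simp: E_def X_def Fpow_def)
      then have "E `` {insert x S} = E `` {S}" by (simp add: equiv_class_eq[OF eqv])
      then have "(\<Union>s\<in>insert x S. G s) = (\<Union>s\<in>S. G s)"
        using gS[of "insert x S"] gS[of S] x S by (simp add: X_def)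
      then show ?thesis by blast
    qed
  qed
qed

text \<open>
  For a word \<open>w\<close> in the image of the splitting, \<open>x \<mapsto> [w \<in> G x]\<close> is a linear functional on a finite
  semimodule; it is the sum of the functionals $x \mapsto \alpha_I(xu)$ over those \<open>u\<close> that vanish on
  its kernel.
\<close>

lemma decomposition_exists:
  assumes "regular_language \<Sigma> L" "projective (state_space_minus \<Sigma> L)"
  shows "\<exists>D. decomposition_of_identity \<Sigma> L D"
proof -
  obtain X U where X: "finite X" "X \<subseteq> lists \<Sigma>" and U: "finite U" "U \<subseteq> lists \<Sigma>"
    and Xr: "\<And>x. x \<in> lists \<Sigma> \<Longrightarrow> \<exists>x'\<in>X. \<forall>u\<in>lists \<Sigma>. x @ u \<in> L \<longleftrightarrow> x' @ u \<in> L"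
    and Ur: "\<And>u. u \<in> lists \<Sigma> \<Longrightarrow> \<exists>u'\<in>U. \<forall>x\<in>lists \<Sigma>. x @ u \<in> L \<longleftrightarrow> x @ u' \<in> L"
    using regular_finite_index[OF assms(1)] by blast
  obtain G where GF: "\<And>x. x \<in> lists \<Sigma> \<Longrightarrow> finite (G x) \<and> G x \<subseteq> lists \<Sigma>"
    and G: "\<And>x u. x \<in> lists \<Sigma> \<Longrightarrow> u \<in> lists \<Sigma> \<Longrightarrow> x @ u \<in> L \<longleftrightarrow> (\<exists>w\<in>G x. w @ u \<in> L)"
    and Gle: "\<And>x S. x \<in> lists \<Sigma> \<Longrightarrow> finite S \<Longrightarrow> S \<subseteq> lists \<Sigma> \<Longrightarrow>
      (\<And>u. u \<in> lists \<Sigma> \<Longrightarrow> x @ u \<in> L \<Longrightarrow> \<exists>s\<in>S. s @ u \<in> L) \<Longrightarrow> G x \<subseteq> (\<Union>s\<in>S. G s)"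
    using projective_section[OF assms(2)] by blast
  \<comment> \<open>The finitely many words in the chosen preimages of the representatives; the
    second components of the decomposition come from here.\<close>
  define W where "W = (\<Union>x\<in>X. G x)"
  \<comment> \<open>Representatives of the words at which the functional of w vanishes.\<close>
  define K where "K w = {x \<in> X. w \<notin> G x}" for w
  define D where "D = {(u, w). u \<in> U \<and> w \<in> W \<and> (\<forall>x\<in>K w. x @ u \<notin> L)}"
  have "finite (G x)" "G x \<subseteq> lists \<Sigma>" if "x \<in> X" for x
    using GF[of x] X(2) that by blast+
  then have W: "finite W" "W \<subseteq> lists \<Sigma>" using X(1) by (auto simp: W_def)
  have mem: "w \<in> G x \<longleftrightarrow> (\<exists>u. (u, w) \<in> D \<and> x @ u \<in> L)" if x: "x \<in> X" and w: "w \<in> W" for x w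
  proof
    assume wx: "w \<in> G x"
    have xs: "x \<in> lists \<Sigma>" using x X by blast
    have K: "finite (K w)" "K w \<subseteq> lists \<Sigma>" using X by (auto simp: K_def)
    \<comment> \<open>If x were below the sum of \<open>K w\<close>, monotonicity of the splitting
      would put w into \<open>G s\<close> for some s in \<open>K w\<close>. So some word u separates
      x from \<open>K w\<close>.\<close>
    have "\<not> G x \<subseteq> (\<Union>s\<in>K w. G s)" using wx by (auto simp: K_def)
    then obtain u where u: "u \<in> lists \<Sigma>" "x @ u \<in> L" "\<forall>s\<in>K w. s @ u \<notin> L"
      using Gle[OF xs K] by blast
    then obtain u' where u': "u' \<in> U" "\<forall>x\<in>lists \<Sigma>. x @ u \<in> L \<longleftrightarrow> x @ u' \<in> L" using Ur by blast
    have "(u', w) \<in> D" using u' u(3) w K(2) by (auto simp: D_def)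
    moreover have "x @ u' \<in> L" using u' u(2) xs by blast
    ultimately show "\<exists>u. (u, w) \<in> D \<and> x @ u \<in> L" by blast
  next
    assume "\<exists>u. (u, w) \<in> D \<and> x @ u \<in> L"
    then have "x \<notin> K w" by (auto simp: D_def)
    then show "w \<in> G x" using x by (simp add: K_def)
  qed
  have "decomposition_of_identity \<Sigma> L D"
    unfolding decomposition_of_identity_def
  proof (intro conjI ballI)
    show "finite D" by (rule finite_subset[of _ "U \<times> W"]) (use U W in \<open>auto simp: D_def\<close>)
    show "D \<subseteq> lists \<Sigma> \<times> lists \<Sigma>" using U W by (auto simp: D_def)
    fix x y assume x: "x \<in> lists \<Sigma>" and y: "y \<in> lists \<Sigma>"
    \<comment> \<open>\<open>mem\<close> is available at the representatives only, and membership of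
      x @ y in L depends on x only through its representative.\<close>
    obtain x' where x': "x' \<in> X" "\<forall>u\<in>lists \<Sigma>. x @ u \<in> L \<longleftrightarrow> x' @ u \<in> L" using Xr[OF x] by blast
    have xs': "x' \<in> lists \<Sigma>" using x' X by blast
    have DU: "u \<in> lists \<Sigma>" "w \<in> W" if "(u, w) \<in> D" for u w using that U by (auto simp: D_def)
    have "x @ y \<in> L \<longleftrightarrow> (\<exists>w\<in>G x'. w @ y \<in> L)" using x' y G[OF xs' y] by simp
    also have "\<dots> \<longleftrightarrow> (\<exists>w\<in>W. w \<in> G x' \<and> w @ y \<in> L)" using x'(1) by (auto simp: W_def)
    also have "\<dots> \<longleftrightarrow> (\<exists>w\<in>W. (\<exists>u. (u, w) \<in> D \<and> x' @ u \<in> L) \<and> w @ y \<in> L)"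
      using mem[OF x'(1)] by simp
    also have "\<dots> \<longleftrightarrow> (\<exists>(u, w)\<in>D. x @ u \<in> L \<and> w @ y \<in> L)"
      using DU x'(2) by blast
    finally show "x @ y \<in> L \<longleftrightarrow> (\<exists>(u, v)\<in>D. x @ u \<in> L \<and> v @ y \<in> L)" .
  qed
  then show ?thesis by blast
qed

theorem theorem4p12:
  fixes \<Sigma> :: "'a set" and L\<^sub>I :: "'a list set"
  assumes finite_alphabet: "finite \<Sigma>"
    and regular: "regular_language \<Sigma> L\<^sub>I"
    and proj: "projective (state_space_minus \<Sigma> L\<^sub>I)"
  shows "(\<exists>D. decomposition_of_identity \<Sigma> L\<^sub>I D) \<and>
    (\<forall>D \<alpha>. decomposition_of_identity \<Sigma> L\<^sub>I D \<longrightarrow> \<alpha> = (L\<^sub>I, associated_circular \<Sigma> L\<^sub>I D) \<longrightarrow>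
      symmetric_monoidal_functor (Cob_cat \<Sigma>)
        (state_space \<Sigma> \<alpha>) (state_map \<Sigma> \<alpha>) (state_unit \<Sigma> \<alpha>) (state_tensor \<Sigma> \<alpha>) \<and>
      (\<forall>\<epsilon>. state_ntensor \<Sigma> \<alpha> \<epsilon> \<in> biso (ntensor (sign_spaces \<Sigma> \<alpha> \<epsilon>)) (state_space \<Sigma> \<alpha> \<epsilon>)) \<and>
      (\<forall>\<epsilon> \<delta> fs. length \<epsilon> = length fs \<longrightarrow> length \<delta> = length fs \<longrightarrow>
         (\<forall>i<length fs. fs ! i \<in> Cob \<Sigma> [\<epsilon> ! i] [\<delta> ! i]) \<longrightarrow>
         (\<forall>t\<in>carrier (ntensor (sign_spaces \<Sigma> \<alpha> \<epsilon>)).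
            state_map \<Sigma> \<alpha> \<epsilon> \<delta> (cob_tensors \<epsilon> \<delta> fs) (state_ntensor \<Sigma> \<alpha> \<epsilon> t) =
            state_ntensor \<Sigma> \<alpha> \<delta>
              (ntensor_map (sign_spaces \<Sigma> \<alpha> \<delta>)
                 (map (\<lambda>i. state_map \<Sigma> \<alpha> [\<epsilon> ! i] [\<delta> ! i] (fs ! i)) [0..<length fs]) t))) \<and>
      (\<forall>\<epsilon> \<epsilon>'. bend_map \<Sigma> \<alpha> \<epsilon> \<epsilon>' \<in> biso (Hom_eval \<Sigma> \<alpha> \<epsilon> \<epsilon>') (state_space \<Sigma> \<alpha> (dual \<epsilon> @ \<epsilon>')) \<and>
         state_tensor \<Sigma> \<alpha> (dual \<epsilon>) \<epsilon>' \<in>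
           biso (tensor (state_space \<Sigma> \<alpha> (dual \<epsilon>)) (state_space \<Sigma> \<alpha> \<epsilon>'))
                (state_space \<Sigma> \<alpha> (dual \<epsilon> @ \<epsilon>'))) \<and>
      (\<forall>\<delta> \<epsilon> \<epsilon>' \<delta>'. \<forall>h\<in>Cob \<Sigma> \<delta> \<epsilon>. \<forall>g\<in>Cob \<Sigma> \<epsilon>' \<delta>'. \<forall>x\<in>carrier (Hom_eval \<Sigma> \<alpha> \<epsilon> \<epsilon>').
         bend_map \<Sigma> \<alpha> \<delta> \<delta>' (Hom_map \<Sigma> \<alpha> \<delta> \<epsilon> \<epsilon>' \<delta>' h g x) =
         state_map \<Sigma> \<alpha> (dual \<epsilon> @ \<epsilon>') (dual \<delta> @ \<delta>')
           (cob_tensor (dual \<epsilon>) (dual \<delta>) (cob_dual \<delta> \<epsilon> h) g) (bend_map \<Sigma> \<alpha> \<epsilon> \<epsilon>' x)))"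
proof (rule conjI[OF decomposition_exists[OF regular proj]], intro allI impI, goal_cases)
  case (1 D \<alpha>)
  \<comment> \<open>Every decomposition, not only the one constructed above, gives an instance of
    the locale.\<close>
  then interpret A: decomposed_language \<Sigma> L\<^sub>I D by unfold_locales
  show ?case
    unfolding 1(2) A.\<alpha>_def[symmetric]
    by (intro conjI allI impI ballI A.state_space_functor A.state_ntensor_biso
        A.state_ntensor_natural A.bend_map_biso A.state_tensor_biso A.bend_map_natural) blast+
qed

end
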